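(* Let $\mathcal{C}$ be a permutation class and $k$ a positive integer. The following are equivalent. (1) There is a $\mathsf{TOTO}$ formula $\phi(x_1,\dots,x_k)$ such that for all $\sigma\in\mathcal{C}$ and all sequences $\mathbf{a}=(a_1,\dots,a_k)$ of elements of $\sigma$, $(\sigma,\mathbf{a})\models\phi$ if and only if $\mathbf{a}$ is a cycle of $\sigma$ (that is, $a_1,\dots,a_k$ are distinct and the set of their positions forms a single cycle of $\sigma$). (2) For each $k$-cycle $\pi\in S_k$ (permutation of size $k$ consisting of a single cycle), for each non-trivial cycle $\mathbf{i}$ of distinct elements of $[k+1]$, and for each sequence $\overline{\mathcal{X}}$ of the same length as $\mathbf{i}$ whose terms are $\mathcal{I}$ or $\mathcal{D}$, the class $\mathcal{C}$ does not contain all of $E(\pi,\mathbf{i},\overline{\mathcal{X}})$, i.e. $\mathcal{C}$ avoids at least one permutation of $E(\pi,\mathbf{i},\overline{\mathcal{X}})$.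
   Context: Permutations are viewed as finite structures with domain $A^\sigma=\{(i,\sigma(i))\}$, position order $<_P$ (first coordinates) and value order $<_V$ (second coordinates); $\mathsf{TOTO}$ is first-order logic with equality over $\{<_P,<_V\}$. A permutation class is a set of permutations closed under taking patterns; $\mathcal{I}$ and $\mathcal{D}$ are the classes of increasing and of decreasing permutations. An occurrence of $\pi\in S_k$ in $\sigma$ is a sequence $\mathbf{s}=(s_1,\dots,s_k)$ of elements of $\sigma$ with $s_1<_P\dots<_P s_k$ whose pattern is $\pi$; it is stable if the set of positions of $s_1,\dots,s_k$ is mapped to itself by $\sigma$. An occurrence $\mathbf{s}$ of $\pi$ partitions the other elements of $\sigma$ into $(k+1)^2$ cells: two elements are in the same cell iff they compare identically with each $s_j$ in both orders; cells form a $(k+1)\times(k+1)$ grid (columns according to position relative to $\mathbf{s}$, rows according to value, rows indexed from bottom to top). $A(\sigma,\mathbf{s})$ is the $(k+1)\times(k+1)$ matrix whose $(i,j)$ entry is the number of elements in the cell in row $i$, column $j$. For a sequence $\mathbf{i}=(i_1,\dots,i_r)$ of distinct elements of $[k+1]$, $A_{\mathbf{i}}$ is the $(k+1)\times(k+1)$ 0/1 matrix with $1$'s exactly at positions $(i_t,i_{t+1})$ for $1\le t<r$ and $(i_r,i_1)$; $\mathbf{i}$ is non-trivial if $r\ge2$. The expansion $E(\pi,\mathbf{i})$ is the permutation of length $k+r$ containing a stable occurrence $\mathbf{s}$ of $\pi$ with $A(E(\pi,\mathbf{i}),\mathbf{s})=A_{\mathbf{i}}$. For permutations $\Theta=(\theta_1,\dots,\theta_r)$,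 $E(\pi,\mathbf{i},\Theta)$ is obtained by inflating the $r$ points of $E(\pi,\mathbf{i})$ not in $\mathbf{s}$, taken in left-to-right order, by $\theta_1,\dots,\theta_r$ (replacing each point's diagram by that of $\theta_t$). For classes $\overline{\mathcal{X}}=(\mathcal{X}_1,\dots,\mathcal{X}_r)$, $E(\pi,\mathbf{i},\overline{\mathcal{X}})$ is the class of all patterns of permutations $E(\pi,\mathbf{i},\Theta)$ with $\theta_t\in\mathcal{X}_t$ for all $t$. *)

theory Defs
  imports "HOL-Combinatorics.Combinatorics" "HOL-Library.FuncSet"
begin

section \<open>Permutations as finite structures\<close>

text \<open>A permutation is stored with its size \<open>n\<close>, since a function permuting \<open>{1..n}\<close>
  does not determine \<open>n\<close>. Only values satisfying \<open>is_perm\<close> are meant. The empty permutation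
  is allowed.\<close>

datatype fperm = FPerm (len: nat) (app: "nat \<Rightarrow> nat")

definition is_perm :: "fperm \<Rightarrow> bool" where
  "is_perm \<sigma> \<longleftrightarrow> app \<sigma> permutes {1..len \<sigma>}"

type_synonym elem = "nat \<times> nat"

definition elems :: "fperm \<Rightarrow> elem set" where
  "elems \<sigma> = {(i, app \<sigma> i) | i. i \<in> {1..len \<sigma>}}"

definition less_P :: "elem \<Rightarrow> elem \<Rightarrow> bool" (infix "<\<^sub>P" 50) where
  "x <\<^sub>P y \<longleftrightarrow> fst x < fst y"

definition less_V :: "elem \<Rightarrow> elem \<Rightarrow> bool" (infix "<\<^sub>V" 50) where
  "x <\<^sub>V y \<longleftrightarrow> snd x < snd y"

section \<open>The logic TOTO\<close>

text \<open>Variables are named by natural numbers; the remaining connectives and the universal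
  quantifier are expressible from the ones below.\<close>

datatype toto =
    EqF nat nat
  | LessP nat nat
  | LessV nat nat
  | Neg toto
  | Conj toto toto
  | Ex nat toto

primrec fv :: "toto \<Rightarrow> nat set" where
  "fv (EqF x y) = {x, y}"
| "fv (LessP x y) = {x, y}"
| "fv (LessV x y) = {x, y}"
| "fv (Neg \<phi>) = fv \<phi>"
| "fv (Conj \<phi> \<psi>) = fv \<phi> \<union> fv \<psi>"
| "fv (Ex x \<phi>) = fv \<phi> - {x}"

primrec sat :: "fperm \<Rightarrow> (nat \<Rightarrow> elem) \<Rightarrow> toto \<Rightarrow> bool" where
  "sat \<sigma> a (EqF x y) \<longleftrightarrow> a x = a y"
| "sat \<sigma> a (LessP x y) \<longleftrightarrow> a x <\<^sub>P a y"
| "sat \<sigma> a (LessV x y) \<longleftrightarrow> a x <\<^sub>V a y"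
| "sat \<sigma> a (Neg \<phi>) \<longleftrightarrow> \<not> sat \<sigma> a \<phi>"
| "sat \<sigma> a (Conj \<phi> \<psi>) \<longleftrightarrow> sat \<sigma> a \<phi> \<and> sat \<sigma> a \<psi>"
| "sat \<sigma> a (Ex x \<phi>) \<longleftrightarrow> (\<exists>e\<in>elems \<sigma>. sat \<sigma> (a(x := e)) \<phi>)"

section \<open>Patterns, occurrences and classes\<close>

text \<open>A sequence of \<open>k\<close> elements of \<open>\<sigma>\<close> is a function in \<open>{1..k} \<rightarrow> elems \<sigma>\<close>; its values outside
  \<open>{1..k}\<close> are irrelevant.\<close>

definition positions :: "nat \<Rightarrow> (nat \<Rightarrow> elem) \<Rightarrow> nat set" where
  "positions k s = fst ` s ` {1..k}"

definition occurrence :: "fperm \<Rightarrow> fperm \<Rightarrow> (nat \<Rightarrow> elem) \<Rightarrow> bool" where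
  "occurrence \<pi> \<sigma> s \<longleftrightarrow>
     s \<in> {1..len \<pi>} \<rightarrow> elems \<sigma> \<and>
     (\<forall>i\<in>{1..len \<pi>}. \<forall>j\<in>{1..len \<pi>}. i < j \<longrightarrow> s i <\<^sub>P s j) \<and>
     (\<forall>i\<in>{1..len \<pi>}. \<forall>j\<in>{1..len \<pi>}. s i <\<^sub>V s j \<longleftrightarrow> app \<pi> i < app \<pi> j)"

definition is_pattern_of :: "fperm \<Rightarrow> fperm \<Rightarrow> bool" where
  "is_pattern_of \<pi> \<sigma> \<longleftrightarrow> (\<exists>s. occurrence \<pi> \<sigma> s)"

definition perm_class :: "fperm set \<Rightarrow> bool" where
  "perm_class \<C> \<longleftrightarrow>
     (\<forall>\<sigma>\<in>\<C>. is_perm \<sigma>) \<and>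
     (\<forall>\<sigma>\<in>\<C>. \<forall>\<pi>. is_perm \<pi> \<and> is_pattern_of \<pi> \<sigma> \<longrightarrow> \<pi> \<in> \<C>)"

definition Increasing :: "fperm set" where
  "Increasing = {\<sigma>. is_perm \<sigma> \<and> monotone_on {1..len \<sigma>} (<) (<) (app \<sigma>)}"

definition Decreasing :: "fperm set" where
  "Decreasing = {\<sigma>. is_perm \<sigma> \<and> monotone_on {1..len \<sigma>} (<) (>) (app \<sigma>)}"

section \<open>Cycles\<close>

definition is_cycle_of :: "fperm \<Rightarrow> nat \<Rightarrow> (nat \<Rightarrow> elem) \<Rightarrow> bool" where
  "is_cycle_of \<sigma> k a \<longleftrightarrow> inj_on a {1..k} \<and> cyclic_on (app \<sigma>) (positions k a)"

definition k_cycle :: "nat \<Rightarrow> fperm \<Rightarrow> bool" where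
  "k_cycle k \<pi> \<longleftrightarrow> is_perm \<pi> \<and> len \<pi> = k \<and> cyclic_on (app \<pi>) {1..k}"

section \<open>Cells and expansions\<close>

definition stable :: "fperm \<Rightarrow> nat \<Rightarrow> (nat \<Rightarrow> elem) \<Rightarrow> bool" where
  "stable \<sigma> k s \<longleftrightarrow> app \<sigma> ` positions k s = positions k s"

text \<open>Rows and columns are numbered \<open>1, \<dots>, k + 1\<close>. An element lies in column \<open>j\<close> (row \<open>i\<close>) iff
  exactly \<open>j - 1\<close> (\<open>i - 1\<close>) of the \<open>s\<^sub>t\<close> precede it by position (value).\<close>

definition cell :: "fperm \<Rightarrow> nat \<Rightarrow> (nat \<Rightarrow> elem) \<Rightarrow> nat \<Rightarrow> nat \<Rightarrow> elem set" where
  "cell \<sigma> k s i j = {x \<in> elems \<sigma> - s ` {1..k}.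
     Suc (card {t\<in>{1..k}. s t <\<^sub>V x}) = i \<and> Suc (card {t\<in>{1..k}. s t <\<^sub>P x}) = j}"

definition cell_matrix :: "fperm \<Rightarrow> nat \<Rightarrow> (nat \<Rightarrow> elem) \<Rightarrow> nat \<Rightarrow> nat \<Rightarrow> nat" where
  "cell_matrix \<sigma> k s i j = card (cell \<sigma> k s i j)"

text \<open>The pairs in \<open>zip is (rotate1 is)\<close> are \<open>(i\<^sub>t, i\<^sub>t\<^sub>+\<^sub>1)\<close> for \<open>t < r\<close>, and \<open>(i\<^sub>r, i\<^sub>1)\<close>.\<close>

definition cyc_matrix :: "nat list \<Rightarrow> nat \<Rightarrow> nat \<Rightarrow> nat" where
  "cyc_matrix is i j = (if (i, j) \<in> set (zip is (rotate1 is)) then 1 else 0)"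

definition nontrivial_cycle :: "nat \<Rightarrow> nat list \<Rightarrow> bool" where
  "nontrivial_cycle k is \<longleftrightarrow> distinct is \<and> set is \<subseteq> {1..k+1} \<and> length is \<ge> 2"

text \<open>\<open>is_expansion \<pi> is \<tau> s\<close>: \<open>\<tau>\<close> is \<open>E(\<pi>, is)\<close> and \<open>s\<close> is its distinguished occurrence of \<open>\<pi>\<close>.
  The matrix has at most one entry in each row and column, so it determines \<open>\<tau>\<close> and the
  restriction of \<open>s\<close> to \<open>{1..len \<pi>}\<close>.\<close>

definition is_expansion :: "fperm \<Rightarrow> nat list \<Rightarrow> fperm \<Rightarrow> (nat \<Rightarrow> elem) \<Rightarrow> bool" where
  "is_expansion \<pi> is \<tau> s \<longleftrightarrow>
     is_perm \<tau> \<and> len \<tau> = len \<pi> + length is \<and>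
     occurrence \<pi> \<tau> s \<and> stable \<tau> (len \<pi>) s \<and>
     (\<forall>i\<in>{1..len \<pi> + 1}. \<forall>j\<in>{1..len \<pi> + 1}. cell_matrix \<tau> (len \<pi>) s i j = cyc_matrix is i j)"

section \<open>Inflations\<close>

text \<open>In the inflation of \<open>\<tau>\<close> by \<open>\<Theta>\<close>, the point of \<open>\<tau>\<close> at position \<open>p\<close> is replaced by the diagram of
  \<open>\<Theta> p\<close>: the block of \<open>p\<close> starts after \<open>pos_offset\<close> positions and \<open>val_offset\<close> values.\<close>

definition pos_offset :: "(nat \<Rightarrow> fperm) \<Rightarrow> nat \<Rightarrow> nat" where
  "pos_offset \<Theta> p = (\<Sum>p'\<in>{1..<p}. len (\<Theta> p'))"

definition val_offset :: "fperm \<Rightarrow> (nat \<Rightarrow> fperm) \<Rightarrow> nat \<Rightarrow> nat" where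
  "val_offset \<tau> \<Theta> p = (\<Sum>p'\<in>{p'\<in>{1..len \<tau>}. app \<tau> p' < app \<tau> p}. len (\<Theta> p'))"

definition is_inflation :: "fperm \<Rightarrow> (nat \<Rightarrow> fperm) \<Rightarrow> fperm \<Rightarrow> bool" where
  "is_inflation \<tau> \<Theta> \<omega> \<longleftrightarrow>
     is_perm \<omega> \<and> len \<omega> = (\<Sum>p\<in>{1..len \<tau>}. len (\<Theta> p)) \<and>
     (\<forall>p\<in>{1..len \<tau>}. \<forall>q\<in>{1..len (\<Theta> p)}.
        app \<omega> (pos_offset \<Theta> p + q) = val_offset \<tau> \<Theta> p + app (\<Theta> p) q)"

text \<open>Points of \<open>\<tau>\<close> at positions in \<open>S\<close> are kept (inflated by the permutation of size 1); the
  others are inflated, from left to right, by the members of the list \<open>\<Theta>\<close>.\<close>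

definition inflators :: "nat set \<Rightarrow> fperm list \<Rightarrow> nat \<Rightarrow> fperm" where
  "inflators S \<Theta> p = (if p \<in> S then FPerm 1 id else \<Theta> ! card ({1..<p} - S))"

text \<open>\<open>is_inflated_expansion \<pi> is \<Theta> \<omega>\<close>: \<open>\<omega>\<close> is \<open>E(\<pi>, is, \<Theta>)\<close>.\<close>

definition is_inflated_expansion :: "fperm \<Rightarrow> nat list \<Rightarrow> fperm list \<Rightarrow> fperm \<Rightarrow> bool" where
  "is_inflated_expansion \<pi> is \<Theta> \<omega> \<longleftrightarrow>
     (\<exists>\<tau> s. is_expansion \<pi> is \<tau> s \<and> is_inflation \<tau> (inflators (positions (len \<pi>) s) \<Theta>) \<omega>)"

definition expansion_class :: "fperm \<Rightarrow> nat list \<Rightarrow> fperm set list \<Rightarrow> fperm set" where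
  "expansion_class \<pi> is \<X> =
     {\<rho>. is_perm \<rho> \<and> (\<exists>\<Theta> \<omega>. list_all2 (\<in>) \<Theta> \<X> \<and> is_inflated_expansion \<pi> is \<Theta> \<omega> \<and>
          is_pattern_of \<rho> \<omega>)}"

end

theory Submission
  imports Defs "HOL-Library.Ramsey"
begin

text \<open>If \<open>\<C>\<close> contains a whole class \<open>E(\<pi>, i, X)\<close>, inflate every new point of \<open>E(\<pi>, i)\<close> by a
  long monotone permutation. Adding one point to a single block is invisible to formulas of bounded
  quantifier rank, but the distinguished occurrence of \<open>\<pi>\<close> is no longer stable, since the row and the
  column of that block are different.

  Conversely, an occurrence of a \<open>k\<close>-cycle \<open>\<pi>\<close> is stable iff its cell matrix has equal \<open>i\<close>-th row and
  column sums for all \<open>i\<close>, that is, iff the matrix is a circulation on \<open>{1..k+1}\<close>. If all cells along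
  a non-trivial cycle are large, then by Ramsey's theorem they contain long monotone sequences and
  these together contain any given member of the corresponding \<open>E(\<pi>, i, X)\<close>. Hence, if \<open>\<C>\<close> contains no
  such class, the edges of large weight form an acyclic digraph, and cutting a circulation at the
  set of vertices reachable from the head of an edge bounds the weight of that edge. So all
  off-diagonal entries are bounded, and only finitely many matrices have to be described by
  the formula.\<close>

section \<open>Inserting a point into a long block\<close>

text \<open>TOTO never compares a position with a value, so no formula can directly say that
  \<sigma> sends one position to another; it can only compare and count. Counting suffices because a
  point of the occurrence stands at its index plus the number of other points in the columns to its
  left, and likewise for values and rows: stability turns into an equality of prefix sums of row and
  column sums. A diagonal cell adds the same amount to its row and to its column. It may be
  arbitrarily large without harm, which is why only cycles of length at least 2 obstruct
  definability. For the other direction, new blocks of one common length keep the occurrence stable,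
  since they form a multiple of the unit circulation along the cycle. Indistinguishability is an
  Ehrenfeucht-Fraisse game played as an induction on formulas. In a monotone block any point can be
  regarded as the additional one, so the place of insertion is not fixed but retreats from each
  quantified element. Containment of inflated expansions is checked by integer keys that depend only
  on a cell or on an index in the occurrence and so have the same meaning in two
  permutations.\<close>

primrec qrank :: "toto \<Rightarrow> nat" where
  "qrank (EqF x y) = 0"
| "qrank (LessP x y) = 0"
| "qrank (LessV x y) = 0"
| "qrank (Neg \<phi>) = qrank \<phi>"
| "qrank (Conj \<phi> \<psi>) = max (qrank \<phi>) (qrank \<psi>)"
| "qrank (Ex x \<phi>) = Suc (qrank \<phi>)"

text \<open>The value that it misses, \<open>c + 1\<close>, is the position of the inserted
  point.\<close>

definition shift :: "nat \<Rightarrow> nat \<Rightarrow> nat" where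
  "shift c i = (if i \<le> c then i else Suc i)"

lemma shift_eq_iff [simp]: "shift c i = shift c j \<longleftrightarrow> i = j"
  by (auto simp: shift_def)

lemma shift_less_iff [simp]: "shift c i < shift c j \<longleftrightarrow> i < j"
  by (auto simp: shift_def)

lemma elemsD:
  assumes "x \<in> elems \<sigma>"
  shows "fst x \<in> {1..len \<sigma>}" "snd x = app \<sigma> (fst x)"
  using assms by (auto simp: elems_def)

lemma elemsI: "i \<in> {1..len \<sigma>} \<Longrightarrow> (i, app \<sigma> i) \<in> elems \<sigma>"
  by (auto simp: elems_def)

lemma elems_eq_iff: "x \<in> elems \<sigma> \<Longrightarrow> y \<in> elems \<sigma> \<Longrightarrow> x = y \<longleftrightarrow> fst x = fst y"
  by (auto simp: elems_def)

text \<open>By \<open>emb\<close>, removing any one of the positions \<open>lo + 1\<close> to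
  \<open>hi + 1\<close> from the larger permutation leaves a copy of the smaller one, so the cut
  \<open>c\<close> can be chosen anew after each quantifier. The base 3 pays for this: if
  \<open>d\<close> is the margin left afterwards, the cut moves by at most \<open>2 * d\<close> and
  must still keep distance \<open>d\<close> from the old variables and from both ends of the
  window.\<close>

lemma sat_insert_point:
  assumes len: "len \<sigma>' = Suc (len \<sigma>)"
    and hi: "hi \<le> len \<sigma>"
    and emb: "\<And>c i j. lo \<le> c \<Longrightarrow> c \<le> hi \<Longrightarrow> i \<in> {1..len \<sigma>} \<Longrightarrow> j \<in> {1..len \<sigma>} \<Longrightarrow>
               app \<sigma> i < app \<sigma> j \<longleftrightarrow> app \<sigma>' (shift c i) < app \<sigma>' (shift c j)"
    and cut: "lo + 3 ^ qrank \<phi> \<le> c" "c + 3 ^ qrank \<phi> \<le> hi"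
    and a: "\<And>x. x \<in> fv \<phi> \<Longrightarrow> a x \<in> elems \<sigma> \<and> a' x \<in> elems \<sigma>' \<and> fst (a' x) = shift c (fst (a x)) \<and>
              (fst (a x) + 3 ^ qrank \<phi> \<le> c \<or> c + 3 ^ qrank \<phi> < fst (a x))"
  shows "sat \<sigma> a \<phi> \<longleftrightarrow> sat \<sigma>' a' \<phi>"
  using cut a
proof (induction \<phi> arbitrary: c a a')
  case (EqF x y)
  have "a x \<in> elems \<sigma>" "a y \<in> elems \<sigma>" "a' x \<in> elems \<sigma>'" "a' y \<in> elems \<sigma>'"
    and *: "fst (a' x) = shift c (fst (a x))" "fst (a' y) = shift c (fst (a y))"
    using EqF.prems(3)[of x] EqF.prems(3)[of y] by auto
  then have "a x = a y \<longleftrightarrow> fst (a x) = fst (a y)" "a' x = a' y \<longleftrightarrow> fst (a' x) = fst (a' y)"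
    by (auto simp: elems_eq_iff)
  then show ?case by (simp add: *)
next
  case (LessP x y)
  then show ?case
    using LessP.prems(3)[of x] LessP.prems(3)[of y] by (simp add: less_P_def)
next
  case (LessV x y)
  have "a x \<in> elems \<sigma>" "a y \<in> elems \<sigma>" "a' x \<in> elems \<sigma>'" "a' y \<in> elems \<sigma>'"
    "fst (a' x) = shift c (fst (a x))" "fst (a' y) = shift c (fst (a y))"
    using LessV.prems(3)[of x] LessV.prems(3)[of y] by auto
  moreover from this have "app \<sigma> (fst (a x)) < app \<sigma> (fst (a y)) \<longleftrightarrow>
      app \<sigma>' (shift c (fst (a x))) < app \<sigma>' (shift c (fst (a y)))"
    using LessV.prems(1,2) by (intro emb elemsD) auto
  ultimately show ?case by (simp add: less_V_def elemsD)
next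
  case (Neg \<phi>)
  then show ?case by simp
next
  case (Conj \<phi> \<psi>)
  have le: "(3::nat) ^ qrank \<phi> \<le> 3 ^ qrank (Conj \<phi> \<psi>)" "(3::nat) ^ qrank \<psi> \<le> 3 ^ qrank (Conj \<phi> \<psi>)"
    by (auto intro: power_increasing)
  have "sat \<sigma> a \<phi> = sat \<sigma>' a' \<phi>"
  proof (rule Conj.IH(1))
    show "lo + 3 ^ qrank \<phi> \<le> c" "c + 3 ^ qrank \<phi> \<le> hi"
      using Conj.prems(1,2) le by linarith+
    show "a x \<in> elems \<sigma> \<and> a' x \<in> elems \<sigma>' \<and> fst (a' x) = shift c (fst (a x)) \<and>
        (fst (a x) + 3 ^ qrank \<phi> \<le> c \<or> c + 3 ^ qrank \<phi> < fst (a x))" if "x \<in> fv \<phi>" for x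
    proof -
      have "x \<in> fv (Conj \<phi> \<psi>)" using that by simp
      from Conj.prems(3)[OF this] le show ?thesis by linarith
    qed
  qed
  moreover have "sat \<sigma> a \<psi> = sat \<sigma>' a' \<psi>"
  proof (rule Conj.IH(2))
    show "lo + 3 ^ qrank \<psi> \<le> c" "c + 3 ^ qrank \<psi> \<le> hi"
      using Conj.prems(1,2) le by linarith+
    show "a x \<in> elems \<sigma> \<and> a' x \<in> elems \<sigma>' \<and> fst (a' x) = shift c (fst (a x)) \<and>
        (fst (a x) + 3 ^ qrank \<psi> \<le> c \<or> c + 3 ^ qrank \<psi> < fst (a x))" if "x \<in> fv \<psi>" for x
    proof -
      have "x \<in> fv (Conj \<phi> \<psi>)" using that by simp
      from Conj.prems(3)[OF this] le show ?thesis by linarith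
    qed
  qed
  ultimately show ?case by simp
next
  case (Ex x \<phi>)
  define d :: nat where "d = 3 ^ qrank \<phi>"
  have d: "3 ^ qrank (Ex x \<phi>) = 3 * d" "1 \<le> d" by (auto simp: d_def)
  note cut = Ex.prems(1,2)[unfolded d]
  \<comment> \<open>The cut may be moved by up to \<open>2 * d\<close> without affecting the images of the old variables, so it can
    always be moved away from the new element.\<close>
  have step: "sat \<sigma> (a(x := e)) \<phi> = sat \<sigma>' (a'(x := e')) \<phi>"
    if e: "e \<in> elems \<sigma>" "e' \<in> elems \<sigma>'" "fst e' = shift c' (fst e)"
      and c': "c \<le> c' + d" "c' \<le> c + 2 * d" and far: "fst e + d \<le> c' \<or> c' + d < fst e" for e e' c'
  proof (rule Ex.IH[of c'])
    show "lo + 3 ^ qrank \<phi> \<le> c'" "c' + 3 ^ qrank \<phi> \<le> hi"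
      using cut c' by (auto simp flip: d_def)
    fix y assume y: "y \<in> fv \<phi>"
    show "(a(x := e)) y \<in> elems \<sigma> \<and> (a'(x := e')) y \<in> elems \<sigma>' \<and>
        fst ((a'(x := e')) y) = shift c' (fst ((a(x := e)) y)) \<and>
        (fst ((a(x := e)) y) + 3 ^ qrank \<phi> \<le> c' \<or> c' + 3 ^ qrank \<phi> < fst ((a(x := e)) y))"
    proof (cases "y = x")
      case True
      then show ?thesis using e far by (simp flip: d_def)
    next
      case False
      then have *: "a y \<in> elems \<sigma> \<and> a' y \<in> elems \<sigma>' \<and> fst (a' y) = shift c (fst (a y)) \<and>
          (fst (a y) + 3 * d \<le> c \<or> c + 3 * d < fst (a y))"
        using Ex.prems(3)[of y] y unfolding d by simp
      from * have "shift c (fst (a y)) = shift c' (fst (a y))"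
        using c' d by (auto simp: shift_def)
      moreover from * have "fst (a y) + d \<le> c' \<or> c' + d < fst (a y)"
        using c' by linarith
      ultimately show ?thesis using * False by (simp flip: d_def)
    qed
  qed
  show ?case
  proof
    assume "sat \<sigma> a (Ex x \<phi>)"
    then obtain e where e: "e \<in> elems \<sigma>" "sat \<sigma> (a(x := e)) \<phi>" by auto
    define c' where "c' = (if fst e \<le> c then c + d else c - d)"
    define e' where "e' = (shift c' (fst e), app \<sigma>' (shift c' (fst e)))"
    have "shift c' (fst e) \<in> {1..len \<sigma>'}"
      using elemsD(1)[OF e(1)] len by (auto simp: shift_def)
    then have "e' \<in> elems \<sigma>'" by (auto simp: e'_def intro: elemsI)
    moreover have "sat \<sigma>' (a'(x := e')) \<phi>"
      using e(2) step[OF e(1) \<open>e' \<in> elems \<sigma>'\<close>, of c'] cut by (auto simp: c'_def e'_def)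
    ultimately show "sat \<sigma>' a' (Ex x \<phi>)" by auto
  next
    assume "sat \<sigma>' a' (Ex x \<phi>)"
    then obtain e' where e': "e' \<in> elems \<sigma>'" "sat \<sigma>' (a'(x := e')) \<phi>" by auto
    \<comment> \<open>Position \<open>c + 1\<close> is missed by \<open>shift c\<close>, so an
      element there is placed below the new cut. Then \<open>p = c + 1\<close>, and moving the cut
      by \<open>d\<close> alone would leave it too close; \<open>2 * d\<close> is enough as
      \<open>1 \<le> d\<close>.\<close>
    define p where "p = (if fst e' \<le> Suc c then fst e' else fst e' - 1)"
    define c' where "c' = (if fst e' \<le> Suc c then c + 2 * d else c - d)"
    have "p \<in> {1..len \<sigma>}"
      using elemsD(1)[OF e'(1)] len cut hi d by (auto simp: p_def)
    then have e: "(p, app \<sigma> p) \<in> elems \<sigma>" by (rule elemsI)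
    have "fst e' = shift c' p" "c \<le> c' + d" "c' \<le> c + 2 * d" "p + d \<le> c' \<or> c' + d < p"
      using cut d(2) unfolding p_def c'_def shift_def by auto
    then have "sat \<sigma> (a(x := (p, app \<sigma> p))) \<phi>"
      using e'(2) step[OF e e'(1), of c'] by simp
    then show "sat \<sigma> a (Ex x \<phi>)" using e by auto
  qed
qed

section \<open>Inflations\<close>

lemma is_permD:
  assumes "is_perm \<sigma>" "i \<in> {1..len \<sigma>}"
  shows "app \<sigma> i \<in> {1..len \<sigma>}"
  using assms permutes_in_image[of "app \<sigma>"] unfolding is_perm_def by blast

lemma is_perm_app_eq_iff: "is_perm \<sigma> \<Longrightarrow> app \<sigma> i = app \<sigma> j \<longleftrightarrow> i = j"
  unfolding is_perm_def by (metis permutes_inverses(2))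

text \<open>A pair addresses a point of the inflation by its block and its index in the block. Both
  coordinates of points compare addresses lexicographically, first by block and then inside the
  block.\<close>

definition block_index :: "fperm \<Rightarrow> (nat \<Rightarrow> fperm) \<Rightarrow> (nat \<times> nat) set" where
  "block_index \<tau> \<Theta> = (SIGMA p:{1..len \<tau>}. {1..len (\<Theta> p)})"

definition block_pos :: "(nat \<Rightarrow> fperm) \<Rightarrow> nat \<times> nat \<Rightarrow> nat" where
  "block_pos \<Theta> x = pos_offset \<Theta> (fst x) + snd x"

definition block_val :: "fperm \<Rightarrow> (nat \<Rightarrow> fperm) \<Rightarrow> nat \<times> nat \<Rightarrow> nat" where
  "block_val \<tau> \<Theta> x = val_offset \<tau> \<Theta> (fst x) + app (\<Theta> (fst x)) (snd x)"

lemma block_index_app: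
  assumes "(p, q) \<in> block_index \<tau> \<Theta>" "\<And>p. p \<in> {1..len \<tau>} \<Longrightarrow> is_perm (\<Theta> p)"
  shows "app (\<Theta> p) q \<in> {1..len (\<Theta> p)}"
  using is_permD[of "\<Theta> p" q] assms by (auto simp: block_index_def)

lemma pos_offset_mono: "p \<le> p' \<Longrightarrow> pos_offset \<Theta> p \<le> pos_offset \<Theta> p'"
  unfolding pos_offset_def by (rule sum_mono2) auto

lemma pos_offset_Suc: "1 \<le> p \<Longrightarrow> pos_offset \<Theta> (Suc p) = pos_offset \<Theta> p + len (\<Theta> p)"
  by (auto simp: pos_offset_def atLeastLessThanSuc)

lemma pos_offset_less:
  assumes "1 \<le> p" "p < p'"
  shows "pos_offset \<Theta> p + len (\<Theta> p) \<le> pos_offset \<Theta> p'"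
  using pos_offset_mono[of "Suc p" p' \<Theta>] pos_offset_Suc[of p \<Theta>] assms by simp

lemma val_offset_less:
  assumes "p \<in> {1..len \<tau>}" "app \<tau> p < app \<tau> p'"
  shows "val_offset \<tau> \<Theta> p + len (\<Theta> p) \<le> val_offset \<tau> \<Theta> p'"
proof -
  let ?A = "{p' \<in> {1..len \<tau>}. app \<tau> p' < app \<tau> p}"
  have "val_offset \<tau> \<Theta> p + len (\<Theta> p) = (\<Sum>p'\<in>insert p ?A. len (\<Theta> p'))"
    by (simp add: val_offset_def)
  also have "\<dots> \<le> val_offset \<tau> \<Theta> p'"
    unfolding val_offset_def by (rule sum_mono2) (use assms in auto)
  finally show ?thesis .
qed

lemma block_pos_less_iff:
  assumes "(p, q) \<in> block_index \<tau> \<Theta>" "(p', q') \<in> block_index \<tau> \<Theta>"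
  shows "block_pos \<Theta> (p, q) < block_pos \<Theta> (p', q') \<longleftrightarrow> p < p' \<or> p = p' \<and> q < q'"
  using assms pos_offset_less[of p p' \<Theta>] pos_offset_less[of p' p \<Theta>]
  by (cases p p' rule: linorder_cases) (auto simp: block_pos_def block_index_def)

lemma block_val_less_iff:
  assumes "is_perm \<tau>" "\<And>p. p \<in> {1..len \<tau>} \<Longrightarrow> is_perm (\<Theta> p)"
    and "(p, q) \<in> block_index \<tau> \<Theta>" "(p', q') \<in> block_index \<tau> \<Theta>"
  shows "block_val \<tau> \<Theta> (p, q) < block_val \<tau> \<Theta> (p', q') \<longleftrightarrow>
    app \<tau> p < app \<tau> p' \<or> p = p' \<and> app (\<Theta> p) q < app (\<Theta> p) q'"
proof -
  have "app (\<Theta> p) q \<in> {1..len (\<Theta> p)}" "app (\<Theta> p') q' \<in> {1..len (\<Theta> p')}"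
    using assms(3,4) assms(2) by (blast intro: block_index_app)+
  then show ?thesis
    using assms(3,4) val_offset_less[of p \<tau> p' \<Theta>] val_offset_less[of p' \<tau> p \<Theta>]
      is_perm_app_eq_iff[OF assms(1), of p p']
    by (cases "app \<tau> p" "app \<tau> p'" rule: linorder_cases) (auto simp: block_val_def block_index_def)
qed

lemma bij_betw_block_pos:
  "bij_betw (block_pos \<Theta>) (block_index \<tau> \<Theta>) {1..\<Sum>p\<in>{1..len \<tau>}. len (\<Theta> p)}"
  (is "bij_betw _ ?B {1..?n}")
proof -
  have inj: "inj_on (block_pos \<Theta>) ?B"
  proof (rule inj_onI, clarify)
    fix p q p' q' assume "(p, q) \<in> ?B" "(p', q') \<in> ?B" "block_pos \<Theta> (p, q) = block_pos \<Theta> (p', q')"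
    then have "\<not> (p < p' \<or> p = p' \<and> q < q')" "\<not> (p' < p \<or> p' = p \<and> q' < q)"
      using block_pos_less_iff[of p q \<tau> \<Theta> p' q'] block_pos_less_iff[of p' q' \<tau> \<Theta> p q] by auto
    then show "p = p' \<and> q = q'" by auto
  qed
  have "block_pos \<Theta> ` ?B \<subseteq> {1..?n}"
  proof (rule image_subsetI, clarify)
    fix p q assume pq: "(p, q) \<in> ?B"
    have "block_pos \<Theta> (p, q) \<le> pos_offset \<Theta> (Suc (len \<tau>))"
      using pq pos_offset_less[of p "Suc (len \<tau>)" \<Theta>] by (auto simp: block_pos_def block_index_def)
    also have "\<dots> = ?n" by (simp add: pos_offset_def atLeastLessThanSuc_atLeastAtMost)
    finally show "block_pos \<Theta> (p, q) \<in> {1..?n}"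
      using pq by (auto simp: block_pos_def block_index_def)
  qed
  moreover have "card (block_pos \<Theta> ` ?B) = card {1..?n}"
    using inj by (simp add: card_image block_index_def)
  ultimately have "block_pos \<Theta> ` ?B = {1..?n}" by (intro card_subset_eq) auto
  with inj show ?thesis by (simp add: bij_betw_def)
qed

lemma bij_betw_block_val:
  assumes "is_perm \<tau>" "\<And>p. p \<in> {1..len \<tau>} \<Longrightarrow> is_perm (\<Theta> p)"
  shows "bij_betw (block_val \<tau> \<Theta>) (block_index \<tau> \<Theta>) {1..\<Sum>p\<in>{1..len \<tau>}. len (\<Theta> p)}"
  (is "bij_betw _ ?B {1..?n}")
proof -
  have inj: "inj_on (block_val \<tau> \<Theta>) ?B"
  proof (rule inj_onI, clarify)
    fix p q p' q' assume *: "(p, q) \<in> ?B" "(p', q') \<in> ?B" "block_val \<tau> \<Theta> (p, q) = block_val \<tau> \<Theta> (p', q')"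
    then have "\<not> (app \<tau> p < app \<tau> p' \<or> p = p' \<and> app (\<Theta> p) q < app (\<Theta> p) q')"
      "\<not> (app \<tau> p' < app \<tau> p \<or> p' = p \<and> app (\<Theta> p') q' < app (\<Theta> p') q)"
      using block_val_less_iff[of \<tau> \<Theta> p q p' q'] block_val_less_iff[of \<tau> \<Theta> p' q' p q] assms by auto
    then have "app \<tau> p = app \<tau> p' \<and> (p = p' \<longrightarrow> app (\<Theta> p) q = app (\<Theta> p) q')" by auto
    then show "p = p' \<and> q = q'"
      using * is_perm_app_eq_iff[OF assms(1)] is_perm_app_eq_iff[OF assms(2)[of p]]
      by (auto simp: block_index_def)
  qed
  have "block_val \<tau> \<Theta> ` ?B \<subseteq> {1..?n}"
  proof (rule image_subsetI, clarify)
    fix p q assume pq: "(p, q) \<in> ?B"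
    have *: "app (\<Theta> p) q \<in> {1..len (\<Theta> p)}" "p \<in> {1..len \<tau>}"
      using block_index_app[OF pq assms(2)] pq by (auto simp: block_index_def)
    let ?A = "{p' \<in> {1..len \<tau>}. app \<tau> p' < app \<tau> p}"
    have "block_val \<tau> \<Theta> (p, q) \<le> (\<Sum>p'\<in>insert p ?A. len (\<Theta> p'))"
      using * by (simp add: val_offset_def block_val_def)
    also have "\<dots> \<le> ?n" by (rule sum_mono2) (use * in auto)
    finally show "block_val \<tau> \<Theta> (p, q) \<in> {1..?n}"
      using * by (auto simp: block_val_def)
  qed
  moreover have "card (block_val \<tau> \<Theta> ` ?B) = card {1..?n}"
    using inj by (simp add: card_image block_index_def)
  ultimately have "block_val \<tau> \<Theta> ` ?B = {1..?n}" by (intro card_subset_eq) auto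
  with inj show ?thesis by (simp add: bij_betw_def)
qed

lemma is_inflation_iff:
  "is_inflation \<tau> \<Theta> \<omega> \<longleftrightarrow> is_perm \<omega> \<and> len \<omega> = (\<Sum>p\<in>{1..len \<tau>}. len (\<Theta> p)) \<and>
     (\<forall>x\<in>block_index \<tau> \<Theta>. app \<omega> (block_pos \<Theta> x) = block_val \<tau> \<Theta> x)"
  by (auto simp: is_inflation_def block_index_def block_pos_def block_val_def)

lemma ex_inflation:
  assumes "is_perm \<tau>" "\<And>p. p \<in> {1..len \<tau>} \<Longrightarrow> is_perm (\<Theta> p)"
  shows "\<exists>\<omega>. is_inflation \<tau> \<Theta> \<omega>"
proof -
  let ?n = "\<Sum>p\<in>{1..len \<tau>}. len (\<Theta> p)"
  let ?P = "block_pos \<Theta>" and ?V = "block_val \<tau> \<Theta>" and ?B = "block_index \<tau> \<Theta>"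
  \<comment> \<open>Position to address to value; the identity elsewhere, as \<open>permutes\<close>
    demands.\<close>
  define f where "f = (\<lambda>i. if i \<in> {1..?n} then ?V (the_inv_into ?B ?P i) else i)"
  have P: "bij_betw ?P ?B {1..?n}" by (rule bij_betw_block_pos)
  have "bij_betw (?V \<circ> the_inv_into ?B ?P) {1..?n} {1..?n}"
    using bij_betw_the_inv_into[OF P] bij_betw_block_val[of \<tau> \<Theta>, OF assms] by (rule bij_betw_trans)
  then have "bij_betw f {1..?n} {1..?n}"
    by (rule bij_betw_cong[THEN iffD1, rotated]) (auto simp: f_def)
  then have "f permutes {1..?n}" by (rule bij_imp_permutes) (auto simp: f_def)
  moreover have "f (?P x) = ?V x" if "x \<in> ?B" for x
    using that P the_inv_into_f_f[of ?P ?B x] bij_betwE[OF P] by (auto simp: f_def bij_betw_def)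
  ultimately have "is_inflation \<tau> \<Theta> (FPerm ?n f)"
    by (simp add: is_inflation_iff is_perm_def)
  then show ?thesis ..
qed

lemma inflation_less_iff:
  assumes "is_inflation \<tau> \<Theta> \<omega>" "is_perm \<tau>" "\<And>p. p \<in> {1..len \<tau>} \<Longrightarrow> is_perm (\<Theta> p)"
    and "(p, q) \<in> block_index \<tau> \<Theta>" "(p', q') \<in> block_index \<tau> \<Theta>"
  shows "app \<omega> (block_pos \<Theta> (p, q)) < app \<omega> (block_pos \<Theta> (p', q')) \<longleftrightarrow>
    app \<tau> p < app \<tau> p' \<or> p = p' \<and> app (\<Theta> p) q < app (\<Theta> p) q'"
  using block_val_less_iff[OF assms(2-5)] assms(1,4,5) by (simp add: is_inflation_iff)

text \<open>Reduces containment of an inflation to a map on addresses. One-way implications suffice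
  because the orders are total: the converse for values follows by trichotomy.\<close>

lemma inflation_pattern_of:
  assumes infl: "is_inflation \<tau> \<Theta> \<omega>" and "is_perm \<tau>" "\<And>p. p \<in> {1..len \<tau>} \<Longrightarrow> is_perm (\<Theta> p)"
    and g: "\<And>x. x \<in> block_index \<tau> \<Theta> \<Longrightarrow> g x \<in> elems \<sigma>"
    and gP: "\<And>p q p' q'. (p, q) \<in> block_index \<tau> \<Theta> \<Longrightarrow> (p', q') \<in> block_index \<tau> \<Theta> \<Longrightarrow>
      p < p' \<or> p = p' \<and> q < q' \<Longrightarrow> g (p, q) <\<^sub>P g (p', q')"
    and gV: "\<And>p q p' q'. (p, q) \<in> block_index \<tau> \<Theta> \<Longrightarrow> (p', q') \<in> block_index \<tau> \<Theta> \<Longrightarrow>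
      app \<tau> p < app \<tau> p' \<or> p = p' \<and> app (\<Theta> p) q < app (\<Theta> p) q' \<Longrightarrow> g (p, q) <\<^sub>V g (p', q')"
  shows "is_pattern_of \<omega> \<sigma>"
proof -
  let ?P = "block_pos \<Theta>" and ?B = "block_index \<tau> \<Theta>"
  define h where "h = the_inv_into ?B ?P"
  have P: "bij_betw ?P ?B {1..len \<omega>}" and perm: "is_perm \<omega>"
    using bij_betw_block_pos[of \<Theta> \<tau>] infl by (auto simp: is_inflation_iff)
  have h: "h i \<in> ?B" "?P (h i) = i" if "i \<in> {1..len \<omega>}" for i
    using that P bij_betwE[OF bij_betw_the_inv_into[OF P]] f_the_inv_into_f_bij_betw[OF P]
    by (auto simp: h_def)
  have V: "g (h i) <\<^sub>V g (h j)" if "i \<in> {1..len \<omega>}" "j \<in> {1..len \<omega>}" "app \<omega> i < app \<omega> j" for i j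
  proof -
    obtain p q p' q' where pq: "h i = (p, q)" "h j = (p', q')" by fastforce
    then show ?thesis
      using gV[of p q p' q'] inflation_less_iff[OF assms(1-3), of p q p' q'] h[OF that(1)] h[OF that(2)] that(3)
      by simp
  qed
  have "occurrence \<omega> \<sigma> (g \<circ> h)"
    unfolding occurrence_def
  proof (intro conjI ballI impI funcsetI)
    show "(g \<circ> h) i \<in> elems \<sigma>" if "i \<in> {1..len \<omega>}" for i using g h that by simp
    fix i j assume ij: "i \<in> {1..len \<omega>}" "j \<in> {1..len \<omega>}"
    show "(g \<circ> h) i <\<^sub>P (g \<circ> h) j" if "i < j"
    proof -
      obtain p q p' q' where pq: "h i = (p, q)" "h j = (p', q')" by fastforce
      then show ?thesis
        using gP[of p q p' q'] block_pos_less_iff[of p q \<tau> \<Theta> p' q'] h[OF ij(1)] h[OF ij(2)] that by simp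
    qed
    show "((g \<circ> h) i <\<^sub>V (g \<circ> h) j) = (app \<omega> i < app \<omega> j)"
      using V[OF ij] V[OF ij(2,1)] is_perm_app_eq_iff[OF perm, of i j]
      by (cases "app \<omega> i" "app \<omega> j" rule: linorder_cases) (auto simp: less_V_def)
  qed
  then show ?thesis by (auto simp: is_pattern_of_def)
qed

section \<open>Cycles as stable occurrences\<close>

lemma card_le_bij:
  fixes f :: "nat \<Rightarrow> nat"
  assumes f: "bij_betw f {1..k} {1..k}" and "j \<in> {1..k}"
  shows "card {i \<in> {1..k}. f i \<le> f j} = f j"
proof -
  have fj: "f j \<in> {1..k}" using assms by (auto dest: bij_betwE)
  have "f ` {i \<in> {1..k}. f i \<le> f j} = {1..f j}"
  proof (intro equalityI subsetI)
    fix y assume "y \<in> {1..f j}"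
    then have "y \<in> f ` {1..k}"
      using bij_betw_imp_surj_on[OF f] fj by simp
    with \<open>y \<in> {1..f j}\<close> show "y \<in> f ` {i \<in> {1..k}. f i \<le> f j}" by auto
  qed (use bij_betwE[OF f] in auto)
  moreover have "inj_on f {i \<in> {1..k}. f i \<le> f j}"
    using bij_betw_imp_inj_on[OF f] by (rule inj_on_subset) auto
  ultimately show ?thesis using card_image by fastforce
qed

text \<open>Each value \<open>f j\<close> is the number of \<open>i\<close> with
  \<open>f i \<le> f j\<close>, which only the induced order determines.\<close>

lemma bij_eq_if_same_order:
  fixes f g :: "nat \<Rightarrow> nat"
  assumes "bij_betw f {1..k} {1..k}" "bij_betw g {1..k} {1..k}"
    and "\<And>i j. i \<in> {1..k} \<Longrightarrow> j \<in> {1..k} \<Longrightarrow> f i < f j \<longleftrightarrow> g i < g j"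
    and j: "j \<in> {1..k}"
  shows "f j = g j"
proof -
  have "{i \<in> {1..k}. f i \<le> f j} = {i \<in> {1..k}. g i \<le> g j}"
    using assms(3)[OF j] by (auto simp flip: not_less)
  then show ?thesis
    using card_le_bij[OF assms(1) j] card_le_bij[OF assms(2) j] by simp
qed

text \<open>Serves twice: to sort a sequence by position and to read off its pattern by
  value.\<close>

lemma ex_rank_permutation:
  fixes f :: "nat \<Rightarrow> nat"
  assumes inj: "inj_on f {1..k}"
  shows "\<exists>r. r permutes {1..k} \<and> (\<forall>i\<in>{1..k}. \<forall>j\<in>{1..k}. r i < r j \<longleftrightarrow> f i < f j)"
proof -
  let ?A = "\<lambda>j. {i \<in> {1..k}. f i \<le> f j}"
  define r where "r = (\<lambda>j. if j \<in> {1..k} then card (?A j) else j)"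
  have less: "r i < r j" if "i \<in> {1..k}" "j \<in> {1..k}" "f i < f j" for i j
  proof -
    have "?A i \<subseteq> ?A j" "j \<in> ?A j - ?A i" using that by auto
    then have "?A i \<subset> ?A j" by blast
    then show ?thesis using that by (simp add: r_def psubset_card_mono)
  qed
  have iff: "r i < r j \<longleftrightarrow> f i < f j" if "i \<in> {1..k}" "j \<in> {1..k}" for i j
    using less[OF that] less[OF that(2,1)] inj_onD[OF inj _ that]
    by (cases "f i" "f j" rule: linorder_cases) auto
  have "inj_on r {1..k}"
  proof (rule inj_onI)
    fix i j assume ij: "i \<in> {1..k}" "j \<in> {1..k}" "r i = r j"
    have "\<not> f i < f j" using iff[OF ij(1,2)] ij(3) by simp
    moreover have "\<not> f j < f i" using iff[OF ij(2,1)] ij(3) by simp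
    ultimately show "i = j" using inj_onD[OF inj _ ij(1,2)] by linarith
  qed
  moreover have "r ` {1..k} \<subseteq> {1..k}"
  proof (rule image_subsetI)
    fix j assume j: "j \<in> {1..k}"
    have "card (?A j) \<le> card {1..k}" by (rule card_mono) auto
    moreover have "card (?A j) > 0" using j by (auto simp: card_gt_0_iff)
    ultimately show "r j \<in> {1..k}" using j by (simp add: r_def)
  qed
  ultimately have "bij_betw r {1..k} {1..k}"
    by (simp add: bij_betw_def endo_inj_surj)
  then have "r permutes {1..k}" by (rule bij_imp_permutes) (auto simp: r_def)
  with iff show ?thesis by blast
qed

lemma occurrenceD:
  assumes "occurrence \<pi> \<sigma> s" "i \<in> {1..len \<pi>}"
  shows "s i \<in> elems \<sigma>" "j \<in> {1..len \<pi>} \<Longrightarrow> s i <\<^sub>P s j \<longleftrightarrow> i < j"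
    "j \<in> {1..len \<pi>} \<Longrightarrow> s i <\<^sub>V s j \<longleftrightarrow> app \<pi> i < app \<pi> j"
proof -
  show "s i \<in> elems \<sigma>" using assms by (auto simp: occurrence_def)
  show "s i <\<^sub>P s j \<longleftrightarrow> i < j" if "j \<in> {1..len \<pi>}"
  proof -
    have "i < j \<Longrightarrow> s i <\<^sub>P s j" "j < i \<Longrightarrow> s j <\<^sub>P s i"
      using assms that by (simp_all add: occurrence_def)
    then show ?thesis by (cases i j rule: linorder_cases) (auto simp: less_P_def)
  qed
  show "s i <\<^sub>V s j \<longleftrightarrow> app \<pi> i < app \<pi> j" if "j \<in> {1..len \<pi>}"
    using assms that by (simp add: occurrence_def)
qed

lemma occurrence_inj_pos:
  assumes "occurrence \<pi> \<sigma> s"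
  shows "inj_on (\<lambda>j. fst (s j)) {1..len \<pi>}"
proof (rule inj_onI)
  fix i j assume "i \<in> {1..len \<pi>}" "j \<in> {1..len \<pi>}" "fst (s i) = fst (s j)"
  then show "i = j"
    using occurrenceD(2)[OF assms, of i j] occurrenceD(2)[OF assms, of j i] by (simp add: less_P_def)
qed

lemma is_perm_bij: "is_perm \<pi> \<Longrightarrow> bij_betw (app \<pi>) {1..len \<pi>} {1..len \<pi>}"
  unfolding is_perm_def by (rule permutes_imp_bij)

text \<open>Invariance of the set of positions alone forces \<sigma> to act on the occurrence as
  \<pi> does. It induces a map \<open>f\<close> on indices; since the value of \<open>s j\<close> is
  the image of its position, \<open>f\<close> orders the indices as \<pi> does, and permutations
  inducing the same order coincide.\<close>

lemma stable_iff_app: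
  assumes "is_perm \<sigma>" "is_perm \<pi>" and occ: "occurrence \<pi> \<sigma> s"
  shows "stable \<sigma> (len \<pi>) s \<longleftrightarrow> (\<forall>j\<in>{1..len \<pi>}. app \<sigma> (fst (s j)) = fst (s (app \<pi> j)))"
proof -
  let ?k = "len \<pi>" and ?P = "\<lambda>j. fst (s j)"
  have pos: "positions ?k s = ?P ` {1..?k}" by (auto simp: positions_def)
  note occD = occurrenceD[OF occ]
  show ?thesis
  proof
    assume "stable \<sigma> ?k s"
    then have "app \<sigma> (?P j) \<in> ?P ` {1..?k}" if "j \<in> {1..?k}" for j
      using that by (auto simp: stable_def pos)
    then have "\<forall>j\<in>{1..?k}. \<exists>i\<in>{1..?k}. app \<sigma> (?P j) = ?P i" by fast
    then obtain f where f: "\<And>j. j \<in> {1..?k} \<Longrightarrow> f j \<in> {1..?k} \<and> app \<sigma> (?P j) = ?P (f j)"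
      by metis
    have less: "f i < f j \<longleftrightarrow> app \<pi> i < app \<pi> j" if "i \<in> {1..?k}" "j \<in> {1..?k}" for i j
    proof -
      have "f i < f j \<longleftrightarrow> app \<sigma> (?P i) < app \<sigma> (?P j)"
        using occD(2)[of "f i" "f j"] f that by (simp add: less_P_def)
      also have "\<dots> \<longleftrightarrow> app \<pi> i < app \<pi> j"
        using occD(3)[of i j] occD(1)[THEN elemsD(2)] that by (simp add: less_V_def)
      finally show ?thesis .
    qed
    have "inj_on f {1..?k}"
    proof (rule inj_onI)
      fix i j assume ij: "i \<in> {1..?k}" "j \<in> {1..?k}" "f i = f j"
      have "\<not> app \<pi> i < app \<pi> j" using less[OF ij(1,2)] ij(3) by simp
      moreover have "\<not> app \<pi> j < app \<pi> i" using less[OF ij(2,1)] ij(3) by simp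
      ultimately show "i = j" using is_perm_app_eq_iff[OF assms(2), of i j] by linarith
    qed
    moreover have "f ` {1..?k} \<subseteq> {1..?k}" using f by blast
    ultimately have "bij_betw f {1..?k} {1..?k}"
      by (simp add: bij_betw_def endo_inj_surj)
    then have "f j = app \<pi> j" if "j \<in> {1..?k}" for j
      by (rule bij_eq_if_same_order[OF _ is_perm_bij[OF assms(2)] less that])
    then show "\<forall>j\<in>{1..?k}. app \<sigma> (?P j) = ?P (app \<pi> j)" using f by simp
  next
    assume "\<forall>j\<in>{1..?k}. app \<sigma> (?P j) = ?P (app \<pi> j)"
    then have "app \<sigma> ` ?P ` {1..?k} = ?P ` app \<pi> ` {1..?k}"
      by (simp add: image_image)
    also have "app \<pi> ` {1..?k} = {1..?k}"
      using is_perm_bij[OF assms(2)] by (simp add: bij_betw_def)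
    finally show "stable \<sigma> ?k s" by (simp add: stable_def pos)
  qed
qed

text \<open>Sending \<open>j\<close> to the position of \<open>s j\<close> conjugates \<pi> to the
  action of \<sigma> on the occurrence. With the inverse \<open>h\<close>, cyclicity passes to
  images both ways.\<close>

lemma cyclic_on_stable_iff:
  assumes "is_perm \<sigma>" "is_perm \<pi>" and occ: "occurrence \<pi> \<sigma> s" and "stable \<sigma> (len \<pi>) s"
  shows "cyclic_on (app \<sigma>) (positions (len \<pi>) s) \<longleftrightarrow> cyclic_on (app \<pi>) {1..len \<pi>}"
proof -
  let ?k = "len \<pi>" and ?P = "\<lambda>j. fst (s j)"
  have pos: "positions ?k s = ?P ` {1..?k}" by (auto simp: positions_def)
  have comm: "app \<sigma> (?P j) = ?P (app \<pi> j)" if "j \<in> {1..?k}" for j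
    using that stable_iff_app[OF assms(1-3)] assms(4) by blast
  define h where "h = the_inv_into {1..?k} ?P"
  have h: "h (?P j) = j" if "j \<in> {1..?k}" for j
    using the_inv_into_f_f[OF occurrence_inj_pos[OF occ]] that by (simp add: h_def)
  have h_comm: "app \<pi> (h x) = h (app \<sigma> x)" if "x \<in> ?P ` {1..?k}" for x
    using that
  proof (rule imageE)
    fix j assume "x = ?P j" "j \<in> {1..?k}"
    then show ?thesis using h[OF is_permD[OF assms(2)]] by (simp add: h comm)
  qed
  have h_img: "h ` ?P ` {1..?k} = {1..?k}"
  proof -
    have "(\<lambda>j. h (?P j)) ` {1..?k} = id ` {1..?k}" by (rule image_cong) (simp_all only: h id_apply)
    then show ?thesis by (simp add: image_image)
  qed
  show ?thesis
    unfolding pos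
  proof
    assume "cyclic_on (app \<sigma>) (?P ` {1..?k})"
    then have "cyclic_on (app \<pi>) (h ` ?P ` {1..?k})" using h_comm by (rule cyclic_on_image)
    then show "cyclic_on (app \<pi>) {1..?k}" by (simp only: h_img)
  next
    assume "cyclic_on (app \<pi>) {1..?k}"
    then show "cyclic_on (app \<sigma>) (?P ` {1..?k})" using comm by (rule cyclic_on_image)
  qed
qed

lemma positions_permute:
  assumes "\<rho> permutes {1..k}"
  shows "positions k (a \<circ> \<rho>) = positions k a"
  unfolding positions_def image_comp[symmetric] using assms by (simp add: permutes_image)

text \<open>A cycle is listed in any order, an occurrence from left to right; \<rho> does the
  sorting and \<pi> is the pattern found afterwards. As there are finitely many \<rho> and \<pi>,
  only stability remains to be expressed by a formula.\<close>

lemma is_cycle_of_iff: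
  assumes \<sigma>: "is_perm \<sigma>" and a: "a \<in> {1..k} \<rightarrow> elems \<sigma>"
  shows "is_cycle_of \<sigma> k a \<longleftrightarrow>
    (\<exists>\<rho> \<pi>. \<rho> permutes {1..k} \<and> k_cycle k \<pi> \<and> occurrence \<pi> \<sigma> (a \<circ> \<rho>) \<and> stable \<sigma> k (a \<circ> \<rho>))"
proof
  assume "is_cycle_of \<sigma> k a"
  then have inj: "inj_on a {1..k}" and cyc: "cyclic_on (app \<sigma>) (positions k a)"
    by (auto simp: is_cycle_of_def)
  have injP: "inj_on (\<lambda>j. fst (a j)) {1..k}"
  proof (rule inj_onI)
    fix i j assume ij: "i \<in> {1..k}" "j \<in> {1..k}" "fst (a i) = fst (a j)"
    then have "a i \<in> elems \<sigma>" "a j \<in> elems \<sigma>" using a by blast+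
    then have "a i = a j" using ij(3) by (simp add: elems_eq_iff)
    then show "i = j" using inj ij by (simp add: inj_on_eq_iff)
  qed
  from ex_rank_permutation[OF this] obtain r
    where r: "r permutes {1..k}" "\<forall>i\<in>{1..k}. \<forall>j\<in>{1..k}. r i < r j \<longleftrightarrow> fst (a i) < fst (a j)"
    by (elim exE conjE)
  \<comment> \<open>\<open>r\<close> ranks the entries of \<open>a\<close> by position, so its
    inverse lists them from left to right.\<close>
  define \<rho> where "\<rho> = inv r"
  have \<rho>: "\<rho> permutes {1..k}" using r by (simp add: \<rho>_def permutes_inv)
  have \<rho>_in: "\<rho> i \<in> {1..k}" if "i \<in> {1..k}" for i
    using permutes_in_image[OF \<rho>] that by blast
  have r\<rho>: "r (\<rho> i) = i" for i using permutes_inverses(1)[OF r(1)] by (simp add: \<rho>_def)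
  have injV: "inj_on (\<lambda>j. snd (a (\<rho> j))) {1..k}"
  proof (rule inj_onI)
    fix i j assume ij: "i \<in> {1..k}" "j \<in> {1..k}" "snd (a (\<rho> i)) = snd (a (\<rho> j))"
    have "a (\<rho> i) \<in> elems \<sigma>" "a (\<rho> j) \<in> elems \<sigma>"
      using ij(1,2) by (auto intro!: funcset_mem[OF a \<rho>_in] simp del: atLeastAtMost_iff)
    then have "fst (a (\<rho> i)) = fst (a (\<rho> j))"
      using ij(3) by (simp add: elemsD(2) is_perm_app_eq_iff[OF \<sigma>])
    then have "\<rho> i = \<rho> j" using inj_onD[OF injP] \<rho>_in ij by simp
    then have "r (\<rho> i) = r (\<rho> j)" by simp
    then show "i = j" by (simp only: r\<rho>)
  qed
  from ex_rank_permutation[OF this] obtain f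
    where f: "f permutes {1..k}"
      "\<forall>i\<in>{1..k}. \<forall>j\<in>{1..k}. f i < f j \<longleftrightarrow> snd (a (\<rho> i)) < snd (a (\<rho> j))"
    by (elim exE conjE)
  define \<pi> where "\<pi> = FPerm k f"
  have \<pi>: "is_perm \<pi>" "len \<pi> = k" using f by (simp_all add: \<pi>_def is_perm_def)
  have occ: "occurrence \<pi> \<sigma> (a \<circ> \<rho>)"
    unfolding occurrence_def
  proof (intro conjI ballI impI)
    show "a \<circ> \<rho> \<in> {1..len \<pi>} \<rightarrow> elems \<sigma>" using \<pi> by (auto intro!: funcset_mem[OF a \<rho>_in] simp del: atLeastAtMost_iff)
    fix i j assume ij: "i \<in> {1..len \<pi>}" "j \<in> {1..len \<pi>}"
    show "((a \<circ> \<rho>) i <\<^sub>V (a \<circ> \<rho>) j) = (app \<pi> i < app \<pi> j)"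
      using f(2) ij by (simp add: less_V_def \<pi>_def)
    show "(a \<circ> \<rho>) i <\<^sub>P (a \<circ> \<rho>) j" if "i < j"
      using r(2)[rule_format, OF \<rho>_in \<rho>_in, of i j] ij that \<pi>(2) by (simp add: less_P_def r\<rho>)
  qed
  have pos: "positions k (a \<circ> \<rho>) = positions k a" using \<rho> by (rule positions_permute)
  have "app \<sigma> ` positions k a \<subseteq> positions k a"
    using cyclic_on_inI[OF cyc] by blast
  moreover have "inj_on (app \<sigma>) (positions k a)"
    using is_perm_app_eq_iff[OF \<sigma>] by (auto intro: inj_onI)
  moreover have "finite (positions k a)" by (simp add: positions_def)
  ultimately have stable: "stable \<sigma> k (a \<circ> \<rho>)"
    unfolding stable_def pos using endo_inj_surj by blast
  then have "k_cycle k \<pi>"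
    using cyclic_on_stable_iff[OF \<sigma> \<pi>(1) occ] cyc \<pi> by (simp add: pos k_cycle_def)
  with \<rho> occ stable show "\<exists>\<rho> \<pi>. \<rho> permutes {1..k} \<and> k_cycle k \<pi> \<and> occurrence \<pi> \<sigma> (a \<circ> \<rho>) \<and> stable \<sigma> k (a \<circ> \<rho>)"
    by blast
next
  assume "\<exists>\<rho> \<pi>. \<rho> permutes {1..k} \<and> k_cycle k \<pi> \<and> occurrence \<pi> \<sigma> (a \<circ> \<rho>) \<and> stable \<sigma> k (a \<circ> \<rho>)"
  then obtain \<rho> \<pi> where *: "\<rho> permutes {1..k}" "k_cycle k \<pi>" "occurrence \<pi> \<sigma> (a \<circ> \<rho>)" "stable \<sigma> k (a \<circ> \<rho>)"
    by blast
  then have \<pi>: "is_perm \<pi>" "len \<pi> = k" "cyclic_on (app \<pi>) {1..k}" by (auto simp: k_cycle_def)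
  have "inj_on (a \<circ> \<rho>) {1..k}"
    by (rule inj_on_imageI2[of fst])
      (use occurrence_inj_pos[OF *(3)] \<pi>(2) in \<open>simp add: comp_def\<close>)
  then have "inj_on a {1..k}"
    using inj_on_imageI[of a \<rho> "{1..k}"] permutes_image[OF *(1)] by simp
  moreover have "cyclic_on (app \<sigma>) (positions k a)"
    using cyclic_on_stable_iff[OF \<sigma> \<pi>(1) *(3)] *(4) \<pi>(2,3) positions_permute[OF *(1), of a] by simp
  ultimately show "is_cycle_of \<sigma> k a" by (simp add: is_cycle_of_def)
qed

section \<open>Stability and balanced cell matrices\<close>

definition col :: "nat \<Rightarrow> (nat \<Rightarrow> elem) \<Rightarrow> elem \<Rightarrow> nat" where
  "col k s x = Suc (card {t \<in> {1..k}. s t <\<^sub>P x})"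

definition row :: "nat \<Rightarrow> (nat \<Rightarrow> elem) \<Rightarrow> elem \<Rightarrow> nat" where
  "row k s x = Suc (card {t \<in> {1..k}. s t <\<^sub>V x})"

lemma cell_eq: "cell \<sigma> k s i j = {x \<in> elems \<sigma> - s ` {1..k}. row k s x = i \<and> col k s x = j}"
  by (simp add: cell_def row_def col_def)

lemma finite_elems [simp]: "finite (elems \<sigma>)"
proof -
  have "elems \<sigma> = (\<lambda>i. (i, app \<sigma> i)) ` {1..len \<sigma>}" by (auto simp: elems_def)
  then show ?thesis by simp
qed

lemma fst_image_elems: "fst ` elems \<sigma> = {1..len \<sigma>}"
  by (force simp: elems_def)

lemma snd_image_elems: "is_perm \<sigma> \<Longrightarrow> snd ` elems \<sigma> = {1..len \<sigma>}"
proof -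
  assume "is_perm \<sigma>"
  have "snd ` elems \<sigma> = app \<sigma> ` {1..len \<sigma>}" by (force simp: elems_def)
  with \<open>is_perm \<sigma>\<close> show ?thesis by (simp add: is_perm_def permutes_image)
qed

lemma inj_on_fst_elems: "inj_on fst (elems \<sigma>)"
  by (auto simp: inj_on_def elems_def)

lemma inj_on_snd_elems: "is_perm \<sigma> \<Longrightarrow> inj_on snd (elems \<sigma>)"
  by (auto simp: inj_on_def elems_def is_perm_app_eq_iff)

lemma col_in: "col k s x \<in> {1..Suc k}"
  and row_in: "row k s x \<in> {1..Suc k}"
proof -
  have "card {t \<in> {1..k}. s t <\<^sub>P x} \<le> card {1..k}" "card {t \<in> {1..k}. s t <\<^sub>V x} \<le> card {1..k}"
    by (rule card_mono; auto)+
  then show "col k s x \<in> {1..Suc k}" "row k s x \<in> {1..Suc k}" by (auto simp: col_def row_def)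
qed

text \<open>\<open>K\<close> stands for either of the two coordinates.\<close>

lemma coordinate_eq_count:
  fixes K :: "'a \<Rightarrow> nat"
  assumes "finite E" and inj: "inj_on K E" and img: "K ` E = {1..n}"
    and u: "\<And>j. j \<in> {1..k} \<Longrightarrow> u j \<in> E"
    and less: "\<And>i j. i \<in> {1..k} \<Longrightarrow> j \<in> {1..k} \<Longrightarrow> K (u i) < K (u j) \<longleftrightarrow> i < j"
    and j: "j \<in> {1..k}"
  shows "K (u j) = j + card {x \<in> E - u ` {1..k}. Suc (card {t \<in> {1..k}. K (u t) < K x}) \<le> j}"
proof -
  let ?line = "\<lambda>x. Suc (card {t \<in> {1..k}. K (u t) < K x})"
  have line: "?line x \<le> j \<longleftrightarrow> K x < K (u j)" if x: "x \<in> E - u ` {1..k}" for x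
  proof
    assume "K x < K (u j)"
    then have "{t \<in> {1..k}. K (u t) < K x} \<subseteq> {1..<j}"
      using less[OF _ j] by force
    then have "card {t \<in> {1..k}. K (u t) < K x} \<le> card {1..<j}" by (intro card_mono) auto
    then show "?line x \<le> j"
      using j by (simp only: card_atLeastLessThan atLeastAtMost_iff) linarith
  next
    assume line: "?line x \<le> j"
    show "K x < K (u j)"
    proof (rule ccontr)
      assume "\<not> K x < K (u j)"
      moreover have "K x \<noteq> K (u j)" using inj_onD[OF inj, of x "u j"] x u j by blast
      ultimately have ux: "K (u j) < K x" by simp
      have "{1..j} \<subseteq> {t \<in> {1..k}. K (u t) < K x}"
      proof
        fix t assume t: "t \<in> {1..j}"
        then have "t \<in> {1..k}" using j by auto
        moreover from this have "K (u t) \<le> K (u j)" using t less[OF _ j, of t] by (cases "t = j") auto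
        ultimately show "t \<in> {t \<in> {1..k}. K (u t) < K x}" using ux by auto
      qed
      then have "card {1..j} \<le> card {t \<in> {1..k}. K (u t) < K x}" by (intro card_mono) auto
      with line show False by simp
    qed
  qed
  \<comment> \<open>\<open>K\<close> takes each value from 1 to \<open>n\<close> exactly once, hence
    \<open>K (u j)\<close> is the number of elements that are not above \<open>u j\<close>.\<close>
  have "K ` {x \<in> E. K x \<le> K (u j)} = {1..K (u j)}"
  proof (intro equalityI subsetI)
    fix y assume y: "y \<in> {1..K (u j)}"
    moreover have "K (u j) \<le> n" using img u[OF j] by (metis atLeastAtMost_iff imageI)
    ultimately have "y \<in> K ` E" unfolding img by simp
    with y show "y \<in> K ` {x \<in> E. K x \<le> K (u j)}" by auto
  qed (use img in auto)
  moreover have "inj_on K {x \<in> E. K x \<le> K (u j)}" by (rule inj_on_subset[OF inj]) auto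
  ultimately have "K (u j) = card {x \<in> E. K x \<le> K (u j)}"
    using card_image by fastforce
  also have "{x \<in> E. K x \<le> K (u j)} = u ` {1..j} \<union> {x \<in> E - u ` {1..k}. ?line x \<le> j}"
  proof (intro equalityI subsetI)
    fix x assume x: "x \<in> {x \<in> E. K x \<le> K (u j)}"
    show "x \<in> u ` {1..j} \<union> {x \<in> E - u ` {1..k}. ?line x \<le> j}"
    proof (cases "x \<in> u ` {1..k}")
      case True
      then obtain t where t: "t \<in> {1..k}" "x = u t" by auto
      then have "t \<le> j" using x less[OF j t(1)] by auto
      then show ?thesis using t by auto
    next
      case False
      have "K x \<noteq> K (u j)" using inj_onD[OF inj, of x "u j"] x u j False by blast
      then show ?thesis using x False line by auto
    qed
  next
    fix x assume "x \<in> u ` {1..j} \<union> {x \<in> E - u ` {1..k}. ?line x \<le> j}"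
    then show "x \<in> {x \<in> E. K x \<le> K (u j)}"
    proof
      assume "x \<in> u ` {1..j}"
      then obtain t where t: "t \<in> {1..j}" "x = u t" by auto
      then have "t \<in> {1..k}" "\<not> j < t" using j by auto
      then show ?thesis using t u less[OF j, of t] by auto
    next
      assume "x \<in> {x \<in> E - u ` {1..k}. ?line x \<le> j}"
      then have "x \<in> E - u ` {1..k}" "?line x \<le> j" by blast+
      then show ?thesis using line[of x] by auto
    qed
  qed
  also have "card \<dots> = card (u ` {1..j}) + card {x \<in> E - u ` {1..k}. ?line x \<le> j}"
    using \<open>finite E\<close> j by (intro card_Un_disjoint) auto
  also have "card (u ` {1..j}) = j"
  proof -
    have "inj_on u {1..j}"
    proof (rule inj_onI)
      fix a b assume *: "a \<in> {1..j}" "b \<in> {1..j}" "u a = u b"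
      then have ab: "a \<in> {1..k}" "b \<in> {1..k}" using j by auto
      show "a = b" using less[OF ab] less[OF ab(2,1)] *(3) by (metis less_irrefl linorder_neq_iff)
    qed
    then show ?thesis by (simp add: card_image)
  qed
  finally show ?thesis .
qed

lemma card_le_eq_sum:
  fixes f :: "'a \<Rightarrow> nat"
  assumes "finite X" "\<And>x. x \<in> X \<Longrightarrow> 1 \<le> f x"
  shows "card {x \<in> X. f x \<le> j} = (\<Sum>i\<in>{1..j}. card {x \<in> X. f x = i})"
proof -
  have "{x \<in> X. f x \<le> j} = (\<Union>i\<in>{1..j}. {x \<in> X. f x = i})" using assms by auto
  also have "card \<dots> = (\<Sum>i\<in>{1..j}. card {x \<in> X. f x = i})"
    using assms by (intro card_UN_disjoint) auto
  finally show ?thesis .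
qed

lemma row_sum_eq:
  "(\<Sum>j\<in>{1..Suc k}. cell_matrix \<sigma> k s i j) = card {x \<in> elems \<sigma> - s ` {1..k}. row k s x = i}"
proof -
  have "{x \<in> elems \<sigma> - s ` {1..k}. row k s x = i} = (\<Union>j\<in>{1..Suc k}. cell \<sigma> k s i j)"
    using col_in by (auto simp: cell_eq simp del: atLeastAtMost_iff)
  also have "card \<dots> = (\<Sum>j\<in>{1..Suc k}. card (cell \<sigma> k s i j))"
    by (intro card_UN_disjoint) (auto simp: cell_eq)
  finally show ?thesis by (simp add: cell_matrix_def)
qed

lemma col_sum_eq:
  "(\<Sum>i\<in>{1..Suc k}. cell_matrix \<sigma> k s i j) = card {x \<in> elems \<sigma> - s ` {1..k}. col k s x = j}"
proof -
  have "{x \<in> elems \<sigma> - s ` {1..k}. col k s x = j} = (\<Union>i\<in>{1..Suc k}. cell \<sigma> k s i j)"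
    using row_in by (auto simp: cell_eq simp del: atLeastAtMost_iff)
  also have "card \<dots> = (\<Sum>i\<in>{1..Suc k}. card (cell \<sigma> k s i j))"
    by (intro card_UN_disjoint) (auto simp: cell_eq)
  finally show ?thesis by (simp add: cell_matrix_def)
qed

text \<open>The circulation condition at each vertex, with \<open>m i j\<close> as the flow from
  \<open>i\<close> to \<open>j\<close>.\<close>

definition balanced :: "nat \<Rightarrow> (nat \<Rightarrow> nat \<Rightarrow> nat) \<Rightarrow> bool" where
  "balanced n m \<longleftrightarrow> (\<forall>i\<in>{1..n}. (\<Sum>j\<in>{1..n}. m i j) = (\<Sum>j\<in>{1..n}. m j i))"

text \<open>The position of \<open>s j\<close> is \<open>j\<close> plus the first \<open>j\<close>
  column sums; its value is \<open>app \<pi> j\<close> plus the first \<open>app \<pi> j\<close> row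
  sums. Stability equates the value of \<open>s j\<close> with the position of
  \<open>s (app \<pi> j)\<close>: the indices cancel, and the prefix sums of rows and columns agree
  at \<open>app \<pi> j\<close>. This covers all prefixes up to \<open>k\<close>. The prefix of
  length \<open>k + 1\<close> agrees anyway, as both sides count all points outside the occurrence,
  so the single row and column sums agree.\<close>

lemma stable_iff_balanced:
  assumes \<sigma>: "is_perm \<sigma>" and \<pi>: "is_perm \<pi>" and occ: "occurrence \<pi> \<sigma> s"
  shows "stable \<sigma> (len \<pi>) s \<longleftrightarrow> balanced (Suc (len \<pi>)) (cell_matrix \<sigma> (len \<pi>) s)"
proof -
  let ?k = "len \<pi>" and ?X = "elems \<sigma> - s ` {1..len \<pi>}"
  let ?R = "\<lambda>i. card {x \<in> ?X. row ?k s x = i}" and ?C = "\<lambda>i. card {x \<in> ?X. col ?k s x = i}"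
  have perm: "app \<pi> permutes {1..?k}" using \<pi> by (simp add: is_perm_def)
  have fst_s: "fst (s j) = j + (\<Sum>i\<in>{1..j}. ?C i)" if "j \<in> {1..?k}" for j
  proof -
    have "fst (s j) = j + card {x \<in> ?X. col ?k s x \<le> j}"
      unfolding col_def less_P_def
      by (rule coordinate_eq_count[OF finite_elems inj_on_fst_elems fst_image_elems occurrenceD(1)[OF occ] _ that])
        (use occurrenceD(2)[OF occ] in \<open>auto simp: less_P_def\<close>)
    then show ?thesis using col_in[of ?k s] by (subst (asm) card_le_eq_sum) auto
  qed
  have snd_s: "snd (s j) = app \<pi> j + (\<Sum>i\<in>{1..app \<pi> j}. ?R i)" if "j \<in> {1..?k}" for j
  proof -
    \<comment> \<open>\<open>coordinate_eq_count\<close> wants the points in increasing order of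
      \<open>K\<close>; for values, the inverse of \<pi> lists the occurrence from bottom to
      top.\<close>
    let ?q = "inv (app \<pi>)" and ?u = "s \<circ> inv (app \<pi>)"
    have q: "?q permutes {1..?k}" using perm by (rule permutes_inv)
    have q_in: "?q i \<in> {1..?k}" if "i \<in> {1..?k}" for i using permutes_in_image[OF q] that by blast
    have \<pi>q: "app \<pi> (?q i) = i" "?q (app \<pi> i) = i" for i
      using permutes_inverses[OF perm] by auto
    have img: "?u ` {1..?k} = s ` {1..?k}"
      using permutes_image[OF q] by (simp only: image_comp[symmetric])
    have "snd (?u (app \<pi> j)) = app \<pi> j +
        card {x \<in> elems \<sigma> - ?u ` {1..?k}. Suc (card {t \<in> {1..?k}. snd (?u t) < snd x}) \<le> app \<pi> j}"
    proof (rule coordinate_eq_count[OF finite_elems inj_on_snd_elems[OF \<sigma>] snd_image_elems[OF \<sigma>]])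
      show "?u i \<in> elems \<sigma>" if "i \<in> {1..?k}" for i
        using occurrenceD(1)[OF occ q_in[OF that]] by simp
      show "(snd (?u i) < snd (?u j)) = (i < j)" if "i \<in> {1..?k}" "j \<in> {1..?k}" for i j
        using occurrenceD(3)[OF occ q_in q_in, OF that] by (simp add: less_V_def \<pi>q)
      show "app \<pi> j \<in> {1..?k}" using is_permD[OF \<pi> that] .
    qed
    moreover have "Suc (card {t \<in> {1..?k}. snd (?u t) < snd x}) = row ?k s x" for x
    proof -
      have "?q ` {t \<in> {1..?k}. snd (?u t) < snd x} = {t \<in> {1..?k}. snd (s t) < snd x}"
      proof (intro equalityI subsetI)
        fix t assume "t \<in> {t \<in> {1..?k}. snd (s t) < snd x}"
        then show "t \<in> ?q ` {t \<in> {1..?k}. snd (?u t) < snd x}"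
          using is_permD[OF \<pi>, of t] by (intro image_eqI[of _ _ "app \<pi> t"]) (simp_all add: \<pi>q)
      qed (use q_in in auto)
      moreover have "inj_on ?q A" for A using permutes_inj[OF q] by (rule inj_on_subset) auto
      ultimately show ?thesis
        unfolding row_def less_V_def by (metis (no_types, lifting) card_image)
    qed
    ultimately have "snd (s j) = app \<pi> j + card {x \<in> ?X. row ?k s x \<le> app \<pi> j}"
      by (simp only: img[unfolded comp_def] comp_def \<pi>q)
    then show ?thesis using row_in[of ?k s] by (subst (asm) card_le_eq_sum) auto
  qed
  have "stable \<sigma> ?k s \<longleftrightarrow> (\<forall>j\<in>{1..?k}. snd (s j) = fst (s (app \<pi> j)))"
    unfolding stable_iff_app[OF \<sigma> \<pi> occ] using elemsD(2)[OF occurrenceD(1)[OF occ]] by simp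
  also have "\<dots> \<longleftrightarrow> (\<forall>j\<in>{1..?k}. (\<Sum>i\<in>{1..app \<pi> j}. ?R i) = (\<Sum>i\<in>{1..app \<pi> j}. ?C i))"
    by (intro ball_cong refl) (simp only: snd_s fst_s is_permD[OF \<pi>] add_left_cancel)
  also have "\<dots> \<longleftrightarrow> (\<forall>j\<in>app \<pi> ` {1..?k}. (\<Sum>i\<in>{1..j}. ?R i) = (\<Sum>i\<in>{1..j}. ?C i))"
    by blast
  also have "\<dots> \<longleftrightarrow> (\<forall>j\<in>{1..?k}. (\<Sum>i\<in>{1..j}. ?R i) = (\<Sum>i\<in>{1..j}. ?C i))"
    by (simp only: permutes_image[OF perm])
  also have "\<dots> \<longleftrightarrow> (\<forall>i\<in>{1..Suc ?k}. ?R i = ?C i)"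
  proof
    assume *: "\<forall>j\<in>{1..?k}. (\<Sum>i\<in>{1..j}. ?R i) = (\<Sum>i\<in>{1..j}. ?C i)"
    have "{x \<in> ?X. row ?k s x \<le> Suc ?k} = {x \<in> ?X. col ?k s x \<le> Suc ?k}"
      using row_in[of ?k s] col_in[of ?k s] by simp
    then have "(\<Sum>i\<in>{1..Suc ?k}. ?R i) = (\<Sum>i\<in>{1..Suc ?k}. ?C i)"
      using card_le_eq_sum[of ?X "row ?k s" "Suc ?k"] card_le_eq_sum[of ?X "col ?k s" "Suc ?k"]
        row_in[of ?k s] col_in[of ?k s] by (simp del: sum.cl_ivl_Suc)
    then have prefix: "(\<Sum>i\<in>{1..j}. ?R i) = (\<Sum>i\<in>{1..j}. ?C i)" if "j \<le> Suc ?k" for j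
      using * that by (cases "j = 0"; cases "j = Suc ?k") auto
    show "\<forall>i\<in>{1..Suc ?k}. ?R i = ?C i"
    proof
      fix i assume i: "i \<in> {1..Suc ?k}"
      then obtain j where j: "i = Suc j" by (cases i) auto
      have "(\<Sum>i\<in>{1..j}. ?R i) + ?R (Suc j) = (\<Sum>i\<in>{1..j}. ?C i) + ?C (Suc j)"
        using prefix[of "Suc j"] i unfolding j by simp
      moreover have "(\<Sum>i\<in>{1..j}. ?R i) = (\<Sum>i\<in>{1..j}. ?C i)"
        using i j by (intro prefix) simp
      ultimately show "?R i = ?C i" unfolding j by linarith
    qed
  next
    assume "\<forall>i\<in>{1..Suc ?k}. ?R i = ?C i"
    then show "\<forall>j\<in>{1..?k}. (\<Sum>i\<in>{1..j}. ?R i) = (\<Sum>i\<in>{1..j}. ?C i)"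
      by (intro ballI sum.cong) auto
  qed
  also have "\<dots> \<longleftrightarrow> balanced (Suc ?k) (cell_matrix \<sigma> ?k s)"
    unfolding balanced_def by (simp only: row_sum_eq col_sum_eq)
  finally show ?thesis .
qed

section \<open>Circulations without cycles of heavy edges\<close>

definition cyc_pairs :: "'a list \<Rightarrow> ('a \<times> 'a) set" where
  "cyc_pairs xs = set (zip xs (rotate1 xs))"

lemma zip_append_successively:
  assumes "successively E xs" "xs \<noteq> []" "E (last xs) y"
  shows "\<forall>(a, b)\<in>set (zip xs (tl xs @ [y])). E a b"
  using assms
proof (induction xs rule: induct_list012)
  case (3 a b xs)
  then show ?case by auto
qed auto

lemma cyc_pairs_successively:
  assumes "successively E xs" "xs \<noteq> []" "E (last xs) (hd xs)"
  shows "\<forall>(a, b)\<in>cyc_pairs xs. E a b"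
  using zip_append_successively[OF assms] assms(2) by (cases xs) (auto simp: cyc_pairs_def)

text \<open>Call an edge heavy if its weight exceeds \<open>N\<close>. If \<open>i\<close> could be
  reached from \<open>j\<close> by heavy edges, the heavy edge from \<open>i\<close> to
  \<open>j\<close> would close a forbidden cycle. So this edge enters the set \<open>S\<close> of
  vertices reachable from \<open>j\<close>, while all edges leaving \<open>S\<close> are light and
  number at most \<open>n * n\<close>. A circulation carries as much into \<open>S\<close> as out of
  it. The summand \<open>N\<close> accounts for an edge that is itself light.\<close>

lemma heavy_edge_bound:
  fixes m :: "nat \<Rightarrow> nat \<Rightarrow> nat"
  assumes bal: "balanced n m"
    and acyclic: "\<And>xs. distinct xs \<Longrightarrow> set xs \<subseteq> {1..n} \<Longrightarrow> length xs \<ge> 2 \<Longrightarrow>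
      \<exists>(a, b)\<in>cyc_pairs xs. m a b \<le> N"
    and ij: "i \<in> {1..n}" "j \<in> {1..n}" "i \<noteq> j"
  shows "m i j \<le> N + n * n * N"
proof (rule ccontr)
  assume "\<not> m i j \<le> N + n * n * N"
  then have heavy: "N < m i j" and large: "n * n * N < m i j" by auto
  let ?E = "\<lambda>a b. N < m a b"
  \<comment> \<open>Paths are kept simple because the hypothesis \<open>acyclic\<close> speaks of
    distinct lists only.\<close>
  let ?path = "\<lambda>xs l. distinct xs \<and> xs \<noteq> [] \<and> hd xs = j \<and> last xs = l \<and> set xs \<subseteq> {1..n} \<and> successively ?E xs"
  define S where "S = {l. \<exists>xs. ?path xs l}"
  have S_sub: "S \<subseteq> {1..n}" by (auto simp: S_def)
  have "?path [j] j" using ij by simp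
  then have "j \<in> S" unfolding S_def by blast
  have "i \<notin> S"
  proof
    assume "i \<in> S"
    then obtain xs where xs: "?path xs i" unfolding S_def by blast
    then have "length xs \<noteq> 1" using ij(3) by (auto simp: length_Suc_conv)
    moreover have "length xs \<noteq> 0" using xs by simp
    ultimately have "length xs \<ge> 2" by linarith
    moreover have "\<forall>(a, b)\<in>cyc_pairs xs. N < m a b"
      using xs heavy by (intro cyc_pairs_successively) auto
    ultimately show False using acyclic[of xs] xs by fastforce
  qed
  have step: "m a b \<le> N" if ab: "a \<in> S" "b \<in> {1..n} - S" for a b
  proof (rule ccontr)
    assume "\<not> m a b \<le> N"
    obtain xs where xs: "?path xs a" using ab unfolding S_def by blast
    \<comment> \<open>Appending \<open>b\<close> has to keep the path simple. Were \<open>b\<close>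
      on it already, the initial segment ending in \<open>b\<close> would put \<open>b\<close> into
      \<open>S\<close>.\<close>
    have "b \<notin> set xs"
    proof
      assume "b \<in> set xs"
      then obtain ys zs where yz: "xs = ys @ b # zs" by (auto simp: in_set_conv_decomp)
      then have "?path (ys @ [b]) b"
        using xs by (cases ys) (auto simp: successively_append_iff successively_Cons hd_append split: if_splits)
      then show False using ab unfolding S_def by blast
    qed
    then have "?path (xs @ [b]) b"
      using xs ab \<open>\<not> m a b \<le> N\<close> by (auto simp: successively_append_iff)
    then show False using ab unfolding S_def by blast
  qed
  define T where "T = {1..n} - S"
  have fin: "finite S" "finite T" using S_sub finite_subset by (auto simp: T_def)
  have split: "(\<Sum>b\<in>{1..n}. f b) = (\<Sum>b\<in>S. f b) + (\<Sum>b\<in>T. f b)" for f :: "nat \<Rightarrow> nat"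
  proof -
    have "{1..n} = S \<union> T" using S_sub by (auto simp: T_def)
    moreover have "S \<inter> T = {}" by (simp add: T_def)
    ultimately show ?thesis using fin by (simp only: sum.union_disjoint)
  qed
  \<comment> \<open>Balance summed over \<open>S\<close>; the edges inside \<open>S\<close> occur on
    both sides and cancel.\<close>
  have "(\<Sum>a\<in>S. \<Sum>b\<in>{1..n}. m a b) = (\<Sum>a\<in>S. \<Sum>b\<in>{1..n}. m b a)"
    by (rule sum.cong[OF refl]) (use bal S_sub in \<open>auto simp: balanced_def\<close>)
  moreover have "(\<Sum>a\<in>S. \<Sum>b\<in>S. m b a) = (\<Sum>a\<in>S. \<Sum>b\<in>S. m a b)"
    by (rule sum.swap)
  ultimately have flow: "(\<Sum>a\<in>S. \<Sum>b\<in>T. m a b) = (\<Sum>a\<in>S. \<Sum>b\<in>T. m b a)"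
    unfolding split sum.distrib by linarith
  have "m i j \<le> (\<Sum>b\<in>T. m b j)"
    using \<open>i \<notin> S\<close> ij fin by (intro member_le_sum) (auto simp: T_def)
  also have "\<dots> \<le> (\<Sum>a\<in>S. \<Sum>b\<in>T. m b a)"
    using \<open>j \<in> S\<close> fin by (intro member_le_sum) auto
  also have "\<dots> \<le> (\<Sum>a\<in>S. \<Sum>b\<in>T. N)"
    unfolding flow[symmetric] by (intro sum_mono step) (auto simp: T_def)
  also have "\<dots> = card S * card T * N" by simp
  also have "\<dots> \<le> n * n * N"
  proof -
    have "card S \<le> card {1..n}" "card T \<le> card {1..n}"
      using S_sub by (intro card_mono; auto simp: T_def)+
    then show ?thesis by (simp add: mult_le_mono)
  qed
  finally show False using large by simp
qed

section \<open>Definable relations\<close>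

text \<open>Lets the closure properties below stand in for explicit formulas. Agreement is asked
  only for permutations and for assignments into their elements, so relations may be rewritten under
  these assumptions.\<close>

definition definable :: "nat set \<Rightarrow> (fperm \<Rightarrow> (nat \<Rightarrow> elem) \<Rightarrow> bool) \<Rightarrow> bool" where
  "definable V R \<longleftrightarrow> (\<exists>\<phi>. fv \<phi> \<subseteq> V \<and>
     (\<forall>\<sigma> a. is_perm \<sigma> \<longrightarrow> a \<in> V \<rightarrow> elems \<sigma> \<longrightarrow> (sat \<sigma> a \<phi> \<longleftrightarrow> R \<sigma> a)))"

lemma definableI:
  assumes "fv \<phi> \<subseteq> V" "\<And>\<sigma> a. is_perm \<sigma> \<Longrightarrow> a \<in> V \<rightarrow> elems \<sigma> \<Longrightarrow> sat \<sigma> a \<phi> \<longleftrightarrow> R \<sigma> a"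
  shows "definable V R"
  using assms unfolding definable_def by blast

lemma definable_cong:
  assumes "definable V R" "\<And>\<sigma> a. is_perm \<sigma> \<Longrightarrow> a \<in> V \<rightarrow> elems \<sigma> \<Longrightarrow> R \<sigma> a \<longleftrightarrow> R' \<sigma> a"
  shows "definable V R'"
  using assms unfolding definable_def by blast

lemma definable_eq: "x \<in> V \<Longrightarrow> y \<in> V \<Longrightarrow> definable V (\<lambda>\<sigma> a. a x = a y)"
  by (rule definableI[of "EqF x y"]) auto

lemma definable_less_P: "x \<in> V \<Longrightarrow> y \<in> V \<Longrightarrow> definable V (\<lambda>\<sigma> a. a x <\<^sub>P a y)"
  by (rule definableI[of "LessP x y"]) auto

lemma definable_less_V: "x \<in> V \<Longrightarrow> y \<in> V \<Longrightarrow> definable V (\<lambda>\<sigma> a. a x <\<^sub>V a y)"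
  by (rule definableI[of "LessV x y"]) auto

lemma definable_not: "definable V R \<Longrightarrow> definable V (\<lambda>\<sigma> a. \<not> R \<sigma> a)"
  unfolding definable_def by (metis fv.simps(4) sat.simps(4))

lemma definable_conj:
  assumes "definable V R" "definable V R'"
  shows "definable V (\<lambda>\<sigma> a. R \<sigma> a \<and> R' \<sigma> a)"
proof -
  from assms obtain \<phi> \<psi> where
    "fv \<phi> \<subseteq> V" "\<And>\<sigma> a. is_perm \<sigma> \<Longrightarrow> a \<in> V \<rightarrow> elems \<sigma> \<Longrightarrow> sat \<sigma> a \<phi> \<longleftrightarrow> R \<sigma> a"
    "fv \<psi> \<subseteq> V" "\<And>\<sigma> a. is_perm \<sigma> \<Longrightarrow> a \<in> V \<rightarrow> elems \<sigma> \<Longrightarrow> sat \<sigma> a \<psi> \<longleftrightarrow> R' \<sigma> a"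
    unfolding definable_def by metis
  then show ?thesis by (intro definableI[of "Conj \<phi> \<psi>"]) auto
qed

lemma definable_disj:
  assumes "definable V R" "definable V R'"
  shows "definable V (\<lambda>\<sigma> a. R \<sigma> a \<or> R' \<sigma> a)"
  by (rule definable_cong[OF definable_not[OF definable_conj[OF definable_not definable_not]]])
    (use assms in auto)

text \<open>Truth is expressed as \<open>x = x\<close>, with \<open>x\<close> taken from
  \<open>V\<close>.\<close>

lemma definable_True:
  assumes "V \<noteq> {}"
  shows "definable V (\<lambda>\<sigma> a. True)"
proof -
  obtain x where "x \<in> V" using assms by auto
  then show ?thesis by (intro definable_cong[OF definable_eq[of x V x]]) auto
qed

lemma definable_const: "V \<noteq> {} \<Longrightarrow> definable V (\<lambda>\<sigma> a. b)"
  using definable_not[OF definable_True] definable_True by (cases b) auto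

lemma definable_iff:
  assumes "definable V R" "definable V R'"
  shows "definable V (\<lambda>\<sigma> a. R \<sigma> a \<longleftrightarrow> R' \<sigma> a)"
  by (rule definable_cong[OF definable_disj[OF definable_conj[OF assms]
          definable_conj[OF assms[THEN definable_not]]]]) auto

lemma definable_Ball:
  assumes "finite I" "V \<noteq> {}" "\<And>i. i \<in> I \<Longrightarrow> definable V (R i)"
  shows "definable V (\<lambda>\<sigma> a. \<forall>i\<in>I. R i \<sigma> a)"
  using assms
proof (induction I)
  case empty
  then show ?case by (simp add: definable_True)
next
  case (insert i I)
  then show ?case by (simp add: definable_conj)
qed

lemma definable_Bex:
  assumes "finite I" "V \<noteq> {}" "\<And>i. i \<in> I \<Longrightarrow> definable V (R i)"
  shows "definable V (\<lambda>\<sigma> a. \<exists>i\<in>I. R i \<sigma> a)"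
  by (rule definable_cong[OF definable_not[OF definable_Ball[of I V "\<lambda>i \<sigma> a. \<not> R i \<sigma> a"]]])
    (use assms in \<open>auto intro: definable_not\<close>)

lemma definable_Ex:
  assumes "definable (insert x V) R"
  shows "definable V (\<lambda>\<sigma> a. \<exists>e\<in>elems \<sigma>. R \<sigma> (a(x := e)))"
proof -
  from assms obtain \<phi> where \<phi>: "fv \<phi> \<subseteq> insert x V"
    "\<And>\<sigma> a. is_perm \<sigma> \<Longrightarrow> a \<in> insert x V \<rightarrow> elems \<sigma> \<Longrightarrow> sat \<sigma> a \<phi> \<longleftrightarrow> R \<sigma> a"
    unfolding definable_def by metis
  show ?thesis
  proof (rule definableI[of "Ex x \<phi>"])
    show "fv (Ex x \<phi>) \<subseteq> V" using \<phi>(1) by auto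
    fix \<sigma> a assume \<sigma>: "is_perm \<sigma>" and a: "a \<in> V \<rightarrow> elems \<sigma>"
    have "a(x := e) \<in> insert x V \<rightarrow> elems \<sigma>" if "e \<in> elems \<sigma>" for e using a that by auto
    then show "sat \<sigma> a (Ex x \<phi>) \<longleftrightarrow> (\<exists>e\<in>elems \<sigma>. R \<sigma> (a(x := e)))"
      using \<phi>(2)[OF \<sigma>] by simp
  qed
qed

text \<open>The indices are external to the logic: the formula is a disjunction over the possible
  sets \<open>T\<close> of indices at which the relation holds.\<close>

lemma definable_card_eq:
  assumes "finite I" "V \<noteq> {}" "\<And>i. i \<in> I \<Longrightarrow> definable V (R i)"
  shows "definable V (\<lambda>\<sigma> a. card {i \<in> I. R i \<sigma> a} = n)"
proof (rule definable_cong)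
  let ?T = "{T. T \<subseteq> I \<and> card T = n}"
  show "definable V (\<lambda>\<sigma> a. \<exists>T\<in>?T. \<forall>i\<in>I. i \<in> T \<longleftrightarrow> R i \<sigma> a)"
    by (intro definable_Bex definable_Ball definable_iff definable_const) (use assms in auto)
  show "(\<exists>T\<in>?T. \<forall>i\<in>I. i \<in> T \<longleftrightarrow> R i \<sigma> a) \<longleftrightarrow> card {i \<in> I. R i \<sigma> a} = n" for \<sigma> a
  proof
    assume "\<exists>T\<in>?T. \<forall>i\<in>I. i \<in> T \<longleftrightarrow> R i \<sigma> a"
    then obtain T where "T \<subseteq> I" "card T = n" "\<forall>i\<in>I. i \<in> T \<longleftrightarrow> R i \<sigma> a" by blast
    moreover from this have "{i \<in> I. R i \<sigma> a} = T" by blast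
    ultimately show "card {i \<in> I. R i \<sigma> a} = n" by simp
  qed (intro bexI[of _ "{i \<in> I. R i \<sigma> a}"], auto)
qed

section \<open>Counting the points of a cell by a formula\<close>

lemma definable_in_cell:
  assumes \<rho>: "\<rho> permutes {1..k}" and "1 \<le> k" "{1..k} \<subseteq> V" "v \<in> V"
  shows "definable V (\<lambda>\<sigma> a. a v \<in> cell \<sigma> k (a \<circ> \<rho>) i j)"
proof (rule definable_cong)
  have V: "\<rho> t \<in> V" if "t \<in> {1..k}" for t using permutes_in_image[OF \<rho>] that assms by blast
  \<comment> \<open>\<open>1 \<le> i\<close> and \<open>1 \<le> j\<close> exclude the index 0, for
    which \<open>i - 1\<close> truncates to 0 although the cell is empty.\<close>
  show "definable V (\<lambda>\<sigma> a. (\<forall>t\<in>{1..k}. a v \<noteq> a (\<rho> t)) \<and>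
      card {t \<in> {1..k}. a (\<rho> t) <\<^sub>V a v} = i - 1 \<and> card {t \<in> {1..k}. a (\<rho> t) <\<^sub>P a v} = j - 1 \<and>
      1 \<le> i \<and> 1 \<le> j)"
    by (intro definable_conj definable_Ball definable_not definable_eq definable_card_eq
        definable_less_V definable_less_P definable_const V) (use assms in auto)
  show "((\<forall>t\<in>{1..k}. a v \<noteq> a (\<rho> t)) \<and>
      card {t \<in> {1..k}. a (\<rho> t) <\<^sub>V a v} = i - 1 \<and> card {t \<in> {1..k}. a (\<rho> t) <\<^sub>P a v} = j - 1 \<and>
      1 \<le> i \<and> 1 \<le> j) \<longleftrightarrow> a v \<in> cell \<sigma> k (a \<circ> \<rho>) i j" if "a \<in> V \<rightarrow> elems \<sigma>" for \<sigma> a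
    using that assms(4) by (auto simp: cell_def)
qed

lemma Suc_le_card_iff:
  assumes "finite X"
  shows "Suc n \<le> card X \<longleftrightarrow> (\<exists>x\<in>X. n \<le> card (X - {x}))"
proof
  assume *: "Suc n \<le> card X"
  then have "X \<noteq> {}" by auto
  then obtain x where "x \<in> X" by blast
  with * assms show "\<exists>x\<in>X. n \<le> card (X - {x})" by auto
next
  assume "\<exists>x\<in>X. n \<le> card (X - {x})"
  then obtain x where "x \<in> X" "n \<le> card (X - {x})" by blast
  with assms show "Suc n \<le> card X" by (metis Suc_le_mono card.remove)
qed

lemma cell_cong:
  assumes "\<And>t. t \<in> {1..k} \<Longrightarrow> s t = s' t"
  shows "cell \<sigma> k s i j = cell \<sigma> k s' i j"
proof -
  have "{t \<in> {1..k}. s t <\<^sub>V x} = {t \<in> {1..k}. s' t <\<^sub>V x}"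
    "{t \<in> {1..k}. s t <\<^sub>P x} = {t \<in> {1..k}. s' t <\<^sub>P x}" for x
    using assms by auto
  moreover have "s ` {1..k} = s' ` {1..k}" using assms by (rule image_cong[OF refl])
  ultimately show ?thesis by (simp only: cell_def)
qed

text \<open>At least \<open>n + 1\<close> points means one point and at least \<open>n\<close>
  others. The variables in \<open>Z\<close> hold the points chosen so far; the induction needs the
  claim for all \<open>Z\<close>, since each step adds a fresh variable.\<close>

lemma definable_cell_ge:
  assumes \<rho>: "\<rho> permutes {1..k}" and "1 \<le> k" "finite Z" "Z \<inter> {1..k} = {}"
  shows "definable ({1..k} \<union> Z) (\<lambda>\<sigma> a. n \<le> card (cell \<sigma> k (a \<circ> \<rho>) i j - a ` Z))"
  using assms(3,4)
proof (induction n arbitrary: Z)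
  case 0
  then show ?case using \<open>1 \<le> k\<close> by (simp add: definable_True)
next
  case (Suc n)
  obtain w where w: "w \<notin> {1..k} \<union> Z"
    using ex_new_if_finite[of "{1..k} \<union> Z"] Suc.prems by auto
  let ?V = "{1..k} \<union> Z"
  have "definable ({1..k} \<union> insert w Z) (\<lambda>\<sigma> a. n \<le> card (cell \<sigma> k (a \<circ> \<rho>) i j - a ` insert w Z))"
    using Suc.prems w by (intro Suc.IH) auto
  then have "definable (insert w ?V) (\<lambda>\<sigma> a. n \<le> card (cell \<sigma> k (a \<circ> \<rho>) i j - a ` insert w Z))"
    by simp
  moreover have "definable (insert w ?V) (\<lambda>\<sigma> a. \<forall>z\<in>Z. a w \<noteq> a z)"
    using Suc.prems by (intro definable_Ball definable_not definable_eq) auto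
  moreover have "definable (insert w ?V) (\<lambda>\<sigma> a. a w \<in> cell \<sigma> k (a \<circ> \<rho>) i j)"
    using assms(1,2) by (intro definable_in_cell) auto
  ultimately have "definable (insert w ?V) (\<lambda>\<sigma> a. a w \<in> cell \<sigma> k (a \<circ> \<rho>) i j \<and>
      (\<forall>z\<in>Z. a w \<noteq> a z) \<and> n \<le> card (cell \<sigma> k (a \<circ> \<rho>) i j - a ` insert w Z))"
    by (intro definable_conj)
  then show ?case
  proof (rule definable_cong[OF definable_Ex])
    fix \<sigma> a
    let ?C = "cell \<sigma> k (a \<circ> \<rho>) i j"
    have cell: "cell \<sigma> k (a(w := e) \<circ> \<rho>) i j = ?C" for e
      by (rule cell_cong) (use w permutes_in_image[OF \<rho>] in auto)
    have img: "a(w := e) ` insert w Z = insert e (a ` Z)" "\<And>z. z \<in> Z \<Longrightarrow> (a(w := e)) z = a z" for e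
      using w by auto
    have fin: "finite (?C - a ` Z)"
      by (rule finite_subset[OF _ finite_elems[of \<sigma>]]) (auto simp: cell_def)
    have "(\<exists>e\<in>elems \<sigma>. e \<in> ?C \<and> (\<forall>z\<in>Z. e \<noteq> a z) \<and> n \<le> card (?C - insert e (a ` Z))) \<longleftrightarrow>
        (\<exists>e\<in>?C - a ` Z. n \<le> card (?C - a ` Z - {e}))"
      by (auto simp: cell_def set_diff_eq Bex_def conj_ac)
    also have "\<dots> \<longleftrightarrow> Suc n \<le> card (?C - a ` Z)"
      using Suc_le_card_iff[OF fin] by simp
    finally show "(\<exists>e\<in>elems \<sigma>. (a(w := e)) w \<in> cell \<sigma> k (a(w := e) \<circ> \<rho>) i j \<and>
        (\<forall>z\<in>Z. (a(w := e)) w \<noteq> (a(w := e)) z) \<and>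
        n \<le> card (cell \<sigma> k (a(w := e) \<circ> \<rho>) i j - a(w := e) ` insert w Z)) \<longleftrightarrow>
        Suc n \<le> card (?C - a ` Z)"
      by (simp only: cell img fun_upd_same cong: ball_cong)
  qed
qed

lemma definable_cell_matrix_eq:
  assumes \<rho>: "\<rho> permutes {1..k}" and "1 \<le> k"
  shows "definable {1..k} (\<lambda>\<sigma> a. cell_matrix \<sigma> k (a \<circ> \<rho>) i j = n)"
proof -
  have "definable {1..k} (\<lambda>\<sigma> a. n \<le> card (cell \<sigma> k (a \<circ> \<rho>) i j))" for n
    using definable_cell_ge[OF assms, of "{}"] by simp
  from definable_conj[OF this[of n] definable_not[OF this[of "Suc n"]]]
  show ?thesis by (rule definable_cong) (auto simp: cell_matrix_def)
qed

lemma definable_occurrence: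
  assumes \<rho>: "\<rho> permutes {1..len \<pi>}" and "1 \<le> len \<pi>"
  shows "definable {1..len \<pi>} (\<lambda>\<sigma> a. occurrence \<pi> \<sigma> (a \<circ> \<rho>))"
proof (rule definable_cong)
  let ?I = "{1..len \<pi>}"
  have \<rho>_in: "\<rho> t \<in> ?I" if "t \<in> ?I" for t using permutes_in_image[OF \<rho>] that by blast
  show "definable ?I (\<lambda>\<sigma> a. (\<forall>i\<in>?I. \<forall>j\<in>{j \<in> ?I. i < j}. a (\<rho> i) <\<^sub>P a (\<rho> j)) \<and>
      (\<forall>i\<in>?I. \<forall>j\<in>?I. a (\<rho> i) <\<^sub>V a (\<rho> j) \<longleftrightarrow> app \<pi> i < app \<pi> j))"
    by (intro definable_conj definable_Ball definable_iff definable_less_P definable_less_V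
        definable_const \<rho>_in) (use assms in auto)
  show "((\<forall>i\<in>?I. \<forall>j\<in>{j \<in> ?I. i < j}. a (\<rho> i) <\<^sub>P a (\<rho> j)) \<and>
      (\<forall>i\<in>?I. \<forall>j\<in>?I. a (\<rho> i) <\<^sub>V a (\<rho> j) \<longleftrightarrow> app \<pi> i < app \<pi> j)) \<longleftrightarrow> occurrence \<pi> \<sigma> (a \<circ> \<rho>)"
    if "a \<in> ?I \<rightarrow> elems \<sigma>" for \<sigma> a
  proof -
    have "a \<circ> \<rho> \<in> ?I \<rightarrow> elems \<sigma>"
    proof
      fix t assume "t \<in> ?I"
      from funcset_mem[OF that \<rho>_in[OF this]] show "(a \<circ> \<rho>) t \<in> elems \<sigma>" by simp
    qed
    then show ?thesis unfolding occurrence_def by auto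
  qed
qed

section \<open>Monotone points in large cells\<close>

lemma cyc_pairs_iff: "(i, j) \<in> cyc_pairs xs \<longleftrightarrow> (\<exists>t<length xs. i = xs ! t \<and> j = xs ! (Suc t mod length xs))"
  by (auto simp: cyc_pairs_def in_set_zip nth_rotate1)

lemma cyc_pairs_fst_unique: "distinct xs \<Longrightarrow> (i, j) \<in> cyc_pairs xs \<Longrightarrow> (i', j) \<in> cyc_pairs xs \<Longrightarrow> i = i'"
  unfolding cyc_pairs_def in_set_zip by (auto simp: nth_eq_iff_index_eq)

lemma cyc_pairs_snd_unique: "distinct xs \<Longrightarrow> (i, j) \<in> cyc_pairs xs \<Longrightarrow> (i, j') \<in> cyc_pairs xs \<Longrightarrow> j = j'"
  unfolding cyc_pairs_def in_set_zip by (auto simp: nth_eq_iff_index_eq)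

lemma fst_cyc_pairs: "fst ` cyc_pairs xs = set xs"
  unfolding cyc_pairs_def by (metis length_rotate1 list.set_map map_fst_zip)

lemma snd_cyc_pairs: "snd ` cyc_pairs xs = set xs"
  unfolding cyc_pairs_def by (metis length_rotate1 list.set_map map_snd_zip set_rotate1)

lemma cyc_pairs_neq:
  assumes "distinct xs" "2 \<le> length xs" "(i, j) \<in> cyc_pairs xs"
  shows "i \<noteq> j"
proof -
  obtain t where t: "t < length xs" "i = xs ! t" "j = xs ! (Suc t mod length xs)"
    using assms(3) by (auto simp: cyc_pairs_iff)
  have "Suc t mod length xs \<noteq> t"
    using t(1) assms(2) by (cases "Suc t = length xs") auto
  moreover have "Suc t mod length xs < length xs"
    using mod_less_divisor[of "length xs" "Suc t"] t(1) by linarith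
  ultimately show ?thesis using t assms(1) by (simp add: nth_eq_iff_index_eq)
qed

section \<open>Monotone sequences from Ramsey's theorem\<close>

definition monotone_points :: "nat \<Rightarrow> (nat \<Rightarrow> elem) \<Rightarrow> bool" where
  "monotone_points n d \<longleftrightarrow> (\<forall>q\<in>{1..n}. \<forall>q'\<in>{1..n}. q < q' \<longrightarrow> d q <\<^sub>P d q') \<and>
      ((\<forall>q\<in>{1..n}. \<forall>q'\<in>{1..n}. q < q' \<longrightarrow> d q <\<^sub>V d q') \<or>
       (\<forall>q\<in>{1..n}. \<forall>q'\<in>{1..n}. q < q' \<longrightarrow> d q' <\<^sub>V d q))"

text \<open>Join two points if their position and value orders agree: a clique is then increasing
  and an independent set decreasing. The bound depends on \<open>n\<close> only, hence is uniform in
  \<sigma>.\<close>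

lemma ex_monotone_subsequence:
  fixes n :: nat
  shows "\<exists>N. \<forall>\<sigma> Z. is_perm \<sigma> \<longrightarrow> Z \<subseteq> elems \<sigma> \<longrightarrow> N \<le> card Z \<longrightarrow>
    (\<exists>d. (\<forall>q\<in>{1..n}. d q \<in> Z) \<and> monotone_points n d)"
proof -
  obtain N where N: "\<And>(V :: elem set) E. finite V \<Longrightarrow> N \<le> card V \<Longrightarrow>
      \<exists>R\<subseteq>V. card R = n \<and> clique R E \<or> card R = n \<and> indep R E"
    using ramsey2[of n n] by auto
  show ?thesis
  proof (intro exI[of _ N] allI impI)
    fix \<sigma> Z assume \<sigma>: "is_perm \<sigma>" and Z: "Z \<subseteq> elems \<sigma>" and card: "N \<le> card Z"
    define E where "E = {{x, y} | x y. x <\<^sub>P y \<and> x <\<^sub>V y}"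
    have "finite Z" using Z by (rule finite_subset) simp
    from N[OF this card, of E] obtain R where R: "R \<subseteq> Z" "card R = n" "clique R E \<or> indep R E" by blast
    have finR: "finite R" using \<open>finite Z\<close> R(1) by (rule rev_finite_subset)
    have inj: "inj_on fst R" using inj_on_fst_elems R(1) Z by (meson inj_on_subset)
    \<comment> \<open>The positions of \<open>R\<close> in increasing order, with list indices from
      0 turned into indices from 1.\<close>
    define h where "h = (\<lambda>q. sorted_list_of_set (fst ` R) ! (q - 1))"
    have len: "length (sorted_list_of_set (fst ` R)) = n"
      using R(2) inj by (simp add: card_image)
    have h_in: "h q \<in> fst ` R" if "q \<in> {1..n}" for q
      using nth_mem[of "q - 1" "sorted_list_of_set (fst ` R)"] that finR len by (auto simp: h_def)
    have h_less: "h q < h q'" if "q \<in> {1..n}" "q' \<in> {1..n}" "q < q'" for q q'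
      using sorted_wrt_nth_less[OF strict_sorted_list_of_set, of "q - 1" "q' - 1" "fst ` R"] that len
      by (simp add: h_def)
    define d where "d = (\<lambda>q. the_inv_into R fst (h q))"
    have d_in: "d q \<in> R" and d_fst: "fst (d q) = h q" if "q \<in> {1..n}" for q
      using the_inv_into_into[OF inj h_in[OF that]] f_the_inv_into_f[OF inj h_in[OF that]]
      by (auto simp: d_def)
    have dP: "d q <\<^sub>P d q'" if "q \<in> {1..n}" "q' \<in> {1..n}" "q < q'" for q q'
      using h_less[OF that] that by (simp add: less_P_def d_fst)
    have dV: "d q <\<^sub>V d q' \<longleftrightarrow> {d q, d q'} \<in> E" if "q \<in> {1..n}" "q' \<in> {1..n}" "q < q'" for q q'
    proof
      assume "d q <\<^sub>V d q'"
      then show "{d q, d q'} \<in> E" unfolding E_def using dP[OF that] by blast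
    next
      assume "{d q, d q'} \<in> E"
      then obtain x y where "{d q, d q'} = {x, y}" "x <\<^sub>P y" "x <\<^sub>V y" unfolding E_def by blast
      then show "d q <\<^sub>V d q'" using dP[OF that] by (auto simp: doubleton_eq_iff less_P_def)
    qed
    have neq: "d q \<noteq> d q'" if "q \<in> {1..n}" "q' \<in> {1..n}" "q < q'" for q q'
      using dP[OF that] by (auto simp: less_P_def)
    have "(\<forall>q\<in>{1..n}. \<forall>q'\<in>{1..n}. q < q' \<longrightarrow> d q <\<^sub>V d q') \<or>
       (\<forall>q\<in>{1..n}. \<forall>q'\<in>{1..n}. q < q' \<longrightarrow> d q' <\<^sub>V d q)"
      using R(3)
    proof
      assume "clique R E"
      then show ?thesis using dV neq d_in by (simp add: clique_def)
    next
      assume "indep R E"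
      then have not: "\<not> d q <\<^sub>V d q'" if "q \<in> {1..n}" "q' \<in> {1..n}" "q < q'" for q q'
        using dV[OF that] neq[OF that] d_in that by (simp add: indep_def)
      have "snd (d q) \<noteq> snd (d q')" if "q \<in> {1..n}" "q' \<in> {1..n}" "q < q'" for q q'
        using neq[OF that] inj_onD[OF inj_on_snd_elems[OF \<sigma>]] d_in that R(1) Z by blast
      then show ?thesis using not by (meson less_V_def linorder_neqE_nat)
    qed
    then show "\<exists>d. (\<forall>q\<in>{1..n}. d q \<in> Z) \<and> monotone_points n d"
      using d_in dP R(1) by (intro exI[of _ d]) (auto simp: monotone_points_def)
  qed
qed

text \<open>The keys of a point depend only on its cell, or on its index if it belongs to the occurrence; so they
  compare points of different permutations that contain the same pattern.\<close>

definition pos_key :: "nat \<Rightarrow> (nat \<Rightarrow> elem) \<Rightarrow> elem \<Rightarrow> nat" where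
  "pos_key k s x = card {t \<in> {1..k}. s t <\<^sub>P x} + card {t \<in> {1..k}. \<not> x <\<^sub>P s t}"

definition val_key :: "nat \<Rightarrow> (nat \<Rightarrow> elem) \<Rightarrow> elem \<Rightarrow> nat" where
  "val_key k s x = card {t \<in> {1..k}. s t <\<^sub>V x} + card {t \<in> {1..k}. \<not> x <\<^sub>V s t}"

lemma less_P_if_pos_key_less:
  assumes "pos_key k s x < pos_key k s y"
  shows "x <\<^sub>P y"
proof (rule ccontr)
  assume "\<not> x <\<^sub>P y"
  then have "pos_key k s y \<le> pos_key k s x"
    unfolding pos_key_def by (intro add_mono card_mono) (auto simp: less_P_def)
  with assms show False by simp
qed

lemma less_V_if_val_key_less:
  assumes "val_key k s x < val_key k s y"
  shows "x <\<^sub>V y"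
proof (rule ccontr)
  assume "\<not> x <\<^sub>V y"
  then have "val_key k s y \<le> val_key k s x"
    unfolding val_key_def by (intro add_mono card_mono) (auto simp: less_V_def)
  with assms show False by simp
qed

text \<open>For a permutation \<pi> these are the odd numbers \<open>2 * j - 1\<close> and
  \<open>2 * app \<pi> j - 1\<close>. What matters later is that neither \<sigma> nor
  \<open>s\<close> occurs in them.\<close>

lemma key_occurrence:
  assumes occ: "occurrence \<pi> \<sigma> s" and j: "j \<in> {1..len \<pi>}"
  shows "pos_key (len \<pi>) s (s j) = card {t \<in> {1..len \<pi>}. t < j} + card {t \<in> {1..len \<pi>}. \<not> j < t}"
    and "val_key (len \<pi>) s (s j) =
      card {t \<in> {1..len \<pi>}. app \<pi> t < app \<pi> j} + card {t \<in> {1..len \<pi>}. \<not> app \<pi> j < app \<pi> t}"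
  unfolding pos_key_def val_key_def
  using occurrenceD(2,3)[OF occ _ j] occurrenceD(2,3)[OF occ j] by (simp_all cong: conj_cong)

lemma not_less_P_occurrence:
  assumes "s ` {1..k} \<subseteq> elems \<sigma>" "x \<in> elems \<sigma> - s ` {1..k}" "t \<in> {1..k}"
  shows "\<not> x <\<^sub>P s t \<longleftrightarrow> s t <\<^sub>P x"
proof -
  have "fst x \<noteq> fst (s t)" using inj_onD[OF inj_on_fst_elems, of x "s t" \<sigma>] assms by blast
  then show ?thesis by (auto simp: less_P_def)
qed

lemma not_less_V_occurrence:
  assumes "is_perm \<sigma>" "s ` {1..k} \<subseteq> elems \<sigma>" "x \<in> elems \<sigma> - s ` {1..k}" "t \<in> {1..k}"
  shows "\<not> x <\<^sub>V s t \<longleftrightarrow> s t <\<^sub>V x"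
proof -
  have "snd x \<noteq> snd (s t)"
    using inj_onD[OF inj_on_snd_elems[OF assms(1)], of x "s t"] assms by blast
  then show ?thesis by (auto simp: less_V_def)
qed

text \<open>Outside the occurrence the two counts in a key coincide. So these keys are even and lie
  between the odd keys of the occurrence.\<close>

lemma key_cell:
  assumes \<sigma>: "is_perm \<sigma>" and occ: "occurrence \<pi> \<sigma> s" and x: "x \<in> cell \<sigma> (len \<pi>) s i j"
  shows "pos_key (len \<pi>) s x = 2 * (j - 1)" and "val_key (len \<pi>) s x = 2 * (i - 1)"
proof -
  let ?k = "len \<pi>"
  have s: "s ` {1..?k} \<subseteq> elems \<sigma>" using occurrenceD(1)[OF occ] by blast
  have xE: "x \<in> elems \<sigma> - s ` {1..?k}" using x by (simp add: cell_def)
  have "{t \<in> {1..?k}. \<not> x <\<^sub>P s t} = {t \<in> {1..?k}. s t <\<^sub>P x}"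
    using not_less_P_occurrence[OF s xE] by blast
  then show "pos_key ?k s x = 2 * (j - 1)" using x by (auto simp: pos_key_def cell_def)
  have "{t \<in> {1..?k}. \<not> x <\<^sub>V s t} = {t \<in> {1..?k}. s t <\<^sub>V x}"
    using not_less_V_occurrence[OF \<sigma> s xE] by blast
  then show "val_key ?k s x = 2 * (i - 1)" using x by (auto simp: val_key_def cell_def)
qed

section \<open>Points of an expansion and their keys\<close>

lemma expansionD:
  assumes "is_expansion \<pi> is \<tau> s"
  shows "is_perm \<tau>" "len \<tau> = len \<pi> + length is" "occurrence \<pi> \<tau> s" "stable \<tau> (len \<pi>) s"
    "i \<in> {1..len \<pi> + 1} \<Longrightarrow> j \<in> {1..len \<pi> + 1} \<Longrightarrow>
      cell_matrix \<tau> (len \<pi>) s i j = (if (i, j) \<in> cyc_pairs is then 1 else 0)"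
  using assms by (simp_all add: is_expansion_def cyc_matrix_def cyc_pairs_def)

lemma expansion_cell:
  assumes "is_expansion \<pi> is \<tau> s" "x \<in> elems \<tau> - s ` {1..len \<pi>}"
  shows "(row (len \<pi>) s x, col (len \<pi>) s x) \<in> cyc_pairs is"
proof -
  have x: "x \<in> cell \<tau> (len \<pi>) s (row (len \<pi>) s x) (col (len \<pi>) s x)"
    using assms(2) by (simp add: cell_eq)
  have "finite (cell \<tau> (len \<pi>) s i j)" for i j by (simp add: cell_eq)
  then have "cell_matrix \<tau> (len \<pi>) s (row (len \<pi>) s x) (col (len \<pi>) s x) \<noteq> 0"
    using x unfolding cell_matrix_def by auto
  then show ?thesis
    using expansionD(5)[OF assms(1), of "row (len \<pi>) s x" "col (len \<pi>) s x"]
      row_in[of "len \<pi>" s x] col_in[of "len \<pi>" s x] by (auto split: if_splits)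
qed

text \<open>A distinct list puts at most one pair into each row and each column, and the cell of
  such a pair holds one point.\<close>

lemma expansion_cell_unique:
  assumes exp: "is_expansion \<pi> is \<tau> s" and "distinct is"
    and x: "x \<in> elems \<tau> - s ` {1..len \<pi>}" and y: "y \<in> elems \<tau> - s ` {1..len \<pi>}"
    and eq: "col (len \<pi>) s x = col (len \<pi>) s y \<or> row (len \<pi>) s x = row (len \<pi>) s y"
  shows "x = y"
proof -
  let ?k = "len \<pi>"
  note pairs = expansion_cell[OF exp x] expansion_cell[OF exp y]
  have both: "row ?k s x = row ?k s y" "col ?k s x = col ?k s y"
    using eq cyc_pairs_fst_unique[OF \<open>distinct is\<close>] cyc_pairs_snd_unique[OF \<open>distinct is\<close>] pairs by metis+
  have "card (cell \<tau> ?k s (row ?k s x) (col ?k s x)) \<le> 1"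
    using expansionD(5)[OF exp, of "row ?k s x" "col ?k s x"] row_in[of ?k s x] col_in[of ?k s x]
    by (auto simp: cell_matrix_def split: if_splits)
  moreover have "x \<in> cell \<tau> ?k s (row ?k s x) (col ?k s x)" "y \<in> cell \<tau> ?k s (row ?k s x) (col ?k s x)"
    using x y both by (simp_all add: cell_eq)
  moreover have "finite (cell \<tau> ?k s (row ?k s x) (col ?k s x))" by (simp add: cell_eq)
  ultimately show ?thesis by (metis One_nat_def card_le_Suc0_iff_eq)
qed

text \<open>In an expansion \<open>less_P_if_pos_key_less\<close> has a converse: two points with
  equal keys would both be new points in one column, where there is at most one.\<close>

lemma pos_key_less_iff:
  assumes exp: "is_expansion \<pi> is \<tau> s" and "distinct is" and x: "x \<in> elems \<tau>" and y: "y \<in> elems \<tau>"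
  shows "pos_key (len \<pi>) s x < pos_key (len \<pi>) s y \<longleftrightarrow> x <\<^sub>P y"
proof
  let ?k = "len \<pi>"
  assume less: "x <\<^sub>P y"
  let ?A = "\<lambda>x. {t \<in> {1..?k}. s t <\<^sub>P x}" and ?B = "\<lambda>x. {t \<in> {1..?k}. \<not> x <\<^sub>P s t}"
  have sub: "?A x \<subseteq> ?A y" "?B x \<subseteq> ?B y" using less by (auto simp: less_P_def)
  show "pos_key ?k s x < pos_key ?k s y"
  proof (rule ccontr)
    assume "\<not> pos_key ?k s x < pos_key ?k s y"
    moreover have "card (?A x) \<le> card (?A y)" "card (?B x) \<le> card (?B y)"
      using sub by (auto intro!: card_mono simp del: atLeastAtMost_iff)
    ultimately have eq': "card (?A x) = card (?A y)" "card (?B x) = card (?B y)"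
      unfolding pos_key_def by linarith+
    have eq: "?A x = ?A y" "?B x = ?B y"
      by (rule card_subset_eq[OF _ sub(1) eq'(1)], simp) (rule card_subset_eq[OF _ sub(2) eq'(2)], simp)
    have "x \<notin> s ` {1..?k}"
    proof
      assume "x \<in> s ` {1..?k}"
      then obtain t where t: "t \<in> {1..?k}" "x = s t" by blast
      then have "t \<in> ?A y" using less by simp
      then have "t \<in> ?A x" by (simp only: eq(1))
      then show False using t(2) by (simp add: less_P_def)
    qed
    moreover have "y \<notin> s ` {1..?k}"
    proof
      assume "y \<in> s ` {1..?k}"
      then obtain t where t: "t \<in> {1..?k}" "y = s t" by blast
      then have "t \<in> ?B y" by (simp add: less_P_def)
      then have "t \<in> ?B x" by (simp only: eq(2))
      then show False using t(2) less by simp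
    qed
    moreover have "col ?k s x = col ?k s y" using eq(1) by (simp add: col_def)
    ultimately have "x = y" using expansion_cell_unique[OF exp \<open>distinct is\<close>] x y by blast
    with less show False by (simp add: less_P_def)
  qed
qed (rule less_P_if_pos_key_less)

lemma val_key_less_iff:
  assumes exp: "is_expansion \<pi> is \<tau> s" and "distinct is" and x: "x \<in> elems \<tau>" and y: "y \<in> elems \<tau>"
  shows "val_key (len \<pi>) s x < val_key (len \<pi>) s y \<longleftrightarrow> x <\<^sub>V y"
proof
  let ?k = "len \<pi>"
  assume less: "x <\<^sub>V y"
  let ?A = "\<lambda>x. {t \<in> {1..?k}. s t <\<^sub>V x}" and ?B = "\<lambda>x. {t \<in> {1..?k}. \<not> x <\<^sub>V s t}"
  have sub: "?A x \<subseteq> ?A y" "?B x \<subseteq> ?B y" using less by (auto simp: less_V_def)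
  show "val_key ?k s x < val_key ?k s y"
  proof (rule ccontr)
    assume "\<not> val_key ?k s x < val_key ?k s y"
    moreover have "card (?A x) \<le> card (?A y)" "card (?B x) \<le> card (?B y)"
      using sub by (auto intro!: card_mono simp del: atLeastAtMost_iff)
    ultimately have eq': "card (?A x) = card (?A y)" "card (?B x) = card (?B y)"
      unfolding val_key_def by linarith+
    have eq: "?A x = ?A y" "?B x = ?B y"
      by (rule card_subset_eq[OF _ sub(1) eq'(1)], simp) (rule card_subset_eq[OF _ sub(2) eq'(2)], simp)
    have "x \<notin> s ` {1..?k}"
    proof
      assume "x \<in> s ` {1..?k}"
      then obtain t where t: "t \<in> {1..?k}" "x = s t" by blast
      then have "t \<in> ?A y" using less by simp
      then have "t \<in> ?A x" by (simp only: eq(1))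
      then show False using t(2) by (simp add: less_V_def)
    qed
    moreover have "y \<notin> s ` {1..?k}"
    proof
      assume "y \<in> s ` {1..?k}"
      then obtain t where t: "t \<in> {1..?k}" "y = s t" by blast
      then have "t \<in> ?B y" by (simp add: less_V_def)
      then have "t \<in> ?B x" by (simp only: eq(2))
      then show False using t(2) less by simp
    qed
    moreover have "row ?k s x = row ?k s y" using eq(1) by (simp add: row_def)
    ultimately have "x = y" using expansion_cell_unique[OF exp \<open>distinct is\<close>] x y by blast
    with less show False by (simp add: less_V_def)
  qed
qed (rule less_V_if_val_key_less)

section \<open>Embedding inflated expansions into permutations with large cells\<close>

lemma nontrivial_cycleD:
  assumes "nontrivial_cycle k is"
  shows "distinct is" "set is \<subseteq> {1..k+1}" "2 \<le> length is"
  using assms by (simp_all add: nontrivial_cycle_def)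

lemma cyc_pairs_subset:
  assumes "(i, j) \<in> cyc_pairs is"
  shows "i \<in> set is" "j \<in> set is"
  using assms fst_cyc_pairs[of "is"] snd_cyc_pairs[of "is"] by force+

lemma col_mono: "x <\<^sub>P y \<Longrightarrow> col k s x \<le> col k s y"
  unfolding col_def by (auto intro!: card_mono simp: less_P_def)

lemma in_positions_iff:
  assumes "s \<in> {1..k} \<rightarrow> elems \<tau>" "x \<in> elems \<tau>"
  shows "fst x \<in> positions k s \<longleftrightarrow> x \<in> s ` {1..k}"
proof
  assume "fst x \<in> positions k s"
  then obtain j where j: "j \<in> {1..k}" "fst x = fst (s j)" by (auto simp: positions_def)
  then have "x = s j"
    using elems_eq_iff[OF assms(2) funcset_mem[OF assms(1) j(1)]] by simp
  with j show "x \<in> s ` {1..k}" by blast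
qed (auto simp: positions_def)

text \<open>\<open>inflators\<close> numbers the new points from left to right by counting
  positions. This number becomes the rank of the column among the entries of the cycle, because each
  such column holds exactly one new point.\<close>

lemma card_left_of:
  assumes exp: "is_expansion \<pi> is \<tau> s" and cyc: "nontrivial_cycle (len \<pi>) is"
    and x: "x \<in> elems \<tau> - s ` {1..len \<pi>}"
  shows "card ({1..<fst x} - positions (len \<pi>) s) = card {c \<in> set is. c < col (len \<pi>) s x}"
proof (rule bij_betw_same_card)
  let ?k = "len \<pi>" and ?S = "positions (len \<pi>) s"
  let ?f = "\<lambda>p. col ?k s (p, app \<tau> p)"
  note uniq = expansion_cell_unique[OF exp nontrivial_cycleD(1)[OF cyc]]
  have s: "s \<in> {1..?k} \<rightarrow> elems \<tau>" using expansionD(3)[OF exp] by (simp add: occurrence_def)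
  have elem: "(p, app \<tau> p) \<in> elems \<tau> - s ` {1..?k}" if p: "p \<in> {1..<fst x} - ?S" for p
  proof -
    have "(p, app \<tau> p) \<in> elems \<tau>" using p x elemsD(1)[of x \<tau>] by (intro elemsI) auto
    then show ?thesis using in_positions_iff[OF s, of "(p, app \<tau> p)"] p by simp
  qed
  show "bij_betw ?f ({1..<fst x} - ?S) {c \<in> set is. c < col ?k s x}"
    unfolding bij_betw_def
  proof (intro conjI equalityI subsetI)
    show "inj_on ?f ({1..<fst x} - ?S)"
      using uniq[OF elem elem] by (auto intro!: inj_onI)
  next
    fix c assume "c \<in> ?f ` ({1..<fst x} - ?S)"
    then obtain p where p: "p \<in> {1..<fst x} - ?S" "c = ?f p" by blast
    have "c \<in> set is" using cyc_pairs_subset(2)[OF expansion_cell[OF exp elem[OF p(1)]]] p(2) by simp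
    moreover have "(p, app \<tau> p) <\<^sub>P x" using p(1) by (simp add: less_P_def)
    moreover have "c \<noteq> col ?k s x" using uniq[OF elem[OF p(1)] x] p by auto
    ultimately show "c \<in> {c \<in> set is. c < col ?k s x}"
      using col_mono[of "(p, app \<tau> p)" x ?k s] p(2) by simp
  next
    fix c assume "c \<in> {c \<in> set is. c < col ?k s x}"
    then have c: "c \<in> set is" "c < col ?k s x" by auto
    then obtain i where i: "(i, c) \<in> cyc_pairs is" using snd_cyc_pairs[of "is"] by force
    then have "i \<in> {1..?k+1}" "c \<in> {1..?k+1}"
      using cyc_pairs_subset[OF i] nontrivial_cycleD(2)[OF cyc] by blast+
    then have "cell_matrix \<tau> ?k s i c = 1" using expansionD(5)[OF exp, of i c] i by simp
    then have "cell \<tau> ?k s i c \<noteq> {}" by (auto simp: cell_matrix_def)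
    then obtain y where y: "y \<in> elems \<tau> - s ` {1..?k}" "col ?k s y = c" by (auto simp: cell_eq)
    have "y <\<^sub>P x"
    proof (rule ccontr)
      assume "\<not> y <\<^sub>P x"
      moreover have "y \<noteq> x" using c y by auto
      ultimately have "x <\<^sub>P y" using elems_eq_iff[of x \<tau> y] x y(1) by (auto simp: less_P_def)
      then show False using col_mono[of x y ?k s] c y by simp
    qed
    moreover have "fst y \<notin> ?S" using in_positions_iff[OF s, of y] y(1) by blast
    moreover have "y = (fst y, app \<tau> (fst y))" using elemsD(2)[of y \<tau>] y(1) by (metis DiffD1 prod.collapse)
    ultimately show "c \<in> ?f ` ({1..<fst x} - ?S)"
      using y elemsD(1)[of y \<tau>] by (intro image_eqI[of _ _ "fst y"]) (auto simp: less_P_def)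
  qed
qed

text \<open>The occurrence in the expansion goes to \<open>s\<close>, and the \<open>q\<close>-th
  point of the block in cell \<open>(i, j)\<close> goes to \<open>d i j q\<close>; a block shorter
  than \<open>n\<close> uses an initial segment. Each image has the same keys as its block has in
  the expansion. There, order is reflected by strictly smaller keys, and in \<sigma> smaller keys
  imply order, so different blocks compare correctly. Inside a block, \<open>dP\<close> and
  \<open>dV\<close> match the direction of the inflator.\<close>

lemma inflated_expansion_pattern_of:
  assumes cyc: "nontrivial_cycle (len \<pi>) is" and infl: "is_inflated_expansion \<pi> is \<Theta> \<omega>"
    and \<Theta>: "length \<Theta> = length is" "\<And>\<theta>. \<theta> \<in> set \<Theta> \<Longrightarrow> is_perm \<theta> \<and> len \<theta> \<le> n"
    and \<sigma>: "is_perm \<sigma>" and occ: "occurrence \<pi> \<sigma> s"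
    and d: "\<And>i j q. (i, j) \<in> cyc_pairs is \<Longrightarrow> q \<in> {1..n} \<Longrightarrow> d i j q \<in> cell \<sigma> (len \<pi>) s i j"
    and dP: "\<And>i j q q'. (i, j) \<in> cyc_pairs is \<Longrightarrow> q \<in> {1..n} \<Longrightarrow> q' \<in> {1..n} \<Longrightarrow> q < q' \<Longrightarrow>
        d i j q <\<^sub>P d i j q'"
    and dV: "\<And>i j q q'. (i, j) \<in> cyc_pairs is \<Longrightarrow> q \<in> {1..n} \<Longrightarrow> q' \<in> {1..n} \<Longrightarrow> q < q' \<Longrightarrow>
        \<Theta> ! card {c \<in> set is. c < j} \<in> Increasing \<and> d i j q <\<^sub>V d i j q' \<or>
        \<Theta> ! card {c \<in> set is. c < j} \<in> Decreasing \<and> d i j q' <\<^sub>V d i j q"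
  shows "is_pattern_of \<omega> \<sigma>"
proof -
  let ?k = "len \<pi>"
  obtain \<tau> u where exp: "is_expansion \<pi> is \<tau> u"
    and \<omega>: "is_inflation \<tau> (inflators (positions ?k u) \<Theta>) \<omega>"
    using infl unfolding is_inflated_expansion_def by blast
  let ?S = "positions ?k u" and ?T = "inflators (positions ?k u) \<Theta>" and ?x = "\<lambda>p. (p, app \<tau> p)"
  note occ' = expansionD(3)[OF exp]
  have u: "u \<in> {1..?k} \<rightarrow> elems \<tau>" using occ' by (simp add: occurrence_def)
  have elem: "?x p \<in> elems \<tau>" if "p \<in> {1..len \<tau>}" for p using that by (rule elemsI)
  have cell: "?x p \<in> elems \<tau> - u ` {1..?k}" if "p \<in> {1..len \<tau>}" "p \<notin> ?S" for p
    using in_positions_iff[OF u elem[OF that(1)]] elem[OF that(1)] that(2) by simp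
  define r c where "r = (\<lambda>p. row ?k u (?x p))" and "c = (\<lambda>p. col ?k u (?x p))"
  have pair: "(r p, c p) \<in> cyc_pairs is" if "p \<in> {1..len \<tau>}" "p \<notin> ?S" for p
    unfolding r_def c_def using expansion_cell[OF exp cell[OF that]] .
  have T: "?T p = \<Theta> ! card {c' \<in> set is. c' < c p}" if "p \<in> {1..len \<tau>}" "p \<notin> ?S" for p
    using card_left_of[OF exp cyc cell[OF that]] that(2) by (simp add: inflators_def c_def)
  have T_mem: "?T p \<in> set \<Theta>" if "p \<in> {1..len \<tau>}" "p \<notin> ?S" for p
  proof -
    have "{c' \<in> set is. c' < c p} \<subset> set is" using cyc_pairs_subset(2)[OF pair[OF that]] by blast
    then have "card {c' \<in> set is. c' < c p} < card (set is)" by (intro psubset_card_mono) auto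
    also have "\<dots> = length \<Theta>" using distinct_card[OF nontrivial_cycleD(1)[OF cyc]] \<Theta>(1) by simp
    finally show ?thesis unfolding T[OF that] by (rule nth_mem)
  qed
  have T_S: "?T p = FPerm 1 id" if "p \<in> ?S" for p using that by (simp add: inflators_def)
  define idx where "idx = (\<lambda>p. SOME j. j \<in> {1..?k} \<and> ?x p = u j)"
  have idx: "idx p \<in> {1..?k}" "?x p = u (idx p)" if "p \<in> {1..len \<tau>}" "p \<in> ?S" for p
  proof -
    have "\<exists>j. j \<in> {1..?k} \<and> ?x p = u j"
      using in_positions_iff[OF u elem[OF that(1)]] that(2) by auto
    from someI_ex[OF this] show "idx p \<in> {1..?k}" "?x p = u (idx p)" by (auto simp: idx_def)
  qed
  define g where "g = (\<lambda>(p, q). if p \<in> ?S then s (idx p) else d (r p) (c p) q)"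
  have q_n: "q \<in> {1..n}" if "(p, q) \<in> block_index \<tau> ?T" "p \<notin> ?S" for p q
    using that \<Theta>(2)[OF T_mem[of p]] by (auto simp: block_index_def)
  have key: "pos_key ?k s (g (p, q)) = pos_key ?k u (?x p) \<and> val_key ?k s (g (p, q)) = val_key ?k u (?x p)"
    if pq: "(p, q) \<in> block_index \<tau> ?T" for p q
  proof -
    have p: "p \<in> {1..len \<tau>}" using pq by (auto simp: block_index_def)
    show ?thesis
    proof (cases "p \<in> ?S")
      case True
      then show ?thesis
        using key_occurrence[OF occ idx(1)[OF p True]] key_occurrence[OF occ' idx(1)[OF p True]] idx(2)[OF p True]
        by (simp add: g_def)
    next
      case False
      have "?x p \<in> cell \<tau> ?k u (r p) (c p)" using cell[OF p False] by (simp add: cell_eq r_def c_def)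
      then show ?thesis
        using key_cell[OF \<sigma> occ d[OF pair[OF p False] q_n[OF pq False]]] key_cell[OF expansionD(1)[OF exp] occ']
          False by (simp add: g_def)
    qed
  qed
  show ?thesis
  proof (rule inflation_pattern_of[OF \<omega> expansionD(1)[OF exp]])
    show "is_perm (?T p)" if "p \<in> {1..len \<tau>}" for p
      using \<Theta>(2)[OF T_mem[OF that]] T_S[of p]
      by (cases "p \<in> ?S") (auto simp: is_perm_def permutes_id)
    show "g z \<in> elems \<sigma>" if z: "z \<in> block_index \<tau> ?T" for z
    proof -
      obtain p q where pq: "z = (p, q)" by fastforce
      have p: "p \<in> {1..len \<tau>}" using z by (auto simp: block_index_def pq)
      show ?thesis
      proof (cases "p \<in> ?S")
        case True
        then show ?thesis using occurrenceD(1)[OF occ idx(1)[OF p True]] by (simp add: g_def pq)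
      next
        case False
        then show ?thesis using d[OF pair[OF p False] q_n[OF z[unfolded pq] False]]
          by (simp add: g_def pq cell_eq)
      qed
    qed
    fix p q p' q' assume *: "(p, q) \<in> block_index \<tau> ?T" "(p', q') \<in> block_index \<tau> ?T"
    then have p: "p \<in> {1..len \<tau>}" "p' \<in> {1..len \<tau>}" by (auto simp: block_index_def)
    note less_iff = pos_key_less_iff[OF exp nontrivial_cycleD(1)[OF cyc] elem[OF p(1)] elem[OF p(2)]]
      val_key_less_iff[OF exp nontrivial_cycleD(1)[OF cyc] elem[OF p(1)] elem[OF p(2)]]
    have single: "q = 1" "q' = 1" if "p = p'" "p \<in> ?S"
      using that * T_S by (auto simp: block_index_def)
    show "g (p, q) <\<^sub>P g (p', q')" if "p < p' \<or> p = p' \<and> q < q'"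
      using that
    proof
      assume "p < p'"
      then show ?thesis
        using less_iff(1) key[OF *(1)] key[OF *(2)]
        by (intro less_P_if_pos_key_less[of ?k s]) (simp add: less_P_def)
    next
      assume eq: "p = p' \<and> q < q'"
      then have "p \<notin> ?S" using single by auto
      then show ?thesis
        using dP[OF pair[OF p(1)] q_n[OF *(1)], of q'] q_n[OF *(2)] eq by (simp add: g_def)
    qed
    show "g (p, q) <\<^sub>V g (p', q')" if "app \<tau> p < app \<tau> p' \<or> p = p' \<and> app (?T p) q < app (?T p) q'"
      using that
    proof
      assume "app \<tau> p < app \<tau> p'"
      then show ?thesis
        using less_iff(2) key[OF *(1)] key[OF *(2)]
        by (intro less_V_if_val_key_less[of ?k s]) (simp add: less_V_def)
    next
      assume eq: "p = p' \<and> app (?T p) q < app (?T p) q'"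
      then have pS: "p \<notin> ?S" using single by auto
      have q: "q \<in> {1..n}" "q' \<in> {1..n}" "q \<in> {1..len (?T p)}" "q' \<in> {1..len (?T p)}"
        using q_n[OF *(1) pS] q_n[OF *(2)] pS eq * by (auto simp: block_index_def)
      note dV' = dV[OF pair[OF p(1) pS], folded T[OF p(1) pS]]
      have "d (r p) (c p) q <\<^sub>V d (r p) (c p) q'"
      proof (cases q q' rule: linorder_cases)
        case less
        then have "?T p \<notin> Decreasing"
          using eq q unfolding Decreasing_def monotone_on_def by force
        then show ?thesis using dV'[OF q(1,2) less] by blast
      next
        case greater
        then have "?T p \<notin> Increasing"
          using eq q unfolding Increasing_def monotone_on_def by force
        then show ?thesis using dV'[OF q(2,1) greater] by blast
      qed (use eq in simp)
      then show ?thesis using pS eq by (simp add: g_def)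
    qed
  qed
qed

section \<open>From avoided permutations to a defining formula\<close>

lemma finite_k_cycles: "finite {\<pi>. k_cycle k \<pi>}"
proof -
  have "{\<pi>. k_cycle k \<pi>} \<subseteq> FPerm k ` {f. f permutes {1..k}}"
  proof
    fix \<pi> assume "\<pi> \<in> {\<pi>. k_cycle k \<pi>}"
    then show "\<pi> \<in> FPerm k ` {f. f permutes {1..k}}"
      by (cases \<pi>) (auto simp: k_cycle_def is_perm_def)
  qed
  then show ?thesis by (rule finite_subset) (simp add: finite_permutations)
qed

lemma finite_nontrivial_cycles: "finite {is. nontrivial_cycle k is}"
proof -
  have "{is. nontrivial_cycle k is} \<subseteq> {is. set is \<subseteq> {1..k+1} \<and> length is \<le> k + 1}"
  proof (intro subsetI CollectI)
    fix "is" assume "is \<in> {is. nontrivial_cycle k is}"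
    then have *: "distinct is" "set is \<subseteq> {1..k+1}" by (auto simp: nontrivial_cycle_def)
    then have "card (set is) \<le> card {1..k+1}" by (intro card_mono) auto
    then show "set is \<subseteq> {1..k+1} \<and> length is \<le> k + 1" using * by (simp add: distinct_card)
  qed
  then show ?thesis by (rule finite_subset) (intro finite_lists_length_le, simp)
qed

text \<open>The triples of a \<open>k\<close>-cycle, a non-trivial cycle and a sequence of classes
  are finite in number. So one avoided witness is fixed for each of them beforehand, and a single
  \<open>n\<close> bounds the blocks of all; Ramsey's theorem turns \<open>n\<close> into
  \<open>N\<close>. Only when \<sigma> is given do its monotone sequences decide which sequence of
  classes, and hence which witness, embeds.\<close>

lemma ex_thin_cell:
  assumes closed: "perm_class \<C>"
    and avoids: "\<forall>\<pi> is \<X>. k_cycle k \<pi> \<longrightarrow> nontrivial_cycle k is \<longrightarrow> length \<X> = length is \<longrightarrow>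
      set \<X> \<subseteq> {Increasing, Decreasing} \<longrightarrow> \<not> expansion_class \<pi> is \<X> \<subseteq> \<C>"
  shows "\<exists>N. \<forall>\<sigma>\<in>\<C>. \<forall>\<pi> s is. k_cycle k \<pi> \<longrightarrow> occurrence \<pi> \<sigma> s \<longrightarrow> nontrivial_cycle k is \<longrightarrow>
    (\<exists>(i, j)\<in>cyc_pairs is. cell_matrix \<sigma> k s i j \<le> N)"
proof -
  define Q where "Q = {(\<pi>, is, \<X>). k_cycle k \<pi> \<and> nontrivial_cycle k is \<and> length \<X> = length is \<and>
    set \<X> \<subseteq> {Increasing, Decreasing}}"
  have "Q \<subseteq> (SIGMA \<pi>:{\<pi>. k_cycle k \<pi>}. SIGMA is:{is. nontrivial_cycle k is}.
      {\<X>. set \<X> \<subseteq> {Increasing, Decreasing} \<and> length \<X> = length is})"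
    by (auto simp: Q_def)
  then have "finite Q"
    by (rule finite_subset)
      (intro finite_SigmaI finite_k_cycles finite_nontrivial_cycles finite_lists_length_eq, simp)
  have "\<forall>x\<in>Q. \<exists>\<rho> \<Theta> \<omega>. is_perm \<rho> \<and> \<rho> \<notin> \<C> \<and> list_all2 (\<in>) \<Theta> (snd (snd x)) \<and>
      is_inflated_expansion (fst x) (fst (snd x)) \<Theta> \<omega> \<and> is_pattern_of \<rho> \<omega>"
  proof
    fix x assume "x \<in> Q"
    then have "\<not> expansion_class (fst x) (fst (snd x)) (snd (snd x)) \<subseteq> \<C>"
      using avoids by (auto simp: Q_def)
    then show "\<exists>\<rho> \<Theta> \<omega>. is_perm \<rho> \<and> \<rho> \<notin> \<C> \<and> list_all2 (\<in>) \<Theta> (snd (snd x)) \<and>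
        is_inflated_expansion (fst x) (fst (snd x)) \<Theta> \<omega> \<and> is_pattern_of \<rho> \<omega>"
      unfolding expansion_class_def by blast
  qed
  then obtain \<rho> \<Theta> \<omega> where wit: "\<And>x. x \<in> Q \<Longrightarrow> is_perm (\<rho> x) \<and> \<rho> x \<notin> \<C> \<and>
      list_all2 (\<in>) (\<Theta> x) (snd (snd x)) \<and> is_inflated_expansion (fst x) (fst (snd x)) (\<Theta> x) (\<omega> x) \<and>
      is_pattern_of (\<rho> x) (\<omega> x)"
    by metis
  \<comment> \<open>The element 0 keeps the maximum defined if there are no blocks.\<close>
  define n where "n = Max (insert 0 (len ` (\<Union>x\<in>Q. set (\<Theta> x))))"
  have n: "len \<theta> \<le> n" if "x \<in> Q" "\<theta> \<in> set (\<Theta> x)" for x \<theta>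
    unfolding n_def by (rule Max_ge) (use \<open>finite Q\<close> that in auto)
  obtain N where N: "\<forall>\<sigma> Z. is_perm \<sigma> \<longrightarrow> Z \<subseteq> elems \<sigma> \<longrightarrow> N \<le> card Z \<longrightarrow>
    (\<exists>d. (\<forall>q\<in>{1..n}. d q \<in> Z) \<and> monotone_points n d)"
    using ex_monotone_subsequence[of n] by (elim exE)
  show ?thesis
  proof (rule exI[of _ N], intro ballI allI impI, rule ccontr)
    fix \<sigma> \<pi> s "is"
    assume "\<sigma> \<in> \<C>" and \<pi>: "k_cycle k \<pi>" and occ: "occurrence \<pi> \<sigma> s" and cyc: "nontrivial_cycle k is"
      and no: "\<not> (\<exists>(i, j)\<in>cyc_pairs is. cell_matrix \<sigma> k s i j \<le> N)"
    have \<sigma>: "is_perm \<sigma>" using closed \<open>\<sigma> \<in> \<C>\<close> by (simp add: perm_class_def)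
    have k: "len \<pi> = k" "is_perm \<pi>" using \<pi> by (simp_all add: k_cycle_def)
    have "\<forall>ij\<in>cyc_pairs is. \<exists>d. (\<forall>q\<in>{1..n}. d q \<in> cell \<sigma> k s (fst ij) (snd ij)) \<and> monotone_points n d"
    proof
      fix ij assume "ij \<in> cyc_pairs is"
      then have "N < cell_matrix \<sigma> k s (fst ij) (snd ij)" using no by force
      then have "N \<le> card (cell \<sigma> k s (fst ij) (snd ij))" by (simp add: cell_matrix_def)
      moreover have "cell \<sigma> k s (fst ij) (snd ij) \<subseteq> elems \<sigma>" by (auto simp: cell_eq)
      ultimately show "\<exists>d. (\<forall>q\<in>{1..n}. d q \<in> cell \<sigma> k s (fst ij) (snd ij)) \<and> monotone_points n d"
        using N \<sigma> by blast
    qed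
    from bchoice[OF this] obtain e where e: "\<forall>ij\<in>cyc_pairs is.
        (\<forall>q\<in>{1..n}. e ij q \<in> cell \<sigma> k s (fst ij) (snd ij)) \<and> monotone_points n (e ij)" ..
    define d where "d = (\<lambda>i j. e (i, j))"
    have d_cell: "d i j q \<in> cell \<sigma> k s i j" if "(i, j) \<in> cyc_pairs is" "q \<in> {1..n}" for i j q
      using e that by (auto simp: d_def)
    have d: "(\<forall>q\<in>{1..n}. \<forall>q'\<in>{1..n}. q < q' \<longrightarrow> d i j q <\<^sub>P d i j q') \<and>
        ((\<forall>q\<in>{1..n}. \<forall>q'\<in>{1..n}. q < q' \<longrightarrow> d i j q <\<^sub>V d i j q') \<or>
         (\<forall>q\<in>{1..n}. \<forall>q'\<in>{1..n}. q < q' \<longrightarrow> d i j q' <\<^sub>V d i j q))"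
      if "(i, j) \<in> cyc_pairs is" for i j
      using e that unfolding monotone_points_def d_def by blast
    \<comment> \<open>The classes are read off from the cells in left-to-right order, i.e. sorted by column.\<close>
    define up where "up = (\<lambda>j. \<exists>i. (i, j) \<in> cyc_pairs is \<and>
      (\<forall>q\<in>{1..n}. \<forall>q'\<in>{1..n}. q < q' \<longrightarrow> d i j q <\<^sub>V d i j q'))"
    define cs where "cs = sorted_list_of_set (set is)"
    define \<X> where "\<X> = map (\<lambda>j. if up j then Increasing else Decreasing) cs"
    have len_cs: "length cs = length is"
      using distinct_card[OF nontrivial_cycleD(1)[OF cyc]] by (simp add: cs_def)
    then have len: "length \<X> = length is" by (simp add: \<X>_def)
    have "set \<X> \<subseteq> {Increasing, Decreasing}" by (auto simp: \<X>_def)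
    then have Q: "(\<pi>, is, \<X>) \<in> Q" using \<pi> cyc len by (simp add: Q_def)
    let ?x = "(\<pi>, is, \<X>)"
    note w = wit[OF Q, simplified]
    have \<Theta>_nth: "\<Theta> ?x ! m \<in> \<X> ! m" if "m < length is" for m
      using w that len by (simp add: list_all2_conv_all_nth)
    have \<Theta>_len: "length (\<Theta> ?x) = length is" using w len by (metis list_all2_lengthD)
    \<comment> \<open>The rank of a column is its index in the sorted list, so \<X> is numbered in
      the way in which \<open>card_left_of\<close> numbers the inflators.\<close>
    have cs_nth: "cs ! card {c \<in> set is. c < j} = j \<and> card {c \<in> set is. c < j} < length is"
      if j: "j \<in> set is" for j
    proof -
      have "j \<in> set cs" using j by (simp add: cs_def)
      then obtain m where m: "m < length cs" "cs ! m = j" by (auto simp: in_set_conv_nth)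
      have sorted: "sorted_wrt (<) cs" by (simp add: cs_def)
      have "{c \<in> set is. c < j} = set (take m cs)"
      proof (intro equalityI subsetI)
        fix c assume "c \<in> {c \<in> set is. c < j}"
        then have "c \<in> set cs" "c < j" by (auto simp: cs_def)
        then obtain l where l: "l < length cs" "cs ! l = c" by (auto simp: in_set_conv_nth)
        have "l < m"
        proof (rule ccontr)
          assume "\<not> l < m"
          then have "j \<le> c" using sorted_wrt_nth_less[OF sorted, of m l] l m by (cases "l = m") auto
          with \<open>c < j\<close> show False by simp
        qed
        then show "c \<in> set (take m cs)" using l m by (auto simp: in_set_conv_nth)
      next
        fix c assume "c \<in> set (take m cs)"
        then obtain l where l: "l < m" "cs ! l = c" using m by (auto simp: in_set_conv_nth)
        then have "c \<in> set cs" using m by auto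
        then show "c \<in> {c \<in> set is. c < j}"
          using sorted_wrt_nth_less[OF sorted, of l m] l m by (simp add: cs_def)
      qed
      moreover have "distinct cs" by (simp add: cs_def)
      ultimately have "card {c \<in> set is. c < j} = m" using m(1) by (simp add: distinct_card)
      then show ?thesis using m len_cs by simp
    qed
    have "is_pattern_of (\<omega> ?x) \<sigma>"
    proof (rule inflated_expansion_pattern_of[OF _ _ \<Theta>_len _ \<sigma> occ, where d = d and n = n])
      show "nontrivial_cycle (len \<pi>) is" using cyc k by simp
      show "is_inflated_expansion \<pi> is (\<Theta> ?x) (\<omega> ?x)" using w by simp
      show "is_perm \<theta> \<and> len \<theta> \<le> n" if \<theta>: "\<theta> \<in> set (\<Theta> ?x)" for \<theta>
      proof -
        obtain m where "m < length is" "\<theta> = \<Theta> ?x ! m" using \<theta> \<Theta>_len by (metis in_set_conv_nth)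
        then have "\<theta> \<in> Increasing \<union> Decreasing"
          using \<Theta>_nth[of m] len_cs by (auto simp: \<X>_def split: if_splits)
        then show ?thesis using n[OF Q \<theta>] by (auto simp: Increasing_def Decreasing_def)
      qed
      fix i j q q' assume ij: "(i, j) \<in> cyc_pairs is" and q: "q \<in> {1..n}"
      show "d i j q \<in> cell \<sigma> (len \<pi>) s i j" using d_cell[OF ij q] k by simp
      assume q': "q' \<in> {1..n}" "q < q'"
      show "d i j q <\<^sub>P d i j q'" using d[OF ij] q q' by blast
      let ?m = "card {c \<in> set is. c < j}"
      note m = cs_nth[OF cyc_pairs_subset(2)[OF ij]]
      have "\<Theta> ?x ! ?m \<in> (if up j then Increasing else Decreasing)"
        using \<Theta>_nth[of ?m] m len_cs by (simp add: \<X>_def)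
      moreover have "d i j q <\<^sub>V d i j q'" if "up j"
      proof -
        \<comment> \<open>\<open>up\<close> mentions the column only; the column determines the row
          of the cell on the cycle.\<close>
        from that obtain i' where i': "(i', j) \<in> cyc_pairs is"
          "\<forall>q\<in>{1..n}. \<forall>q'\<in>{1..n}. q < q' \<longrightarrow> d i' j q <\<^sub>V d i' j q'" unfolding up_def by blast
        have "i' = i" using cyc_pairs_fst_unique[OF nontrivial_cycleD(1)[OF cyc] i'(1) ij] .
        then show ?thesis using i'(2) q q' by blast
      qed
      moreover have "d i j q' <\<^sub>V d i j q" if "\<not> up j"
        using that d[OF ij] q q' ij unfolding up_def by blast
      ultimately show "\<Theta> ?x ! ?m \<in> Increasing \<and> d i j q <\<^sub>V d i j q' \<or>
          \<Theta> ?x ! ?m \<in> Decreasing \<and> d i j q' <\<^sub>V d i j q"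
        by (cases "up j") simp_all
    qed
    moreover have "is_perm (\<omega> ?x)"
      using w by (auto simp: is_inflated_expansion_def is_inflation_def)
    ultimately have "\<omega> ?x \<in> \<C>" using closed \<open>\<sigma> \<in> \<C>\<close> unfolding perm_class_def by blast
    then have "\<rho> ?x \<in> \<C>" using w closed unfolding perm_class_def by blast
    then show False using w by simp
  qed
qed

text \<open>A diagonal entry occurs once in the row sum and once in the column sum of its index.
  This removes from the formula the diagonal cells, for which there is no bound.\<close>

lemma balanced_off_diagonal:
  "balanced n (\<lambda>i j. if i = j then 0 else m i j) \<longleftrightarrow> balanced n m"
proof -
  have split: "(\<Sum>j\<in>{1..n}. f i j) = f i i + (\<Sum>j\<in>{1..n}. if i = j then 0 else f i j)" if "i \<in> {1..n}"
    for i and f :: "nat \<Rightarrow> nat \<Rightarrow> nat"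
  proof -
    have "(\<Sum>j\<in>{1..n}. f i j) = (\<Sum>j\<in>{1..n}. (if j = i then f i i else 0) + (if i = j then 0 else f i j))"
      by (rule sum.cong) auto
    also have "\<dots> = f i i + (\<Sum>j\<in>{1..n}. if i = j then 0 else f i j)"
      unfolding sum.distrib using that by (simp add: sum.delta)
    finally show ?thesis .
  qed
  have swap: "(\<Sum>j\<in>{1..n}. if j = i then 0 else m j i) = (\<Sum>j\<in>{1..n}. if i = j then 0 else m j i)" for i
    by (rule sum.cong) auto
  show ?thesis
    unfolding balanced_def
  proof (intro ball_cong refl)
    fix i assume "i \<in> {1..n}"
    then show "((\<Sum>j\<in>{1..n}. if i = j then 0 else m i j) = (\<Sum>j\<in>{1..n}. if j = i then 0 else m j i)) \<longleftrightarrow>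
        ((\<Sum>j\<in>{1..n}. m i j) = (\<Sum>j\<in>{1..n}. m j i))"
      unfolding swap using split[of i m] split[of i "\<lambda>i j. m j i"] by linarith
  qed
qed

text \<open>The formula guesses a sorting \<rho>, a pattern \<pi> and a table \<open>m\<close> of
  off-diagonal cell sizes from a finite list of balanced tables. A table on the list certifies
  stability, and by \<open>heavy_edge_bound\<close> each stable occurrence has its table on the
  list.\<close>

lemma cycles_definable_if_avoids:
  assumes closed: "perm_class \<C>" and "1 \<le> k"
    and avoids: "\<forall>\<pi> is \<X>. k_cycle k \<pi> \<longrightarrow> nontrivial_cycle k is \<longrightarrow> length \<X> = length is \<longrightarrow>
      set \<X> \<subseteq> {Increasing, Decreasing} \<longrightarrow> \<not> expansion_class \<pi> is \<X> \<subseteq> \<C>"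
  shows "\<exists>\<phi>. fv \<phi> \<subseteq> {1..k} \<and>
    (\<forall>\<sigma>\<in>\<C>. \<forall>a. a \<in> {1..k} \<rightarrow> elems \<sigma> \<longrightarrow> (sat \<sigma> a \<phi> \<longleftrightarrow> is_cycle_of \<sigma> k a))"
proof -
  let ?n = "Suc k" and ?P = "{\<rho>. \<rho> permutes {1..k}}" and ?Z = "{\<pi>. k_cycle k \<pi>}"
  obtain N where N: "\<forall>\<sigma>\<in>\<C>. \<forall>\<pi> s is. k_cycle k \<pi> \<longrightarrow> occurrence \<pi> \<sigma> s \<longrightarrow> nontrivial_cycle k is \<longrightarrow>
    (\<exists>(i, j)\<in>cyc_pairs is. cell_matrix \<sigma> k s i j \<le> N)"
    using ex_thin_cell[OF closed avoids] by (elim exE)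
  \<comment> \<open>The bound of \<open>heavy_edge_bound\<close> on \<open>k + 1\<close>
    vertices.\<close>
  define M where "M = N + ?n * ?n * N"
  define D where "D = {(i, j). i \<in> {1..?n} \<and> j \<in> {1..?n} \<and> i \<noteq> j}"
  have "finite D" by (rule finite_subset[of _ "{1..?n} \<times> {1..?n}"]) (auto simp: D_def)
  \<comment> \<open>Extensional functions, so that there are finitely many tables.\<close>
  define B where "B = {m \<in> D \<rightarrow>\<^sub>E {..M}. balanced ?n (\<lambda>i j. if i = j then 0 else m (i, j))}"
  have "finite B" unfolding B_def using \<open>finite D\<close> by (simp add: finite_PiE)
  define R where "R = (\<lambda>\<sigma> a. \<exists>\<rho>\<in>?P. \<exists>\<pi>\<in>?Z. \<exists>m\<in>B. occurrence \<pi> \<sigma> (a \<circ> \<rho>) \<and>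
    (\<forall>ij\<in>D. cell_matrix \<sigma> k (a \<circ> \<rho>) (fst ij) (snd ij) = m ij))"
  have "definable {1..k} R"
    unfolding R_def
  proof (intro definable_Bex definable_conj definable_Ball definable_cell_matrix_eq)
    show "finite ?P" by (simp add: finite_permutations)
    show "definable {1..k} (\<lambda>\<sigma> a. occurrence \<pi> \<sigma> (a \<circ> \<rho>))" if "\<rho> \<in> ?P" "\<pi> \<in> ?Z" for \<rho> \<pi>
      using definable_occurrence[of \<rho> \<pi>] that \<open>1 \<le> k\<close> by (simp add: k_cycle_def)
  qed (use \<open>finite D\<close> \<open>finite B\<close> finite_k_cycles \<open>1 \<le> k\<close> in auto)
  then obtain \<phi> where \<phi>: "fv \<phi> \<subseteq> {1..k}"
    "\<And>\<sigma> a. is_perm \<sigma> \<Longrightarrow> a \<in> {1..k} \<rightarrow> elems \<sigma> \<Longrightarrow> sat \<sigma> a \<phi> \<longleftrightarrow> R \<sigma> a"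
    unfolding definable_def by metis
  have "R \<sigma> a \<longleftrightarrow> is_cycle_of \<sigma> k a" if "\<sigma> \<in> \<C>" and a: "a \<in> {1..k} \<rightarrow> elems \<sigma>" for \<sigma> a
  proof -
    have \<sigma>: "is_perm \<sigma>" using closed \<open>\<sigma> \<in> \<C>\<close> by (simp add: perm_class_def)
    have "(\<exists>m\<in>B. \<forall>ij\<in>D. cell_matrix \<sigma> k s (fst ij) (snd ij) = m ij) \<longleftrightarrow> stable \<sigma> k s"
      if \<pi>: "k_cycle k \<pi>" and occ: "occurrence \<pi> \<sigma> s" for \<pi> s
    proof -
      let ?m = "cell_matrix \<sigma> k s"
      have stable: "stable \<sigma> k s \<longleftrightarrow> balanced ?n ?m"
        using stable_iff_balanced[OF \<sigma> _ occ] \<pi> by (simp add: k_cycle_def)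
      have bal: "balanced ?n (\<lambda>i j. if i = j then 0 else m (i, j)) \<longleftrightarrow> balanced ?n ?m"
        if "\<forall>ij\<in>D. ?m (fst ij) (snd ij) = m ij" for m
      proof -
        have "balanced ?n (\<lambda>i j. if i = j then 0 else m (i, j)) \<longleftrightarrow>
            balanced ?n (\<lambda>i j. if i = j then 0 else ?m i j)"
          unfolding balanced_def using that
          by (intro ball_cong refl arg_cong2[where f = "(=)"] sum.cong) (auto simp: D_def)
        then show ?thesis by (simp only: balanced_off_diagonal)
      qed
      show ?thesis
        unfolding stable
      proof
        assume "\<exists>m\<in>B. \<forall>ij\<in>D. ?m (fst ij) (snd ij) = m ij"
        then show "balanced ?n ?m" using bal by (auto simp: B_def)
      next
        assume b: "balanced ?n ?m"
        have "?m i j \<le> M" if "i \<in> {1..?n}" "j \<in> {1..?n}" "i \<noteq> j" for i j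
          unfolding M_def
        proof (rule heavy_edge_bound[OF b _ that])
          fix xs :: "nat list" assume "distinct xs" "set xs \<subseteq> {1..?n}" "2 \<le> length xs"
          then have "nontrivial_cycle k xs" by (simp add: nontrivial_cycle_def)
          then show "\<exists>(i, j)\<in>cyc_pairs xs. ?m i j \<le> N" using N \<open>\<sigma> \<in> \<C>\<close> \<pi> occ by blast
        qed
        then have "restrict (\<lambda>ij. ?m (fst ij) (snd ij)) D \<in> D \<rightarrow>\<^sub>E {..M}" by (auto simp: D_def)
        moreover have "\<forall>ij\<in>D. ?m (fst ij) (snd ij) = restrict (\<lambda>ij. ?m (fst ij) (snd ij)) D ij"
          by simp
        ultimately show "\<exists>m\<in>B. \<forall>ij\<in>D. ?m (fst ij) (snd ij) = m ij"
          using bal b unfolding B_def by blast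
      qed
    qed
    then show ?thesis unfolding R_def is_cycle_of_iff[OF \<sigma> a] by blast
  qed
  then have "\<forall>\<sigma>\<in>\<C>. \<forall>a. a \<in> {1..k} \<rightarrow> elems \<sigma> \<longrightarrow> (sat \<sigma> a \<phi> \<longleftrightarrow> is_cycle_of \<sigma> k a)"
    using \<phi>(2) closed by (simp add: perm_class_def)
  with \<phi>(1) show ?thesis by blast
qed

section \<open>Existence of expansions\<close>

lemma ex_rank_bij:
  fixes X :: "nat set"
  assumes "finite X"
  shows "\<exists>rk. bij_betw rk X {1..card X} \<and> (\<forall>x\<in>X. \<forall>y\<in>X. rk x < rk y \<longleftrightarrow> x < y)"
proof -
  define rk where "rk = (\<lambda>x. card {y \<in> X. y \<le> x})"
  have less: "rk x < rk y" if "y \<in> X" "x < y" for x y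
  proof -
    have "{z \<in> X. z \<le> x} \<subseteq> {z \<in> X. z \<le> y}" "y \<in> {z \<in> X. z \<le> y} - {z \<in> X. z \<le> x}"
      using that by auto
    then have "{z \<in> X. z \<le> x} \<subset> {z \<in> X. z \<le> y}" by blast
    then show ?thesis using assms by (simp add: rk_def psubset_card_mono)
  qed
  have iff: "rk x < rk y \<longleftrightarrow> x < y" if "x \<in> X" "y \<in> X" for x y
    using less[OF that(1), of y] less[OF that(2), of x] by (cases x y rule: linorder_cases) auto
  have inj: "inj_on rk X"
  proof (rule inj_onI)
    fix x y assume *: "x \<in> X" "y \<in> X" "rk x = rk y"
    have "\<not> x < y" using iff[OF *(1,2)] *(3) by simp
    moreover have "\<not> y < x" using iff[OF *(2,1)] *(3) by simp
    ultimately show "x = y" by simp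
  qed
  moreover have "rk ` X = {1..card X}"
  proof (rule card_subset_eq)
    show "rk ` X \<subseteq> {1..card X}"
    proof (rule image_subsetI)
      fix x assume "x \<in> X"
      then have "{y \<in> X. y \<le> x} \<noteq> {}" by auto
      then have "0 < rk x" using assms by (simp add: rk_def card_gt_0_iff)
      moreover have "rk x \<le> card X" unfolding rk_def using assms by (intro card_mono) auto
      ultimately show "rk x \<in> {1..card X}" by simp
    qed
    show "card (rk ` X) = card {1..card X}" using inj by (simp add: card_image)
  qed simp
  ultimately show ?thesis using iff by (auto simp: bij_betw_def)
qed

text \<open>The points of the expansion are represented by numbers: \<open>2 * j\<close> is the \<open>j\<close>-th point of the occurrence
  and \<open>2 * c - 1\<close> the new point in column \<open>c\<close>. The permutation acts on these by \<open>v\<close>.\<close>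

lemma ex_expansion:
  assumes \<pi>: "is_perm \<pi>" and cyc: "nontrivial_cycle (len \<pi>) is"
  shows "\<exists>\<tau> s. is_expansion \<pi> is \<tau> s"
proof -
  let ?k = "len \<pi>"
  note is_dist = nontrivial_cycleD(1)[OF cyc] and is_sub = nontrivial_cycleD(2)[OF cyc]
  have \<pi>_bij: "bij_betw (app \<pi>) {1..?k} {1..?k}" using \<pi> by (rule is_perm_bij)
  \<comment> \<open>Pairs are (row, column), so \<open>pred c\<close> is the row of the new point in
    column \<open>c\<close>.\<close>
  define pred where "pred = (\<lambda>c. THE i. (i, c) \<in> cyc_pairs is)"
  have pred_eq: "pred c = i" if "(i, c) \<in> cyc_pairs is" for i c
    unfolding pred_def using that cyc_pairs_fst_unique[OF is_dist] by blast
  have pred: "(pred c, c) \<in> cyc_pairs is" if "c \<in> set is" for c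
  proof -
    obtain i where "(i, c) \<in> cyc_pairs is" using \<open>c \<in> set is\<close> snd_cyc_pairs[of "is"] by force
    then show ?thesis using pred_eq by simp
  qed
  have pred_bij: "bij_betw pred (set is) (set is)"
  proof -
    have "inj_on pred (set is)"
    proof (rule inj_onI)
      fix c c' assume *: "c \<in> set is" "c' \<in> set is" "pred c = pred c'"
      have "(pred c, c') \<in> cyc_pairs is" using pred[OF *(2)] *(3) by simp
      then show "c = c'" using cyc_pairs_snd_unique[OF is_dist pred[OF *(1)]] by blast
    qed
    moreover have "pred ` set is \<subseteq> set is" using cyc_pairs_subset(1)[OF pred] by blast
    ultimately show ?thesis by (simp add: bij_betw_def endo_inj_surj)
  qed
  define X where "X = (\<lambda>j. 2 * j) ` {1..?k} \<union> (\<lambda>c. 2 * c - 1) ` set is"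
  have pos: "1 \<le> c" "c \<le> ?k + 1" if "c \<in> set is" for c using is_sub that by auto
  have odd_neq: "2 * c - 1 \<noteq> 2 * j" if "1 \<le> c" for c j :: nat using that by presburger
  have inj_odd: "inj_on (\<lambda>c::nat. 2 * c - 1) (set is)"
    using pos(1) by (fastforce intro!: inj_onI)
  have disj: "(\<lambda>j. 2 * j) ` {1..?k} \<inter> (\<lambda>c. 2 * c - 1) ` set is = {}"
  proof (rule equals0I)
    fix x assume "x \<in> (\<lambda>j. 2 * j) ` {1..?k} \<inter> (\<lambda>c. 2 * c - 1) ` set is"
    then obtain j c where "x = 2 * j" "x = 2 * c - 1" "c \<in> set is" by blast
    then show False using odd_neq[OF pos(1), of c j] by simp
  qed
  have "finite X" by (simp add: X_def)
  have "card X = ?k + length is"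
    unfolding X_def using disj inj_odd is_dist
    by (subst card_Un_disjoint) (auto simp: card_image inj_on_def distinct_card)
  \<comment> \<open>The code \<open>2 * i - 1\<close> of row \<open>i\<close> falls between the
    values \<open>i - 1\<close> and \<open>i\<close> of the occurrence, coded by
    \<open>2 * i - 2\<close> and \<open>2 * i\<close>.\<close>
  define v where "v = (\<lambda>x. if even x then 2 * app \<pi> (x div 2) else 2 * pred ((x + 1) div 2) - 1)"
  have v_even: "v (2 * j) = 2 * app \<pi> j" for j by (simp add: v_def)
  have v_odd: "v (2 * c - 1) = 2 * pred c - 1" if "1 \<le> c" for c
    using that by (simp add: v_def)
  \<comment> \<open>One set of codes serves for positions and values, since \<pi> permutes the even
    ones and \<open>pred\<close> the entries of the cycle.\<close>
  have v_bij: "bij_betw v X X"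
  proof -
    have "v ` X \<subseteq> X"
    proof (rule image_subsetI)
      fix x assume "x \<in> X"
      then consider j where "j \<in> {1..?k}" "x = 2 * j" | c where "c \<in> set is" "x = 2 * c - 1"
        unfolding X_def by blast
      then show "v x \<in> X"
      proof cases
        case 1
        then show ?thesis using is_permD[OF \<pi>] unfolding X_def by (simp only: v_even) blast
      next
        case 2
        then show ?thesis
          using bij_betwE[OF pred_bij] unfolding X_def by (simp only: v_odd[OF pos(1)]) blast
      qed
    qed
    moreover have "inj_on v X"
      unfolding X_def
    proof (rule inj_on_Un[THEN iffD2], intro conjI)
      show "inj_on v ((\<lambda>j. 2 * j) ` {1..?k})"
        using is_perm_app_eq_iff[OF \<pi>] by (auto intro!: inj_onI simp: v_even)
      show "inj_on v ((\<lambda>c. 2 * c - 1) ` set is)"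
      proof (rule inj_onI, elim imageE)
        fix x y c c' assume *: "v x = v y" "x = 2 * c - 1" "c \<in> set is" "y = 2 * c' - 1" "c' \<in> set is"
        then have "2 * pred c - 1 = 2 * pred c' - 1" by (simp only: v_odd[OF pos(1)])
        then have "pred c = pred c'"
          using inj_onD[OF inj_odd] cyc_pairs_subset(1)[OF pred] * by blast
        then show "x = y" using inj_onD[OF bij_betw_imp_inj_on[OF pred_bij]] * by blast
      qed
      have "v x \<noteq> v y" if "x \<in> (\<lambda>j. 2 * j) ` {1..?k}" "y \<in> (\<lambda>c. 2 * c - 1) ` set is" for x y
      proof -
        obtain j c where "x = 2 * j" "y = 2 * c - 1" "c \<in> set is" using \<open>x \<in> _\<close> \<open>y \<in> _\<close> by blast
        then show ?thesis
          using odd_neq[OF pos(1)[OF cyc_pairs_subset(1)[OF pred]], of c "app \<pi> j"]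
          by (simp only: v_even v_odd[OF pos(1)]) metis
      qed
      then show "v ` ((\<lambda>j. 2 * j) ` {1..?k} - (\<lambda>c. 2 * c - 1) ` set is) \<inter>
          v ` ((\<lambda>c. 2 * c - 1) ` set is - (\<lambda>j. 2 * j) ` {1..?k}) = {}" by blast
    qed
    ultimately show ?thesis using \<open>finite X\<close> by (simp add: bij_betw_def endo_inj_surj)
  qed
  let ?n = "?k + length is"
  \<comment> \<open>Ranks close the gaps at odd codes whose columns are not on the cycle.\<close>
  obtain rk where rk: "bij_betw rk X {1..?n}" and rk_less: "\<And>x y. x \<in> X \<Longrightarrow> y \<in> X \<Longrightarrow> rk x < rk y \<longleftrightarrow> x < y"
    using ex_rank_bij[OF \<open>finite X\<close>] unfolding \<open>card X = ?k + length is\<close> by blast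
  define f where "f = (\<lambda>i. if i \<in> {1..?n} then rk (v (the_inv_into X rk i)) else i)"
  have f: "f (rk x) = rk (v x)" if "x \<in> X" for x
    using that bij_betwE[OF rk] the_inv_into_f_f[OF bij_betw_imp_inj_on[OF rk]] by (auto simp: f_def)
  have "bij_betw (rk \<circ> (v \<circ> the_inv_into X rk)) {1..?n} {1..?n}"
    by (intro bij_betw_trans[OF bij_betw_trans[OF bij_betw_the_inv_into[OF rk] v_bij] rk])
  then have "bij_betw f {1..?n} {1..?n}"
    by (rule bij_betw_cong[THEN iffD1, rotated]) (auto simp: f_def)
  then have "f permutes {1..?n}" by (rule bij_imp_permutes) (auto simp: f_def)
  define \<tau> where "\<tau> = FPerm ?n f"
  have \<tau>: "is_perm \<tau>" "len \<tau> = ?n" "app \<tau> = f"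
    using \<open>f permutes {1..?n}\<close> by (simp_all add: \<tau>_def is_perm_def)
  define pt where "pt = (\<lambda>x. (rk x, rk (v x)))"
  have elems: "elems \<tau> = pt ` X"
  proof -
    have "elems \<tau> = (\<lambda>i. (i, f i)) ` rk ` X"
      using bij_betw_imp_surj_on[OF rk] by (auto simp: elems_def \<tau>)
    then show ?thesis using f by (auto simp: pt_def image_image)
  qed
  have pt_inj: "inj_on pt X"
    using bij_betw_imp_inj_on[OF rk] by (auto simp: pt_def inj_on_def)
  have vX: "v x \<in> X" if "x \<in> X" for x using bij_betwE[OF v_bij] that by blast
  define s where "s = (\<lambda>j. pt (2 * j))"
  have evenX: "2 * j \<in> X" if "j \<in> {1..?k}" for j using that by (auto simp: X_def)
  have oddX: "2 * c - 1 \<in> X" if "c \<in> set is" for c using that by (auto simp: X_def)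
  have occ: "occurrence \<pi> \<tau> s"
    unfolding occurrence_def
  proof (intro conjI ballI impI funcsetI)
    show "s j \<in> elems \<tau>" if "j \<in> {1..?k}" for j using evenX[OF that] by (simp add: s_def elems)
    fix i j assume ij: "i \<in> {1..?k}" "j \<in> {1..?k}"
    show "s i <\<^sub>P s j" if "i < j"
      using rk_less[OF evenX[OF ij(1)] evenX[OF ij(2)]] that by (simp add: s_def pt_def less_P_def)
    show "s i <\<^sub>V s j \<longleftrightarrow> app \<pi> i < app \<pi> j"
      using rk_less[OF vX[OF evenX[OF ij(1)]] vX[OF evenX[OF ij(2)]]]
      by (simp add: s_def pt_def less_V_def v_even)
  qed
  have stable: "stable \<tau> ?k s"
    unfolding stable_iff_app[OF \<tau>(1) \<pi> occ] by (simp add: s_def pt_def \<tau> f evenX v_even)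
  have rest: "elems \<tau> - s ` {1..?k} = pt ` (\<lambda>c. 2 * c - 1) ` set is"
  proof -
    have "s ` {1..?k} = pt ` (\<lambda>j. 2 * j) ` {1..?k}" by (simp add: s_def image_image)
    moreover have "X - (\<lambda>j. 2 * j) ` {1..?k} = (\<lambda>c. 2 * c - 1) ` set is"
      using disj by (auto simp: X_def)
    ultimately show ?thesis
      unfolding elems using inj_on_image_set_diff[OF pt_inj, of X "(\<lambda>j. 2 * j) ` {1..?k}"]
      by (simp add: X_def)
  qed
  have col: "col ?k s (pt (2 * c - 1)) = c" if c: "c \<in> set is" for c
  proof -
    have "s t <\<^sub>P pt (2 * c - 1) \<longleftrightarrow> t < c" if "t \<in> {1..?k}" for t
      using rk_less[OF evenX[OF that] oddX[OF c]] pos(1)[OF c] by (auto simp: s_def pt_def less_P_def)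
    then have "{t \<in> {1..?k}. s t <\<^sub>P pt (2 * c - 1)} = {1..<c}" using pos(2)[OF c] by auto
    then show ?thesis using pos(1)[OF c] by (simp add: col_def)
  qed
  have row: "row ?k s (pt (2 * c - 1)) = pred c" if c: "c \<in> set is" for c
  proof -
    note pc = cyc_pairs_subset(1)[OF pred[OF c]]
    have "s t <\<^sub>V pt (2 * c - 1) \<longleftrightarrow> app \<pi> t < pred c" if "t \<in> {1..?k}" for t
      using rk_less[OF vX[OF evenX[OF that]] vX[OF oddX[OF c]]] pos(1)[OF pc]
      unfolding s_def pt_def less_V_def v_even v_odd[OF pos(1)[OF c]] by auto
    then have "{t \<in> {1..?k}. s t <\<^sub>V pt (2 * c - 1)} = {t \<in> {1..?k}. app \<pi> t < pred c}" by auto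
    also have "card \<dots> = card {1..<pred c}"
    proof (rule bij_betw_same_card[of "app \<pi>"], unfold bij_betw_def, intro conjI)
      show "inj_on (app \<pi>) {t \<in> {1..?k}. app \<pi> t < pred c}"
        using bij_betw_imp_inj_on[OF \<pi>_bij] by (rule inj_on_subset) auto
      have "{1..<pred c} \<subseteq> app \<pi> ` {1..?k}"
        using bij_betw_imp_surj_on[OF \<pi>_bij] pos(2)[OF pc] by auto
      then show "app \<pi> ` {t \<in> {1..?k}. app \<pi> t < pred c} = {1..<pred c}"
        using is_permD[OF \<pi>] by auto
    qed
    finally show ?thesis using pos(1)[OF pc] by (simp add: row_def)
  qed
  have "cell_matrix \<tau> ?k s i j = cyc_matrix is i j" for i j
  proof -
    have "cell \<tau> ?k s i j = (\<lambda>c. pt (2 * c - 1)) ` {c \<in> set is. pred c = i \<and> c = j}"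
      unfolding cell_eq rest using row col by (auto simp: image_iff)
    also have "{c \<in> set is. pred c = i \<and> c = j} = (if (i, j) \<in> cyc_pairs is then {j} else {})"
      using pred pred_eq cyc_pairs_subset(2) by auto
    finally show ?thesis by (simp add: cell_matrix_def cyc_matrix_def cyc_pairs_def)
  qed
  then have "is_expansion \<pi> is \<tau> s"
    using \<tau> occ stable by (simp add: is_expansion_def)
  then show ?thesis by blast
qed

section \<open>Classes in which cycles are not definable\<close>

text \<open>A cut at \<open>c\<close> within the block of \<open>p0\<close> is a cut of that block
  at \<open>c - pos_offset T p0\<close>; earlier blocks stay in place and later ones move by
  one.\<close>

lemma shift_block_pos:
  assumes p0: "p0 \<in> {1..len \<tau>}"
    and eq: "\<And>p. p \<in> {1..len \<tau>} \<Longrightarrow> p \<noteq> p0 \<Longrightarrow> T' p = T p"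
    and len: "len (T' p0) = Suc (len (T p0))"
    and c: "pos_offset T p0 \<le> c" "c \<le> pos_offset T p0 + len (T p0)"
    and pq: "(p, q) \<in> block_index \<tau> T"
  shows "shift c (block_pos T (p, q)) =
      block_pos T' (p, if p = p0 then shift (c - pos_offset T p0) q else q)"
    and "(p, if p = p0 then shift (c - pos_offset T p0) q else q) \<in> block_index \<tau> T'"
proof -
  have p: "p \<in> {1..len \<tau>}" "q \<in> {1..len (T p)}" using pq by (auto simp: block_index_def)
  have offset: "pos_offset T' p = (if p \<le> p0 then pos_offset T p else Suc (pos_offset T p))"
  proof -
    have "pos_offset T' p = (\<Sum>p'\<in>{1..<p}. len (T p') + (if p' = p0 then 1 else 0))"
      unfolding pos_offset_def using p eq len by (intro sum.cong) auto
    also have "\<dots> = pos_offset T p + (\<Sum>p'\<in>{1..<p}. if p' = p0 then 1 else 0)"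
      by (simp only: sum.distrib pos_offset_def)
    also have "\<dots> = (if p \<le> p0 then pos_offset T p else Suc (pos_offset T p))"
      using p0 by (simp add: sum.delta')
    finally show ?thesis .
  qed
  show "shift c (block_pos T (p, q)) =
      block_pos T' (p, if p = p0 then shift (c - pos_offset T p0) q else q)"
  proof (cases p p0 rule: linorder_cases)
    case less
    then show ?thesis
      using pos_offset_less[of p p0 T] p c offset by (simp add: block_pos_def shift_def)
  next
    case equal
    then show ?thesis using c offset by (auto simp: block_pos_def shift_def)
  next
    case greater
    then show ?thesis
      using pos_offset_less[of p0 p T] p0 p c offset by (simp add: block_pos_def shift_def)
  qed
  show "(p, if p = p0 then shift (c - pos_offset T p0) q else q) \<in> block_index \<tau> T'"
    using p eq[of p] len by (auto simp: block_index_def shift_def)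
qed

text \<open>The order of values depends only on the order of indices and on the class, so members of
  different lengths are comparable.\<close>

lemma monotone_classes_less_iff:
  assumes X: "X \<in> {Increasing, Decreasing}" "\<theta> \<in> X" "\<theta>' \<in> X"
    and q: "q1 \<in> {1..len \<theta>}" "q2 \<in> {1..len \<theta>}" "r1 \<in> {1..len \<theta>'}" "r2 \<in> {1..len \<theta>'}"
    and iff: "q1 < q2 \<longleftrightarrow> r1 < r2" "q2 < q1 \<longleftrightarrow> r2 < r1"
  shows "app \<theta> q1 < app \<theta> q2 \<longleftrightarrow> app \<theta>' r1 < app \<theta>' r2"
proof -
  have inc: "app \<theta> a < app \<theta> b \<longleftrightarrow> a < b" if "\<theta> \<in> Increasing" "a \<in> {1..len \<theta>}" "b \<in> {1..len \<theta>}" for \<theta> a b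
  proof -
    have mono: "x < y \<Longrightarrow> app \<theta> x < app \<theta> y" if "x \<in> {1..len \<theta>}" "y \<in> {1..len \<theta>}" for x y
      using \<open>\<theta> \<in> Increasing\<close> that unfolding Increasing_def monotone_on_def by blast
    show ?thesis using mono[OF that(2,3)] mono[OF that(3,2)] by (cases a b rule: linorder_cases) auto
  qed
  have dec: "app \<theta> a < app \<theta> b \<longleftrightarrow> b < a" if "\<theta> \<in> Decreasing" "a \<in> {1..len \<theta>}" "b \<in> {1..len \<theta>}" for \<theta> a b
  proof -
    have mono: "x < y \<Longrightarrow> app \<theta> y < app \<theta> x" if "x \<in> {1..len \<theta>}" "y \<in> {1..len \<theta>}" for x y
      using \<open>\<theta> \<in> Decreasing\<close> that unfolding Decreasing_def monotone_on_def by blast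
    show ?thesis using mono[OF that(2,3)] mono[OF that(3,2)] by (cases a b rule: linorder_cases) auto
  qed
  from X(1) consider "X = Increasing" | "X = Decreasing" by blast
  then show ?thesis
  proof cases
    case 1
    then show ?thesis using inc X(2,3) q iff(1) by simp
  next
    case 2
    then show ?thesis using dec X(2,3) q iff(2) by simp
  qed
qed

text \<open>Supplies the hypothesis \<open>emb\<close> of \<open>sat_insert_point\<close>. In a
  monotone block it does not matter which point counts as the additional one, so one pair of
  inflations serves all cuts in the block.\<close>

lemma inflation_shift_less_iff:
  assumes \<tau>: "is_perm \<tau>" and T: "\<And>p. p \<in> {1..len \<tau>} \<Longrightarrow> is_perm (T p)"
    and \<omega>: "is_inflation \<tau> T \<omega>" and \<omega>': "is_inflation \<tau> T' \<omega>'"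
    and p0: "p0 \<in> {1..len \<tau>}"
    and eq: "\<And>p. p \<in> {1..len \<tau>} \<Longrightarrow> p \<noteq> p0 \<Longrightarrow> T' p = T p"
    and len: "len (T' p0) = Suc (len (T p0))"
    and X: "X \<in> {Increasing, Decreasing}" "T p0 \<in> X" "T' p0 \<in> X"
    and c: "pos_offset T p0 \<le> c" "c \<le> pos_offset T p0 + len (T p0)"
    and ij: "i \<in> {1..len \<omega>}" "j \<in> {1..len \<omega>}"
  shows "app \<omega> i < app \<omega> j \<longleftrightarrow> app \<omega>' (shift c i) < app \<omega>' (shift c j)"
proof -
  have T': "is_perm (T' p)" if "p \<in> {1..len \<tau>}" for p
  proof (cases "p = p0")
    case True
    then show ?thesis using X by (auto simp: Increasing_def Decreasing_def)
  next
    case False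
    then show ?thesis using T eq that by simp
  qed
  have "block_pos T ` block_index \<tau> T = {1..len \<omega>}"
    using bij_betw_imp_surj_on[OF bij_betw_block_pos[of T \<tau>]] \<omega> by (simp add: is_inflation_iff)
  with ij obtain p q p' q' where pq: "(p, q) \<in> block_index \<tau> T" "i = block_pos T (p, q)"
    and pq': "(p', q') \<in> block_index \<tau> T" "j = block_pos T (p', q')" by (metis imageE surj_pair)
  let ?s = "\<lambda>p q. if p = p0 then shift (c - pos_offset T p0) q else q"
  have sh: "shift c (block_pos T (p, q)) = block_pos T' (p, ?s p q)" "(p, ?s p q) \<in> block_index \<tau> T'"
    using shift_block_pos[where T = T and T' = T' and \<tau> = \<tau>, OF p0 _ len c pq(1)] eq by simp_all
  have sh': "shift c (block_pos T (p', q')) = block_pos T' (p', ?s p' q')" "(p', ?s p' q') \<in> block_index \<tau> T'"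
    using shift_block_pos[where T = T and T' = T' and \<tau> = \<tau>, OF p0 _ len c pq'(1)] eq by simp_all
  have inner: "app (T p) q < app (T p) q' \<longleftrightarrow> app (T' p) (?s p q) < app (T' p) (?s p q')" if "p = p'"
  proof (cases "p = p0")
    case True
    have "q \<in> {1..len (T p0)}" "q' \<in> {1..len (T p0)}" "?s p q \<in> {1..len (T' p0)}" "?s p q' \<in> {1..len (T' p0)}"
      using pq(1) pq'(1) sh(2) sh'(2) True that by (auto simp: block_index_def)
    from monotone_classes_less_iff[OF X this] show ?thesis using True by simp
  next
    case False
    then show ?thesis using eq[of p] pq(1) by (simp add: block_index_def)
  qed
  have "app \<omega> i < app \<omega> j \<longleftrightarrow> app \<tau> p < app \<tau> p' \<or> p = p' \<and> app (T p) q < app (T p) q'"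
    unfolding pq(2) pq'(2) by (rule inflation_less_iff[OF \<omega> \<tau> T pq(1) pq'(1)])
  also have "\<dots> \<longleftrightarrow> app \<tau> p < app \<tau> p' \<or> p = p' \<and> app (T' p) (?s p q) < app (T' p) (?s p' q')"
    using inner by blast
  also have "\<dots> \<longleftrightarrow> app \<omega>' (block_pos T' (p, ?s p q)) < app \<omega>' (block_pos T' (p', ?s p' q'))"
    by (rule inflation_less_iff[OF \<omega>' \<tau> T' sh(2) sh'(2), symmetric])
  finally show ?thesis unfolding pq(2) pq'(2) sh(1) sh'(1) .
qed

section \<open>Stability of the occurrence after inflation\<close>

definition inflated_occ :: "(nat \<Rightarrow> fperm) \<Rightarrow> fperm \<Rightarrow> (nat \<Rightarrow> elem) \<Rightarrow> nat \<Rightarrow> elem" where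
  "inflated_occ T \<omega> s j = (block_pos T (fst (s j), 1), app \<omega> (block_pos T (fst (s j), 1)))"

lemma occurrence_inflated_occ:
  assumes exp: "is_expansion \<pi> is \<tau> s" and T: "\<And>p. p \<in> {1..len \<tau>} \<Longrightarrow> is_perm (T p)"
    and T_S: "\<And>p. p \<in> positions (len \<pi>) s \<Longrightarrow> T p = FPerm 1 id" and \<omega>: "is_inflation \<tau> T \<omega>"
  shows "occurrence \<pi> \<omega> (inflated_occ T \<omega> s)"
proof -
  let ?k = "len \<pi>" and ?P = "\<lambda>j. fst (s j)"
  note \<tau> = expansionD(1)[OF exp] and occ = expansionD(3)[OF exp]
  have idx: "(?P j, 1) \<in> block_index \<tau> T" if "j \<in> {1..?k}" for j
    using elemsD(1)[OF occurrenceD(1)[OF occ that]] T_S[of "?P j"] that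
    by (auto simp: block_index_def positions_def)
  show ?thesis
    unfolding occurrence_def
  proof (intro conjI ballI impI funcsetI)
    fix i j assume ij: "i \<in> {1..?k}" "j \<in> {1..?k}"
    show "inflated_occ T \<omega> s i <\<^sub>P inflated_occ T \<omega> s j" if "i < j"
      using block_pos_less_iff[OF idx[OF ij(1)] idx[OF ij(2)]] occurrenceD(2)[OF occ ij] that
      by (simp add: inflated_occ_def less_P_def)
    show "inflated_occ T \<omega> s i <\<^sub>V inflated_occ T \<omega> s j \<longleftrightarrow> app \<pi> i < app \<pi> j"
      using inflation_less_iff[OF \<omega> \<tau> T idx[OF ij(1)] idx[OF ij(2)]] occurrenceD(3)[OF occ ij]
        elemsD(2)[OF occurrenceD(1)[OF occ ij(1)]] elemsD(2)[OF occurrenceD(1)[OF occ ij(2)]]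
      by (auto simp: inflated_occ_def less_V_def)
  next
    fix j assume "j \<in> {1..?k}"
    then show "inflated_occ T \<omega> s j \<in> elems \<omega>"
      using bij_betwE[OF bij_betw_block_pos[of T \<tau>]] idx[of j] \<omega>
      unfolding inflated_occ_def by (intro elemsI) (simp add: is_inflation_iff)
  qed
qed

text \<open>As the occurrence is stable in \<tau>, the numbers \<open>fst (s j)\<close> are its
  positions as well as its values. After inflation, a position counts the blocks to the left and a
  value the blocks below; both totals are taken at the common threshold
  \<open>fst (s j)\<close>.\<close>

lemma stable_inflated_occ_iff:
  assumes exp: "is_expansion \<pi> is \<tau> s" and \<pi>: "is_perm \<pi>"
    and T: "\<And>p. p \<in> {1..len \<tau>} \<Longrightarrow> is_perm (T p)"
    and T_S: "\<And>p. p \<in> positions (len \<pi>) s \<Longrightarrow> T p = FPerm 1 id" and \<omega>: "is_inflation \<tau> T \<omega>"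
  shows "stable \<omega> (len \<pi>) (inflated_occ T \<omega> s) \<longleftrightarrow>
    (\<forall>j\<in>{1..len \<pi>}. (\<Sum>p\<in>{p \<in> {1..len \<tau>}. app \<tau> p < fst (s j)}. len (T p)) =
                    (\<Sum>p\<in>{p \<in> {1..len \<tau>}. p < fst (s j)}. len (T p)))"
proof -
  let ?k = "len \<pi>" and ?P = "\<lambda>j. fst (s j)" and ?a = "inflated_occ T \<omega> s"
  let ?V = "\<lambda>b. \<Sum>p\<in>{p \<in> {1..len \<tau>}. app \<tau> p < b}. len (T p)"
  let ?O = "\<lambda>b. \<Sum>p\<in>{p \<in> {1..len \<tau>}. p < b}. len (T p)"
  note \<tau> = expansionD(1)[OF exp] and occ = expansionD(3)[OF exp]
  have \<omega>_perm: "is_perm \<omega>" using \<omega> by (simp add: is_inflation_def)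
  have P: "?P j \<in> {1..len \<tau>}" "?P j \<in> positions ?k s" if "j \<in> {1..?k}" for j
    using elemsD(1)[OF occurrenceD(1)[OF occ that]] that by (auto simp: positions_def)
  have idx: "(?P j, 1) \<in> block_index \<tau> T" if "j \<in> {1..?k}" for j
    using P[OF that] T_S[of "?P j"] by (auto simp: block_index_def)
  have comm: "app \<tau> (?P j) = ?P (app \<pi> j)" if "j \<in> {1..?k}" for j
    using expansionD(4)[OF exp] that unfolding stable_iff_app[OF \<tau> \<pi> occ] by blast
  have val: "app \<omega> (fst (?a j)) = Suc (?V (?P (app \<pi> j)))" if "j \<in> {1..?k}" for j
  proof -
    have "app \<omega> (fst (?a j)) = block_val \<tau> T (?P j, 1)"
      using idx[OF that] \<omega> by (simp add: inflated_occ_def is_inflation_iff)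
    also have "\<dots> = Suc (?V (?P (app \<pi> j)))"
      using T_S[OF P(2)[OF that]] by (simp add: block_val_def val_offset_def comm[OF that])
    finally show ?thesis .
  qed
  have pos: "fst (?a j) = Suc (?O (?P j))" if "j \<in> {1..?k}" for j
  proof -
    have "{1..<?P j} = {p \<in> {1..len \<tau>}. p < ?P j}" using P(1)[OF that] by auto
    then show ?thesis by (simp add: inflated_occ_def block_pos_def pos_offset_def)
  qed
  have "stable \<omega> ?k ?a \<longleftrightarrow> (\<forall>j\<in>{1..?k}. app \<omega> (fst (?a j)) = fst (?a (app \<pi> j)))"
    by (rule stable_iff_app[OF \<omega>_perm \<pi> occurrence_inflated_occ[OF exp T T_S \<omega>]])
  also have "\<dots> \<longleftrightarrow> (\<forall>j\<in>{1..?k}. ?V (?P (app \<pi> j)) = ?O (?P (app \<pi> j)))"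
  proof (intro ball_cong refl)
    fix j assume j: "j \<in> {1..?k}"
    show "app \<omega> (fst (?a j)) = fst (?a (app \<pi> j)) \<longleftrightarrow> ?V (?P (app \<pi> j)) = ?O (?P (app \<pi> j))"
      unfolding val[OF j] pos[OF is_permD[OF \<pi> j]] by simp
  qed
  also have "\<dots> \<longleftrightarrow> (\<forall>j\<in>app \<pi> ` {1..?k}. ?V (?P j) = ?O (?P j))" by blast
  also have "app \<pi> ` {1..?k} = {1..?k}" using is_perm_bij[OF \<pi>] by (simp add: bij_betw_def)
  finally show ?thesis .
qed

section \<open>Two inflations that differ in one point of one block\<close>

lemma ex_monotone_perm:
  assumes "X \<in> {Increasing, Decreasing}"
  shows "\<exists>\<theta>\<in>X. len \<theta> = n"
proof -
  have "FPerm n id \<in> Increasing"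
    by (auto simp: Increasing_def is_perm_def permutes_id monotone_on_def)
  moreover
  let ?f = "\<lambda>i. if i \<in> {1..n} then n + 1 - i else i"
  have "inj_on ?f {1..n}" "?f ` {1..n} \<subseteq> {1..n}" by (auto intro!: inj_onI)
  then have "bij_betw ?f {1..n} {1..n}"
    unfolding bij_betw_def using endo_inj_surj[OF finite_atLeastAtMost] by blast
  then have "?f permutes {1..n}" by (rule bij_imp_permutes) auto
  then have "FPerm n ?f \<in> Decreasing"
    by (auto simp: Decreasing_def is_perm_def monotone_on_def)
  ultimately show ?thesis using assms by (metis fperm.sel(1) insertE singletonD)
qed

lemma is_pattern_of_refl: "is_pattern_of \<omega> \<omega>"
  unfolding is_pattern_of_def occurrence_def
  by (rule exI[of _ "\<lambda>i. (i, app \<omega> i)"]) (auto simp: less_P_def less_V_def intro!: elemsI)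

lemma image_Collect_eq: "f ` A = B \<Longrightarrow> f ` {x \<in> A. P (f x)} = {y \<in> B. P y}"
  by blast

lemma stable_of_cycle:
  assumes "is_perm \<sigma>" "a \<in> {1..k} \<rightarrow> elems \<sigma>" "is_cycle_of \<sigma> k a"
  shows "stable \<sigma> k a"
proof -
  from assms obtain \<rho> where "\<rho> permutes {1..k}" "stable \<sigma> k (a \<circ> \<rho>)"
    using is_cycle_of_iff[OF assms(1,2)] by blast
  then show ?thesis by (simp add: stable_def positions_permute)
qed

text \<open>Lengthening a single block breaks stability: the row and the column of that block differ.\<close>

lemma not_stable_unequal_block:
  assumes exp: "is_expansion \<pi> is \<tau> s" and \<pi>: "is_perm \<pi>" and cyc: "nontrivial_cycle (len \<pi>) is"
    and p0: "p0 \<in> {1..len \<tau>} - positions (len \<pi>) s"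
    and eq: "\<forall>j\<in>{1..len \<pi>}. (\<Sum>p\<in>{p \<in> {1..len \<tau>}. app \<tau> p < fst (s j)}. L p) =
      (\<Sum>p\<in>{p \<in> {1..len \<tau>}. p < fst (s j)}. L p :: nat)"
  shows "\<exists>j\<in>{1..len \<pi>}. (\<Sum>p\<in>{p \<in> {1..len \<tau>}. app \<tau> p < fst (s j)}. L p + (if p = p0 then 1 else 0)) \<noteq>
      (\<Sum>p\<in>{p \<in> {1..len \<tau>}. p < fst (s j)}. L p + (if p = p0 then 1 else 0))"
proof (rule ccontr)
  let ?k = "len \<pi>" and ?P = "\<lambda>j. fst (s j)" and ?x = "(p0, app \<tau> p0)"
  note \<tau> = expansionD(1)[OF exp] and occ = expansionD(3)[OF exp]
  assume no: "\<not> ?thesis"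
  have eq': "(\<Sum>p\<in>{p \<in> {1..len \<tau>}. app \<tau> p < ?P j}. L p + (if p = p0 then 1 else 0)) =
      (\<Sum>p\<in>{p \<in> {1..len \<tau>}. p < ?P j}. L p + (if p = p0 then 1 else 0))" if j: "j \<in> {1..?k}" for j
  proof (rule ccontr)
    assume neq: "\<not> ?thesis"
    show False by (rule notE[OF no], rule bexI[of _ j], rule neq, rule j)
  qed
  \<comment> \<open>Both totals agree with and without the increment, so \<open>p0\<close> is
    counted on both sides or on neither.\<close>
  have iff: "app \<tau> p0 < ?P j \<longleftrightarrow> p0 < ?P j" if "j \<in> {1..?k}" for j
  proof -
    let ?V = "{p \<in> {1..len \<tau>}. app \<tau> p < ?P j}" and ?O = "{p \<in> {1..len \<tau>}. p < ?P j}"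
    have ind: "(\<Sum>p\<in>A. L p + (if p = p0 then 1 else 0)) = sum L A + of_bool (p0 \<in> A)"
      if "finite A" for A using that by (simp add: sum.distrib)
    have "of_bool (p0 \<in> ?V) = (of_bool (p0 \<in> ?O) :: nat)"
      using eq'[OF that] bspec[OF eq that] ind[of ?V] ind[of ?O] by (simp only: finite_Collect_conjI) simp
    then have "p0 \<in> ?V \<longleftrightarrow> p0 \<in> ?O" by (simp only: of_bool_eq_iff)
    then show ?thesis using p0 by blast
  qed
  have x: "?x \<in> elems \<tau>" using p0 by (intro elemsI) simp
  have s: "s \<in> {1..?k} \<rightarrow> elems \<tau>" using occ by (simp add: occurrence_def)
  have x_rest: "?x \<in> elems \<tau> - s ` {1..?k}"
    using in_positions_iff[OF s x] p0 x by simp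
  have comm: "app \<tau> (?P j) = ?P (app \<pi> j)" if "j \<in> {1..?k}" for j
    using expansionD(4)[OF exp] that unfolding stable_iff_app[OF \<tau> \<pi> occ] by blast
  have snd_s: "snd (s j) = ?P (app \<pi> j)" if "j \<in> {1..?k}" for j
    using elemsD(2)[OF occurrenceD(1)[OF occ that]] comm[OF that] by simp
  \<comment> \<open>By stability of the occurrence, \<open>fst (s j)\<close> is neither the position
    nor the value of the new point, so the comparison can be reversed.\<close>
  have less: "?P j < app \<tau> p0 \<longleftrightarrow> ?P j < p0" if j: "j \<in> {1..?k}" for j
  proof -
    have "?P j \<noteq> p0" using p0 that by (auto simp: positions_def)
    moreover have "?P j \<noteq> app \<tau> p0"
    proof
      assume *: "?P j = app \<tau> p0"
      have "j \<in> app \<pi> ` {1..?k}" using is_perm_bij[OF \<pi>] j by (simp add: bij_betw_def)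
      then obtain i where i: "i \<in> {1..?k}" "j = app \<pi> i" by blast
      then have "app \<tau> (?P i) = app \<tau> p0" using comm * by simp
      then have "?P i = p0" using is_perm_app_eq_iff[OF \<tau>] by blast
      then show False using p0 i(1) by (auto simp: positions_def)
    qed
    ultimately show ?thesis using iff[OF that] by linarith
  qed
  \<comment> \<open>As many occurrence values lie below the new point as occurrence positions lie to
    its left. Its cell is thus diagonal, which a cycle of length at least 2 does not allow.\<close>
  have "{t \<in> {1..?k}. s t <\<^sub>V ?x} = {t \<in> {1..?k}. ?P (app \<pi> t) < p0}"
  proof (rule Collect_cong, rule conj_cong[OF refl])
    fix t assume t: "t \<in> {1..?k}"
    show "s t <\<^sub>V ?x \<longleftrightarrow> ?P (app \<pi> t) < p0"
      unfolding less_V_def snd_conv snd_s[OF t] by (rule less[OF is_permD[OF \<pi> t]])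
  qed
  moreover have "app \<pi> ` {t \<in> {1..?k}. ?P (app \<pi> t) < p0} = {t \<in> {1..?k}. ?P t < p0}"
    by (rule image_Collect_eq[OF bij_betw_imp_surj_on[OF is_perm_bij[OF \<pi>]]])
  moreover have "inj_on (app \<pi>) A" for A using is_perm_app_eq_iff[OF \<pi>] by (auto intro: inj_onI)
  ultimately have "row ?k s ?x = col ?k s ?x"
    using card_image[of "app \<pi>" "{t \<in> {1..?k}. ?P (app \<pi> t) < p0}"]
    unfolding row_def col_def less_P_def fst_conv by simp
  then show False
    using cyc_pairs_neq[OF nontrivial_cycleD(1,3)[OF cyc] expansion_cell[OF exp x_rest]] by simp
qed

text \<open>The Boolean \<open>b\<close> selects one of two members of the class: all new blocks
  have length \<open>N\<close>, or the leftmost has one point more. The distinguished occurrence is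
  a cycle only in the former, yet \<phi> takes the same truth value on both.\<close>

lemma avoids_if_cycles_definable:
  assumes "fv \<phi> \<subseteq> {1..k}"
    and \<phi>: "\<And>\<sigma> a. \<sigma> \<in> \<C> \<Longrightarrow> a \<in> {1..k} \<rightarrow> elems \<sigma> \<Longrightarrow> sat \<sigma> a \<phi> \<longleftrightarrow> is_cycle_of \<sigma> k a"
    and cycle: "k_cycle k \<pi>" and cyc: "nontrivial_cycle k is"
    and len: "length \<X> = length is" and \<X>: "set \<X> \<subseteq> {Increasing, Decreasing}"
  shows "\<not> expansion_class \<pi> is \<X> \<subseteq> \<C>"
proof
  assume sub: "expansion_class \<pi> is \<X> \<subseteq> \<C>"
  have \<pi>: "is_perm \<pi>" and k: "len \<pi> = k" using cycle by (auto simp: k_cycle_def)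
  have cyc': "nontrivial_cycle (len \<pi>) is" using cyc k by simp
  obtain \<tau> s where exp: "is_expansion \<pi> is \<tau> s" using ex_expansion[OF \<pi> cyc'] by blast
  note \<tau> = expansionD(1)[OF exp] and occ = expansionD(3)[OF exp]
  let ?S = "positions k s" and ?d = "3 ^ qrank \<phi> :: nat"
  \<comment> \<open>Room for a cut in the middle of a block with the margin of
    \<open>sat_insert_point\<close> on both sides.\<close>
  define N where "N = 2 * ?d"
  define mono_perm where "mono_perm = (\<lambda>X n. SOME \<theta>. \<theta> \<in> X \<and> len \<theta> = n)"
  have mono_perm: "mono_perm X n \<in> X \<and> len (mono_perm X n) = n" if "X \<in> set \<X>" for X n
  proof -
    have "\<exists>\<theta>. \<theta> \<in> X \<and> len \<theta> = n" using ex_monotone_perm[of X n] that \<X> by blast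
    from someI_ex[OF this] show ?thesis by (simp add: mono_perm_def)
  qed
  define \<Theta> where "\<Theta> = (\<lambda>b. map (\<lambda>t. mono_perm (\<X> ! t) (if t = 0 \<and> b then Suc N else N)) [0..<length is])"
  define T where "T = (\<lambda>b. inflators ?S (\<Theta> b))"
  have T_S: "T b p = FPerm 1 id" if "p \<in> ?S" for b p using that by (simp add: T_def inflators_def)
  define R where "R = {1..len \<tau>} - ?S"
  have S_sub: "?S \<subseteq> {1..len \<tau>}"
    using elemsD(1)[OF occurrenceD(1)[OF occ]] k by (auto simp: positions_def)
  have card_S: "card ?S = k"
    using occurrence_inj_pos[OF occ] k by (simp add: positions_def image_image card_image)
  have finS: "finite ?S" by (simp add: positions_def)
  have card_R: "card R = length is"
    unfolding R_def using card_Diff_subset[OF finS S_sub] card_S expansionD(2)[OF exp] k by simp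
  have "R \<noteq> {}" using card_R nontrivial_cycleD(3)[OF cyc] by auto
  have "finite R" by (simp add: R_def)
  \<comment> \<open>The longer inflator has index 0 in the list, and that index belongs to the
    leftmost new point.\<close>
  define p0 where "p0 = Min R"
  have p0: "p0 \<in> R" using \<open>finite R\<close> \<open>R \<noteq> {}\<close> by (simp add: p0_def)
  define ix where "ix = (\<lambda>p. card ({1..<p} - ?S))"
  have ix_less: "ix p < length is" if "p \<in> R" for p
  proof -
    have "{1..<p} - ?S \<subset> R" using that by (auto simp: R_def)
    then have "ix p < card R" unfolding ix_def by (rule psubset_card_mono[OF \<open>finite R\<close>])
    then show ?thesis by (simp add: card_R)
  qed
  have ix_0: "ix p = 0 \<longleftrightarrow> p = p0" if "p \<in> R" for p
  proof
    assume "ix p = 0"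
    then have "p0 \<notin> {1..<p}" using p0 by (auto simp: ix_def R_def)
    then have "p \<le> p0" using p0 by (auto simp: R_def)
    then show "p = p0" using Min_le[OF \<open>finite R\<close> that] by (simp add: p0_def)
  next
    assume "p = p0"
    have "{1..<p0} - ?S = {}"
    proof (rule equals0I)
      fix q assume q: "q \<in> {1..<p0} - ?S"
      then have "q \<in> R" using p0 by (auto simp: R_def)
      then have "p0 \<le> q" unfolding p0_def by (rule Min_le[OF \<open>finite R\<close>])
      with q show False by simp
    qed
    then show "ix p = 0" using \<open>p = p0\<close> by (simp add: ix_def)
  qed
  have T_R: "T b p = mono_perm (\<X> ! ix p) (if p = p0 \<and> b then Suc N else N)" if "p \<in> R" for b p
    using that ix_less[OF that] ix_0[OF that] by (simp add: T_def inflators_def \<Theta>_def ix_def R_def)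
  have T_X: "T b p \<in> \<X> ! ix p" "len (T b p) = (if p = p0 \<and> b then Suc N else N)"
    "\<X> ! ix p \<in> {Increasing, Decreasing}" if "p \<in> R" for b p
  proof -
    have mem: "\<X> ! ix p \<in> set \<X>" using ix_less[OF that] len by simp
    then show "\<X> ! ix p \<in> {Increasing, Decreasing}" using \<X> by blast
    show "T b p \<in> \<X> ! ix p" "len (T b p) = (if p = p0 \<and> b then Suc N else N)"
      using mono_perm[OF mem] by (simp_all add: T_R[OF that])
  qed
  have T_perm: "is_perm (T b p)" if "p \<in> {1..len \<tau>}" for b p
  proof (cases "p \<in> ?S")
    case True
    then show ?thesis by (simp add: T_S is_perm_def permutes_id)
  next
    case False
    then have "p \<in> R" using that by (simp add: R_def)
    then show ?thesis using T_X(1)[of p b] T_X(3)[of p] by (auto simp: Increasing_def Decreasing_def)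
  qed
  have "\<exists>\<omega>. is_inflation \<tau> (T b) \<omega>" for b by (rule ex_inflation[OF \<tau>]) (rule T_perm)
  then obtain \<omega> where \<omega>: "\<And>b. is_inflation \<tau> (T b) (\<omega> b)" by metis
  have \<omega>_perm: "is_perm (\<omega> b)" for b using \<omega> by (simp add: is_inflation_def)
  have \<omega>_\<C>: "\<omega> b \<in> \<C>" for b
  proof -
    have "list_all2 (\<in>) (\<Theta> b) \<X>"
      using mono_perm len by (auto simp: list_all2_conv_all_nth \<Theta>_def)
    moreover have "is_inflated_expansion \<pi> is (\<Theta> b) (\<omega> b)"
      unfolding is_inflated_expansion_def using exp \<omega>[of b] k unfolding T_def by blast
    ultimately have "\<omega> b \<in> expansion_class \<pi> is \<X>"
      unfolding expansion_class_def using \<omega>_perm is_pattern_of_refl by blast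
    then show ?thesis using sub by blast
  qed
  define a where "a = (\<lambda>b. inflated_occ (T b) (\<omega> b) s)"
  have occ_a: "occurrence \<pi> (\<omega> b) (a b)" for b
    unfolding a_def by (rule occurrence_inflated_occ[OF exp _ _ \<omega>]) (use T_perm T_S k in blast)+
  then have a_elems: "a b \<in> {1..k} \<rightarrow> elems (\<omega> b)" for b using k by (simp add: occurrence_def)
  let ?V = "\<lambda>b j. \<Sum>p\<in>{p \<in> {1..len \<tau>}. app \<tau> p < fst (s j)}. len (T b p)"
  let ?O = "\<lambda>b j. \<Sum>p\<in>{p \<in> {1..len \<tau>}. p < fst (s j)}. len (T b p)"
  have stable: "stable (\<omega> b) k (a b) \<longleftrightarrow> (\<forall>j\<in>{1..k}. ?V b j = ?O b j)" for b
    unfolding a_def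
    using stable_inflated_occ_iff[where T = "T b", OF exp \<pi> _ _ \<omega>[of b]] T_perm T_S unfolding k by blast
  have bij: "bij_betw (app \<tau>) {1..len \<tau>} {1..len \<tau>}" using \<tau> by (rule is_perm_bij)
  have len_T: "len (T b p) = (if p \<in> ?S then 1 else N + (if p = p0 \<and> b then 1 else 0))"
    if "p \<in> {1..len \<tau>}" for b p
    using that T_S[of p b] T_X(2)[of p b] by (auto simp: R_def)
  have S_inv: "app \<tau> p \<in> ?S \<longleftrightarrow> p \<in> ?S" for p
  proof -
    have img: "app \<tau> ` ?S = ?S" using expansionD(4)[OF exp] k by (simp add: stable_def)
    have "app \<tau> p \<in> app \<tau> ` ?S \<longleftrightarrow> p \<in> ?S"
      using is_perm_app_eq_iff[OF \<tau>] by (auto simp: image_iff)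
    then show ?thesis by (simp only: img)
  qed
  \<comment> \<open>\<open>app \<tau>\<close> maps the blocks counted for values onto those counted
    for positions. It preserves the occurrence and hence the block lengths, which are 1 on the
    occurrence and \<open>N\<close> elsewhere.\<close>
  have V_O: "\<forall>j\<in>{1..k}. ?V False j = ?O False j"
  proof
    fix j
    let ?A = "{p \<in> {1..len \<tau>}. app \<tau> p < fst (s j)}"
    have inj: "inj_on (app \<tau>) ?A" using is_perm_app_eq_iff[OF \<tau>] by (auto intro: inj_onI)
    have "app \<tau> ` ?A = {p \<in> {1..len \<tau>}. p < fst (s j)}"
      by (rule image_Collect_eq[OF bij_betw_imp_surj_on[OF bij]])
    then have "?O False j = (\<Sum>p\<in>?A. len (T False (app \<tau> p)))"
      using sum.reindex[OF inj, of "\<lambda>p. len (T False p)"] by (simp add: comp_def)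
    also have "\<dots> = ?V False j"
    proof (rule sum.cong[OF refl])
      fix p assume "p \<in> ?A"
      then have p: "p \<in> {1..len \<tau>}" by blast
      show "len (T False (app \<tau> p)) = len (T False p)"
        using len_T[OF p, of False] len_T[OF is_permD[OF \<tau> p], of False] by (simp add: S_inv)
    qed
    finally show "?V False j = ?O False j" ..
  qed
  have "stable (\<omega> False) k (a False)" using stable V_O by blast
  moreover have "id permutes {1..k}" "a False \<circ> id = a False" by (simp_all add: permutes_id)
  ultimately have cycle_a: "is_cycle_of (\<omega> False) k (a False)"
    unfolding is_cycle_of_iff[OF \<omega>_perm a_elems] using cycle occ_a by metis
  have "\<not> stable (\<omega> True) k (a True)"
  proof -
    have "len (T True p) = len (T False p) + (if p = p0 then 1 else 0)" if "p \<in> {1..len \<tau>}" for p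
      using len_T[OF that] p0 by (auto simp: R_def)
    then have V: "?V True j = (\<Sum>p\<in>{p \<in> {1..len \<tau>}. app \<tau> p < fst (s j)}.
          len (T False p) + (if p = p0 then 1 else 0))"
      and O: "?O True j = (\<Sum>p\<in>{p \<in> {1..len \<tau>}. p < fst (s j)}.
          len (T False p) + (if p = p0 then 1 else 0))" for j
      by (auto intro!: sum.cong)
    show ?thesis
      unfolding stable V O
      using not_stable_unequal_block[OF exp \<pi> cyc', of p0 "\<lambda>p. len (T False p)"] V_O p0 k
      by (simp add: R_def)
  qed
  then have not_cycle_a: "\<not> is_cycle_of (\<omega> True) k (a True)"
    using stable_of_cycle[OF \<omega>_perm a_elems] by blast
  have p0_in: "p0 \<in> {1..len \<tau>}" using p0 by (simp add: R_def)
  have eq: "T True p = T False p" if "p \<in> {1..len \<tau>}" "p \<noteq> p0" for p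
    using that T_S[of p] T_R[of p] by (cases "p \<in> ?S") (auto simp: R_def)
  have len_p0: "len (T True p0) = Suc (len (T False p0))" using T_X(2)[OF p0] by simp
  let ?lo = "pos_offset (T False) p0"
  have len_N: "len (T False p0) = N" using T_X(2)[OF p0] by simp
  have len_\<omega>: "len (\<omega> b) = (\<Sum>p\<in>{1..len \<tau>}. len (T b p))" for b using \<omega> by (simp add: is_inflation_def)
  have "sat (\<omega> False) (a False) \<phi> \<longleftrightarrow> sat (\<omega> True) (a True) \<phi>"
  \<comment> \<open>The cut is in the middle of the block of \<open>p0\<close>. The free variables
    denote points outside this block, which are therefore far enough from the cut.\<close>
  proof (rule sat_insert_point[where lo = ?lo and hi = "?lo + N" and c = "?lo + ?d"])
    show "len (\<omega> True) = Suc (len (\<omega> False))"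
    proof -
      have "len (\<omega> True) = (\<Sum>p\<in>{1..len \<tau>}. len (T False p) + (if p = p0 then 1 else 0))"
        unfolding len_\<omega> using len_p0 eq by (intro sum.cong) auto
      then show ?thesis using p0_in by (simp add: len_\<omega> sum.distrib)
    qed
    show "?lo + N \<le> len (\<omega> False)"
    proof -
      have "?lo + N \<le> pos_offset (T False) (Suc (len \<tau>))"
        using pos_offset_less[of p0 "Suc (len \<tau>)" "T False"] p0_in len_N by simp
      then show ?thesis
        by (simp add: len_\<omega> pos_offset_def atLeastLessThanSuc_atLeastAtMost)
    qed
    show "app (\<omega> False) i < app (\<omega> False) j \<longleftrightarrow> app (\<omega> True) (shift c i) < app (\<omega> True) (shift c j)"
      if "?lo \<le> c" "c \<le> ?lo + N" "i \<in> {1..len (\<omega> False)}" "j \<in> {1..len (\<omega> False)}" for c i j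
    proof (rule inflation_shift_less_iff[OF \<tau> _ \<omega> \<omega> p0_in _ len_p0
          T_X(3)[OF p0] T_X(1)[OF p0] T_X(1)[OF p0] that(1) _ that(3,4)])
      show "c \<le> ?lo + len (T False p0)" using that(2) len_N by simp
    qed (rule T_perm, assumption | rule eq, assumption+)+
    show "?lo + 3 ^ qrank \<phi> \<le> ?lo + ?d" "?lo + ?d + 3 ^ qrank \<phi> \<le> ?lo + N" by (simp_all add: N_def)
    fix j assume "j \<in> fv \<phi>"
    then have j: "j \<in> {1..k}" using \<open>fv \<phi> \<subseteq> {1..k}\<close> by blast
    let ?p = "fst (s j)"
    have p: "?p \<in> {1..len \<tau>}" "?p \<in> ?S"
      using elemsD(1)[OF occurrenceD(1)[OF occ]] j k by (auto simp: positions_def)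
    have len1: "len (T False ?p) = 1" using T_S[OF p(2)] by simp
    have "?p \<noteq> p0" using p(2) p0 by (auto simp: R_def)
    have idx: "(?p, 1) \<in> block_index \<tau> (T False)" using p(1) len1 by (simp add: block_index_def)
    have fst_a: "fst (a b j) = block_pos (T b) (?p, 1)" for b by (simp add: a_def inflated_occ_def)
    have "fst (a True j) = shift (?lo + ?d) (fst (a False j))"
      using shift_block_pos(1)[where T = "T False" and T' = "T True", OF p0_in _ len_p0 _ _ idx, of "?lo + ?d"] eq \<open>?p \<noteq> p0\<close> len_N
      by (simp add: fst_a N_def)
    moreover have "fst (a False j) + 3 ^ qrank \<phi> \<le> ?lo + ?d \<or> ?lo + ?d + 3 ^ qrank \<phi> < fst (a False j)"
      using pos_offset_less[of ?p p0 "T False"] pos_offset_less[of p0 ?p "T False"] p(1) p0_in \<open>?p \<noteq> p0\<close>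
      by (cases ?p p0 rule: linorder_cases) (auto simp: fst_a block_pos_def len1 len_N N_def)
    ultimately show "a False j \<in> elems (\<omega> False) \<and> a True j \<in> elems (\<omega> True) \<and>
        fst (a True j) = shift (?lo + ?d) (fst (a False j)) \<and>
        (fst (a False j) + 3 ^ qrank \<phi> \<le> ?lo + ?d \<or> ?lo + ?d + 3 ^ qrank \<phi> < fst (a False j))"
      using funcset_mem[OF a_elems j] by blast
  qed
  then show False using cycle_a not_cycle_a \<phi>[OF \<omega>_\<C> a_elems] by blast
qed

theorem theorem5p6:
  fixes \<C> :: "fperm set" and k :: nat
  assumes "perm_class \<C>" and "k \<ge> 1"
  shows "(\<exists>\<phi>. fv \<phi> \<subseteq> {1..k} \<and>
            (\<forall>\<sigma>\<in>\<C>. \<forall>a. a \<in> {1..k} \<rightarrow> elems \<sigma> \<longrightarrow> (sat \<sigma> a \<phi> \<longleftrightarrow> is_cycle_of \<sigma> k a)))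
     \<longleftrightarrow>
         (\<forall>\<pi> is \<X>. k_cycle k \<pi> \<longrightarrow> nontrivial_cycle k is \<longrightarrow>
            length \<X> = length is \<longrightarrow> set \<X> \<subseteq> {Increasing, Decreasing} \<longrightarrow>
            \<not> expansion_class \<pi> is \<X> \<subseteq> \<C>)"
proof
  assume "\<exists>\<phi>. fv \<phi> \<subseteq> {1..k} \<and>
    (\<forall>\<sigma>\<in>\<C>. \<forall>a. a \<in> {1..k} \<rightarrow> elems \<sigma> \<longrightarrow> (sat \<sigma> a \<phi> \<longleftrightarrow> is_cycle_of \<sigma> k a))"
  then obtain \<phi> where \<phi>: "fv \<phi> \<subseteq> {1..k}"
    "\<And>\<sigma> a. \<sigma> \<in> \<C> \<Longrightarrow> a \<in> {1..k} \<rightarrow> elems \<sigma> \<Longrightarrow> sat \<sigma> a \<phi> \<longleftrightarrow> is_cycle_of \<sigma> k a"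
    by blast
  show "\<forall>\<pi> is \<X>. k_cycle k \<pi> \<longrightarrow> nontrivial_cycle k is \<longrightarrow> length \<X> = length is \<longrightarrow>
      set \<X> \<subseteq> {Increasing, Decreasing} \<longrightarrow> \<not> expansion_class \<pi> is \<X> \<subseteq> \<C>"
    by (intro allI impI avoids_if_cycles_definable[OF \<phi>])
next
  assume "\<forall>\<pi> is \<X>. k_cycle k \<pi> \<longrightarrow> nontrivial_cycle k is \<longrightarrow> length \<X> = length is \<longrightarrow>
      set \<X> \<subseteq> {Increasing, Decreasing} \<longrightarrow> \<not> expansion_class \<pi> is \<X> \<subseteq> \<C>"
  then show "\<exists>\<phi>. fv \<phi> \<subseteq> {1..k} \<and>
      (\<forall>\<sigma>\<in>\<C>. \<forall>a. a \<in> {1..k} \<rightarrow> elems \<sigma> \<longrightarrow> (sat \<sigma> a \<phi> \<longleftrightarrow> is_cycle_of \<sigma> k a))"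
    by (rule cycles_definable_if_avoids[OF assms])
qed

end
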